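(* Let $g=\max_{i\in\mathcal I}g_i$, $\mathcal S$, $c_\ell$, $\bm h=(h_1,\dots,h_J)$, $\bm\mu\in\mathbb R^J$, $\mathscr P$, $\bar{\mathcal S}$ and $\mathcal U_i$ be as specified in the context. Consider the following seven problems: $$\text{(P-UQ)}\quad \sup_{\mathbb P\in\mathscr P}\mathbb E_{\mathbb P}[g(\tilde{\bm z})],$$ $$\text{(D-UQ)}\quad \inf\Big\{\alpha+\bm\mu^\top\bm\beta\ \Big|\ \sup_{\bm z\in\bar{\mathcal S}}\{g(\bm z)-\alpha-\bm h(\bm z)^\top\bm\beta\}\le 0,\ \alpha\in\mathbb R,\ \bm\beta\in\mathbb R^J,\ \bm\beta\ge\bm 0\Big\},$$ $$\text{(FR)}\quad \sup\Big\{\sum_{i\in\mathcal I}\lambda_ig(\bm z_i)\ \Big|\ \sum_{i\in\mathcal I}\lambda_i=1,\ \sum_{i\in\mathcal I}\lambda_i\bm h(\bm z_i)\le\bm\mu,\ \bm z_i\in\bar{\mathcal S}\ \forall i\in\mathcal I,\ \bm\lambda\ge\bm 0\Big\},$$ $$\text{(AP-W)}\quad \inf\Big\{\alpha+\bm\mu^\top\bm\beta\ \Big|\ \sup_{(\bm z_i,\bm u_i,t_i)\in\mathcal U_i}\{t_i-\alpha-\bm u_i^\top\bm\beta\}\le 0\ \forall i\in\mathcal I,\ \alpha\in\mathbb R,\ \bm\beta\ge\bm 0\Big\},$$ $$\text{(AD-B)}\quad \sup\Big\{\sum_{i\in\mathcal I}\lambda_it_i\ \Big|\ \sum_{i\in\mathcal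 I}\lambda_i=1,\ \sum_{i\in\mathcal I}\lambda_i\bm u_i\le\bm\mu,\ (\bm z_i,\bm u_i,t_i)\in\mathcal U_i\ \forall i\in\mathcal I,\ \bm\lambda\ge\bm 0\Big\},$$ $$\text{(AP-W}'\text{)}\quad\begin{array}{cl}\inf&\alpha+\bm\mu^\top\bm\beta\\ \text{s.t.}&(-g_i)^*(\bm y_i^{(0)})+\sum_{j\in\mathcal J}\beta_jh_j^*\big(\bm y_{ij}^{(1)}/\beta_j\big)+\sum_{\ell\in\mathcal L}\nu_{i\ell}c_\ell^*\big(\bm y_{i\ell}^{(2)}/\nu_{i\ell}\big)\le\alpha\quad\forall i\in\mathcal I\\ &\bm y_i^{(0)}+\sum_{j\in\mathcal J}\bm y_{ij}^{(1)}+\sum_{\ell\in\mathcal L}\bm y_{i\ell}^{(2)}=\bm 0\quad\forall i\in\mathcal I\\ &\alpha\in\mathbb R,\ \bm\beta\ge\bm 0,\ \bm y_i^{(0)},\bm y_{ij}^{(1)},\bm y_{i\ell}^{(2)}\in\mathbb R^{d_{\bm z}},\ \nu_{i\ell}\ge0\quad(i\in\mathcal I,j\in\mathcal J,\ell\in\mathcal L),\end{array}$$ $$\text{(AD-B}'\text{)}\quad\begin{array}{cl}\sup&\sum_{i\in\mathcal I}\tau_i\\ \text{s.t.}&\sum_{i\in\mathcal I}\lambda_i=1,\quad\sum_{i\in\mathcal I}\bm\omega_i\le\bm\mu\\ &\lambda_ic_\ell(\bm\upsilon_i/\lambda_i)\le0\quad\forall i\in\mathcal I,\ \forall\ell\in\mathcal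 L\\ &\lambda_i\bm h(\bm\upsilon_i/\lambda_i)\le\bm\omega_i,\quad\lambda_ig_i(\bm\upsilon_i/\lambda_i)\ge\tau_i\quad\forall i\in\mathcal I\\ &\bm\tau\in\mathbb R^I,\ \bm\lambda\in\mathbb R^I,\ \bm\lambda\ge\bm 0,\ \bm\omega_i\in\mathbb R^J,\ \bm\upsilon_i\in\mathbb R^{d_{\bm z}}\ (i\in\mathcal I).\end{array}$$ Then the following hold. (i) If (AD-B$'$) admits a Slater point with $\bm\lambda>\bm 0$, then (AP-W$'$), (AP-W), (D-UQ), (P-UQ), (FR), (AD-B) and (AD-B$'$) all have the same optimal value and (AP-W$'$) is solvable. Also, if $(\alpha^\star,\bm\beta^\star,\{\bm y_i^{(0)\star}\}_i,\{\bm y_{ij}^{(1)\star}\}_{ij},\{\bm y_{i\ell}^{(2)\star},\nu_{i\ell}^\star\}_{i\ell})$ solves (AP-W$'$), then $(\alpha^\star,\bm\beta^\star)$ solves (D-UQ). (ii) If (AP-W$'$) admits a Slater point and $\mathcal S$ is bounded, then (AP-W$'$), (AP-W), (D-UQ), (P-UQ), (FR), (AD-B) and (AD-B$'$) all have the same optimal value and (AD-B$'$) is solvable. Also, if $(\bm\tau^\star,\bm\lambda^\star,\{\bm\omega_i^\star,\bm\upsilon_i^\star\}_i)$ solves (AD-B$'$), then the discrete distribution that assigns probability $\lambda_i^\star$ to the point $\bm\upsilon_i^\star/\lambda_i^\star$ for every $i\in\mathcal I$ with $\lambda_i^\star>0$ solves (P-UQ).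
   Context: $\overline{\mathbb R}=[-\infty,+\infty]$. For $f:\mathbb R^d\to\overline{\mathbb R}$: $\mathrm{dom}(f)=\{\bm x\mid f(\bm x)<+\infty\}$; $f$ is proper if $f>-\infty$ everywhere and $\mathrm{dom}(f)\neq\emptyset$; $f$ is closed if it is lower semicontinuous and either $f>-\infty$ everywhere or $f\equiv-\infty$; $f^*(\bm w)=\sup_{\bm x}\{\bm w^\top\bm x-f(\bm x)\}$. The support function of $\mathcal X$ is $\delta^*_{\mathcal X}(\bm w)=\sup_{\bm x\in\mathcal X}\bm x^\top\bm w$. Perspectives: for $f$ proper, closed and convex, $tf(\bm x/t)$ has its usual meaning for $t>0$, and for $t=0$ it denotes $\delta^*_{\mathrm{dom}(f^* )}(\bm x)$. If $-f$ is proper, closed and convex, then $tf(\bm x/t)$ at $t=0$ denotes $-\delta^*_{\mathrm{dom}((-f)^* )}(\bm x)$. Perspectives of vector functions are taken componentwise. Convex (concave) perspectives are defined for $t\ge 0$ and regarded as $+\infty$ ($-\infty$) for $t<0$ when domains are considered. Setting. Let $\mathcal I=\{1,\dots,I\}$, $\mathcal J=\{1,\dots,J\}$, $\mathcal L=\{1,\dots,L\}$. - $g(\bm z)=\max_{i\in\mathcal I}g_i(\bm z)$ with $g_i:\mathbb R^{d_{\bm z}}\to\overline{\mathbb R}$ such that $-g_i$ is proper, closed and convex for each $i\in\mathcal I$. - $\mathcal S=\{\bm z\in\mathbb R^{d_{\bm z}}\mid c_\ell(\bm z)\le 0\ \forall\ell\in\mathcal L\}$ is nonempty, with $c_\ell:\mathbb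 R^{d_{\bm z}}\to\overline{\mathbb R}$ proper, closed and convex. - $h_j:\mathbb R^{d_{\bm z}}\to\overline{\mathbb R}$ is proper, closed and convex for each $j\in\mathcal J$. - $\mathscr P=\{\mathbb P\in\mathscr P_0(\mathcal S)\mid\mathbb E_{\mathbb P}[\bm h(\tilde{\bm z})]\le\bm\mu\}$ is nonempty, where $\mathscr P_0(\mathcal S)$ is the set of all (Borel) probability distributions supported on $\mathcal S$. - $\bar{\mathcal S}_i=\{\bm z\in\mathcal S\mid\bm z\in\mathrm{dom}(h_j)\ \forall j\in\mathcal J,\ \bm z\in\mathrm{dom}(-g_i)\}$ is nonempty for every $i\in\mathcal I$, and $\bar{\mathcal S}=\bigcup_{i\in\mathcal I}\bar{\mathcal S}_i$. - $\mathcal U_i=\{(\bm z,\bm u,t)\in\mathbb R^{d_{\bm z}}\times\mathbb R^J\times\mathbb R\mid c_\ell(\bm z)\le 0\ \forall\ell\in\mathcal L,\ \bm h(\bm z)\le\bm u,\ g_i(\bm z)\ge t\}$ for $i\in\mathcal I$. Conventions: $\mathbb E_{\mathbb P}[g(\tilde{\bm z})]=-\infty$ if the positive and negative parts of $g(\tilde{\bm z})$ both have infinite expectation, and $\mathbb E_{\mathbb P}[h_j(\tilde{\bm z})]=+\infty$ if those of $h_j(\tilde{\bm z})$ both do. A solution of an optimization problem is feasible if it satisfies all constraints and its objective value is not $+\infty$ (minimization) or not $-\infty$ (maximization). A feasible problem is solvable if its optimal value is attained by a feasible solution; an infeasible problem is regarded as solved by any solution (hence solvable), and its optimal value is $+\infty$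 (minimization) or $-\infty$ (maximization). Slater points: let $\mathcal X=\{\bm x\mid q_i(\bm x)\le 0\ \forall i,\ r_j(\bm x)=0\ \forall j\}$ be a set with this given representation. $\bm x^{\rm S}$ is a Slater point of $\mathcal X$ if (a) it lies in $\mathrm{ri}(\mathrm{dom}(q_i))$ and $\mathrm{ri}(\mathrm{dom}(r_j))$ for all $i,j$, (b) $\bm x^{\rm S}\in\mathcal X$, and (c) $q_i(\bm x^{\rm S})<0$ for all $i$ such that $q_i$ is nonlinear. A Slater point of $\inf\{q_0(\bm x)\mid\bm x\in\mathcal X\}$ [respectively $\sup\{q_0(\bm x)\mid\bm x\in\mathcal X\}$] is a Slater point of $\mathcal X$ that lies in $\mathrm{ri}(\mathrm{dom}(q_0))$ [respectively $\mathrm{ri}(\mathrm{dom}(-q_0))$]. Here $\mathrm{ri}$ denotes relative interior, and linear means affine; the perspective of an affine function, being affine on $\{t\ge0\}$, is also regarded as linear. All inequality constraints are read in the form "(left-hand side minus right-hand side) $\le0$" (or with reversed sign for $\ge$), componentwise. *)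

theory Defs
  imports "HOL-Probability.Probability"
begin

section \<open>Extended-real-valued convex analysis\<close>

definition effective_domain :: "('a \<Rightarrow> ereal) \<Rightarrow> 'a set" where
  "effective_domain f = {x. f x < \<infinity>}"

definition proper_fun :: "('a \<Rightarrow> ereal) \<Rightarrow> bool" where
  "proper_fun f \<longleftrightarrow> (\<forall>x. - \<infinity> < f x) \<and> effective_domain f \<noteq> {}"

definition lsc_fun :: "('a::topological_space \<Rightarrow> ereal) \<Rightarrow> bool" where
  "lsc_fun f \<longleftrightarrow> (\<forall>x. f x \<le> Liminf (at x) f)"

definition closed_fun :: "('a::topological_space \<Rightarrow> ereal) \<Rightarrow> bool" where
  "closed_fun f \<longleftrightarrow> lsc_fun f \<and> ((\<forall>x. - \<infinity> < f x) \<or> (\<forall>x. f x = - \<infinity>))"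

definition convex_fun :: "('a::real_vector \<Rightarrow> ereal) \<Rightarrow> bool" where
  "convex_fun f \<longleftrightarrow> convex {(x, r::real). f x \<le> ereal r}"

definition pcc_fun :: "('a::real_normed_vector \<Rightarrow> ereal) \<Rightarrow> bool" where
  "pcc_fun f \<longleftrightarrow> proper_fun f \<and> closed_fun f \<and> convex_fun f"

definition conjugate :: "('a::real_inner \<Rightarrow> ereal) \<Rightarrow> 'a \<Rightarrow> ereal" where
  "conjugate f w = (SUP x. ereal (w \<bullet> x) - f x)"

definition support_fun :: "'a::real_inner set \<Rightarrow> 'a \<Rightarrow> ereal" where
  "support_fun X w = (SUP x\<in>X. ereal (x \<bullet> w))"

definition persp :: "('a::real_inner \<Rightarrow> ereal) \<Rightarrow> 'a \<Rightarrow> real \<Rightarrow> ereal" where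
  "persp f x t =
     (if t > 0 then ereal t * f (x /\<^sub>R t)
      else if t = 0 then support_fun (effective_domain (conjugate f)) x
      else \<infinity>)"

definition persp_concave :: "('a::real_inner \<Rightarrow> ereal) \<Rightarrow> 'a \<Rightarrow> real \<Rightarrow> ereal" where
  "persp_concave f x t =
     (if t > 0 then ereal t * f (x /\<^sub>R t)
      else if t = 0 then - support_fun (effective_domain (conjugate (\<lambda>z. - f z))) x
      else - \<infinity>)"


section \<open>Optimization problems\<close>

text \<open>A problem is given by the set \<open>X\<close> of points satisfying its constraints and an objective \<open>f\<close>.
  Every point solves an infeasible problem; feasibility requires an objective value other than
  \<open>\<infinity>\<close> (minimization) or \<open>- \<infinity>\<close> (maximization). In \<^typ>\<open>ereal\<close>, the infimum and the supremum
  over the empty set are \<open>\<infinity>\<close> and \<open>- \<infinity>\<close>.\<close>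

definition inf_value :: "'x set \<Rightarrow> ('x \<Rightarrow> ereal) \<Rightarrow> ereal" where
  "inf_value X f = (INF x\<in>X. f x)"

definition sup_value :: "'x set \<Rightarrow> ('x \<Rightarrow> ereal) \<Rightarrow> ereal" where
  "sup_value X f = (SUP x\<in>X. f x)"

definition solves_inf :: "'x set \<Rightarrow> ('x \<Rightarrow> ereal) \<Rightarrow> 'x \<Rightarrow> bool" where
  "solves_inf X f x \<longleftrightarrow>
     ((\<exists>y\<in>X. f y \<noteq> \<infinity>) \<longrightarrow> x \<in> X \<and> f x \<noteq> \<infinity> \<and> f x = inf_value X f)"

definition solves_sup :: "'x set \<Rightarrow> ('x \<Rightarrow> ereal) \<Rightarrow> 'x \<Rightarrow> bool" where
  "solves_sup X f x \<longleftrightarrow>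
     ((\<exists>y\<in>X. f y \<noteq> - \<infinity>) \<longrightarrow> x \<in> X \<and> f x \<noteq> - \<infinity> \<and> f x = sup_value X f)"

definition solvable_inf :: "'x set \<Rightarrow> ('x \<Rightarrow> ereal) \<Rightarrow> bool" where
  "solvable_inf X f \<longleftrightarrow> (\<exists>x. solves_inf X f x)"

definition solvable_sup :: "'x set \<Rightarrow> ('x \<Rightarrow> ereal) \<Rightarrow> bool" where
  "solvable_sup X f \<longleftrightarrow> (\<exists>x. solves_sup X f x)"


section \<open>Represented constraint sets and Slater points\<close>

text \<open>An inequality constraint \<open>q x \<le> 0\<close> is recorded as a pair \<open>(T, q)\<close>, where \<open>T\<close> collects the
  scalar variables (as coordinate functions) with respect to which perspectives are taken in \<open>q\<close>.
  Affine functions and sums of affine functions with perspectives of affine functions count as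
  linear; the latter are affine where all \<open>t \<in> T\<close> are nonnegative and \<open>\<infinity>\<close> elsewhere. For
  \<open>T = {}\<close> this is affinity on the whole space.\<close>

type_synonym 'x ineq = "('x \<Rightarrow> real) set \<times> ('x \<Rightarrow> ereal)"

definition regarded_linear :: "'x::real_vector ineq \<Rightarrow> bool" where
  "regarded_linear = (\<lambda>(T, q). \<exists>a b. linear a \<and>
     (\<forall>x. q x = (if \<forall>t\<in>T. 0 \<le> t x then ereal (a x + b) else \<infinity>)))"

definition constraint_set :: "'x ineq set \<Rightarrow> ('x \<Rightarrow> ereal) set \<Rightarrow> 'x set" where
  "constraint_set Q R = {x. (\<forall>(T, q)\<in>Q. q x \<le> 0) \<and> (\<forall>r\<in>R. r x = 0)}"

definition slater_point ::
  "'x::euclidean_space ineq set \<Rightarrow> ('x \<Rightarrow> ereal) set \<Rightarrow> 'x \<Rightarrow> bool" where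
  "slater_point Q R x \<longleftrightarrow>
     (\<forall>(T, q)\<in>Q. x \<in> rel_interior (effective_domain q)) \<and>
     (\<forall>r\<in>R. x \<in> rel_interior (effective_domain r)) \<and>
     x \<in> constraint_set Q R \<and>
     (\<forall>(T, q)\<in>Q. \<not> regarded_linear (T, q) \<longrightarrow> q x < 0)"

definition slater_point_inf ::
  "('x::euclidean_space \<Rightarrow> ereal) \<Rightarrow> 'x ineq set \<Rightarrow> ('x \<Rightarrow> ereal) set \<Rightarrow> 'x \<Rightarrow> bool" where
  "slater_point_inf q0 Q R x \<longleftrightarrow>
     slater_point Q R x \<and> x \<in> rel_interior (effective_domain q0)"

definition slater_point_sup ::
  "('x::euclidean_space \<Rightarrow> ereal) \<Rightarrow> 'x ineq set \<Rightarrow> ('x \<Rightarrow> ereal) set \<Rightarrow> 'x \<Rightarrow> bool" where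
  "slater_point_sup q0 Q R x \<longleftrightarrow>
     slater_point Q R x \<and> x \<in> rel_interior (effective_domain (\<lambda>y. - q0 y))"


section \<open>The uncertainty quantification problem\<close>

definition gmax :: "('i::finite \<Rightarrow> 'a \<Rightarrow> ereal) \<Rightarrow> 'a \<Rightarrow> ereal" where
  "gmax g z = Max (range (\<lambda>i. g i z))"

definition supp_set :: "('l \<Rightarrow> 'a \<Rightarrow> ereal) \<Rightarrow> 'a set" where
  "supp_set c = {z. \<forall>l. c l z \<le> 0}"

definition Sbar_i ::
  "('i \<Rightarrow> 'a \<Rightarrow> ereal) \<Rightarrow> ('l \<Rightarrow> 'a \<Rightarrow> ereal) \<Rightarrow> ('j \<Rightarrow> 'a \<Rightarrow> ereal) \<Rightarrow> 'i \<Rightarrow> 'a set" where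
  "Sbar_i g c h i = {z \<in> supp_set c. (\<forall>j. z \<in> effective_domain (h j)) \<and>
     z \<in> effective_domain (\<lambda>z. - g i z)}"

definition Sbar ::
  "('i \<Rightarrow> 'a \<Rightarrow> ereal) \<Rightarrow> ('l \<Rightarrow> 'a \<Rightarrow> ereal) \<Rightarrow> ('j \<Rightarrow> 'a \<Rightarrow> ereal) \<Rightarrow> 'a set" where
  "Sbar g c h = (\<Union>i. Sbar_i g c h i)"

definition Uset ::
  "('i \<Rightarrow> 'a \<Rightarrow> ereal) \<Rightarrow> ('l \<Rightarrow> 'a \<Rightarrow> ereal) \<Rightarrow> ('j::finite \<Rightarrow> 'a \<Rightarrow> ereal) \<Rightarrow> 'i
     \<Rightarrow> ('a \<times> (real^'j) \<times> real) set" where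
  "Uset g c h i = {(z, u, t). (\<forall>l. c l z \<le> 0) \<and> (\<forall>j. h j z \<le> ereal (u $ j)) \<and> ereal t \<le> g i z}"

text \<open>The first argument is the value assigned when the positive and the negative part both have
  infinite expectation; \<^const>\<open>e2ennreal\<close> maps negative numbers to \<open>0\<close>.\<close>

definition ext_expectation :: "ereal \<Rightarrow> 'a measure \<Rightarrow> ('a \<Rightarrow> ereal) \<Rightarrow> ereal" where
  "ext_expectation v M f =
     (let p = (\<integral>\<^sup>+ x. e2ennreal (f x) \<partial>M); n = (\<integral>\<^sup>+ x. e2ennreal (- f x) \<partial>M)
      in if p = \<infinity> \<and> n = \<infinity> then v else enn2ereal p - enn2ereal n)"

definition distributions_on :: "'a::topological_space set \<Rightarrow> 'a measure set" where
  "distributions_on S = {M. sets M = sets borel \<and> prob_space M \<and> emeasure M S = 1}"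

definition ambiguity_set ::
  "('l \<Rightarrow> 'a::topological_space \<Rightarrow> ereal) \<Rightarrow> ('j::finite \<Rightarrow> 'a \<Rightarrow> ereal) \<Rightarrow> real^'j
     \<Rightarrow> 'a measure set" where
  "ambiguity_set c h \<mu> =
     {M \<in> distributions_on (supp_set c). \<forall>j. ext_expectation \<infinity> M (h j) \<le> ereal (\<mu> $ j)}"

definition p_uq_obj :: "('i::finite \<Rightarrow> 'a \<Rightarrow> ereal) \<Rightarrow> 'a measure \<Rightarrow> ereal" where
  "p_uq_obj g M = ext_expectation (- \<infinity>) M (gmax g)"

definition ab_obj :: "real^'j::finite \<Rightarrow> real \<times> (real^'j) \<Rightarrow> ereal" where
  "ab_obj \<mu> = (\<lambda>(\<alpha>, \<beta>). ereal (\<alpha> + \<mu> \<bullet> \<beta>))"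

definition d_uq_set ::
  "('i::finite \<Rightarrow> 'a \<Rightarrow> ereal) \<Rightarrow> ('l \<Rightarrow> 'a \<Rightarrow> ereal) \<Rightarrow> ('j::finite \<Rightarrow> 'a \<Rightarrow> ereal)
     \<Rightarrow> (real \<times> (real^'j)) set" where
  "d_uq_set g c h = {(\<alpha>, \<beta>).
     (SUP z\<in>Sbar g c h. gmax g z - ereal \<alpha> - (\<Sum>j\<in>UNIV. h j z * ereal (\<beta> $ j))) \<le> 0 \<and>
     (\<forall>j. 0 \<le> \<beta> $ j)}"

definition fr_set ::
  "('i::finite \<Rightarrow> 'a \<Rightarrow> ereal) \<Rightarrow> ('l \<Rightarrow> 'a \<Rightarrow> ereal) \<Rightarrow> ('j::finite \<Rightarrow> 'a \<Rightarrow> ereal) \<Rightarrow> real^'j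
     \<Rightarrow> ((real^'i) \<times> ('a^'i)) set" where
  "fr_set g c h \<mu> = {(lam, z).
     (\<Sum>i\<in>UNIV. lam $ i) = 1 \<and>
     (\<forall>j. (\<Sum>i\<in>UNIV. ereal (lam $ i) * h j (z $ i)) \<le> ereal (\<mu> $ j)) \<and>
     (\<forall>i. z $ i \<in> Sbar g c h) \<and>
     (\<forall>i. 0 \<le> lam $ i)}"

definition fr_obj :: "('i::finite \<Rightarrow> 'a \<Rightarrow> ereal) \<Rightarrow> (real^'i) \<times> ('a^'i) \<Rightarrow> ereal" where
  "fr_obj g = (\<lambda>(lam, z). \<Sum>i\<in>UNIV. ereal (lam $ i) * gmax g (z $ i))"

definition ap_w_set ::
  "('i \<Rightarrow> 'a \<Rightarrow> ereal) \<Rightarrow> ('l \<Rightarrow> 'a \<Rightarrow> ereal) \<Rightarrow> ('j::finite \<Rightarrow> 'a \<Rightarrow> ereal)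
     \<Rightarrow> (real \<times> (real^'j)) set" where
  "ap_w_set g c h = {(\<alpha>, \<beta>).
     (\<forall>i. (SUP (z, u, t)\<in>Uset g c h i. ereal (t - \<alpha> - u \<bullet> \<beta>)) \<le> 0) \<and>
     (\<forall>j. 0 \<le> \<beta> $ j)}"

definition ad_b_set ::
  "('i::finite \<Rightarrow> 'a \<Rightarrow> ereal) \<Rightarrow> ('l \<Rightarrow> 'a \<Rightarrow> ereal) \<Rightarrow> ('j::finite \<Rightarrow> 'a \<Rightarrow> ereal) \<Rightarrow> real^'j
     \<Rightarrow> ((real^'i) \<times> ('a^'i) \<times> ((real^'j)^'i) \<times> (real^'i)) set" where
  "ad_b_set g c h \<mu> = {(lam, z, u, t).
     (\<Sum>i\<in>UNIV. lam $ i) = 1 \<and>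
     (\<forall>j. (\<Sum>i\<in>UNIV. lam $ i * u $ i $ j) \<le> \<mu> $ j) \<and>
     (\<forall>i. (z $ i, u $ i, t $ i) \<in> Uset g c h i) \<and>
     (\<forall>i. 0 \<le> lam $ i)}"

definition ad_b_obj :: "(real^'i::finite) \<times> ('a^'i) \<times> ((real^'j::finite)^'i) \<times> (real^'i) \<Rightarrow> ereal" where
  "ad_b_obj = (\<lambda>(lam, z, u, t). ereal (\<Sum>i\<in>UNIV. lam $ i * t $ i))"


subsection \<open>The finite convex program (AP-W')\<close>

text \<open>The variables are \<open>(\<alpha>, \<beta>, y0, y1, y2, \<nu>)\<close>.\<close>

type_synonym ('n, 'i, 'j, 'l) ap_w'_var =
  "real \<times> (real^'j) \<times> ((real^'n)^'i) \<times> ((real^'n)^'j^'i) \<times> ((real^'n)^'l^'i) \<times> (real^'l^'i)"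

definition ap_w'_obj ::
  "real^'j \<Rightarrow> ('n::finite, 'i::finite, 'j::finite, 'l::finite) ap_w'_var \<Rightarrow> ereal" where
  "ap_w'_obj \<mu> = (\<lambda>(\<alpha>, \<beta>, y0, y1, y2, \<nu>). ereal (\<alpha> + \<mu> \<bullet> \<beta>))"

definition ap_w'_ineqs ::
  "('i \<Rightarrow> real^'n \<Rightarrow> ereal) \<Rightarrow> ('l \<Rightarrow> real^'n \<Rightarrow> ereal) \<Rightarrow> ('j \<Rightarrow> real^'n \<Rightarrow> ereal)
     \<Rightarrow> ('n::finite, 'i::finite, 'j::finite, 'l::finite) ap_w'_var ineq set" where
  "ap_w'_ineqs g c h =
     range (\<lambda>i. (range (\<lambda>j (\<alpha>, \<beta>, y0, y1, y2, \<nu>). \<beta> $ j) \<union>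
                 range (\<lambda>l (\<alpha>, \<beta>, y0, y1, y2, \<nu>). \<nu> $ i $ l),
       \<lambda>(\<alpha>, \<beta>, y0, y1, y2, \<nu>).
         conjugate (\<lambda>z. - g i z) (y0 $ i)
         + (\<Sum>j\<in>UNIV. persp (conjugate (h j)) (y1 $ i $ j) (\<beta> $ j))
         + (\<Sum>l\<in>UNIV. persp (conjugate (c l)) (y2 $ i $ l) (\<nu> $ i $ l)) - ereal \<alpha>))
     \<union> range (\<lambda>j. ({}, \<lambda>(\<alpha>, \<beta>, y0, y1, y2, \<nu>). ereal (- (\<beta> $ j))))
     \<union> range (\<lambda>(i, l). ({}, \<lambda>(\<alpha>, \<beta>, y0, y1, y2, \<nu>). ereal (- (\<nu> $ i $ l))))"

definition ap_w'_eqs ::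
  "(('n::finite, 'i::finite, 'j::finite, 'l::finite) ap_w'_var \<Rightarrow> ereal) set" where
  "ap_w'_eqs = range (\<lambda>(i, k) (\<alpha>, \<beta>, y0, y1, y2, \<nu>).
     ereal ((y0 $ i + (\<Sum>j\<in>UNIV. y1 $ i $ j) + (\<Sum>l\<in>UNIV. y2 $ i $ l)) $ k))"

definition ap_w'_set ::
  "('i \<Rightarrow> real^'n \<Rightarrow> ereal) \<Rightarrow> ('l \<Rightarrow> real^'n \<Rightarrow> ereal) \<Rightarrow> ('j \<Rightarrow> real^'n \<Rightarrow> ereal)
     \<Rightarrow> ('n::finite, 'i::finite, 'j::finite, 'l::finite) ap_w'_var set" where
  "ap_w'_set g c h = constraint_set (ap_w'_ineqs g c h) ap_w'_eqs"

lemma mem_ap_w'_set_iff: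
  "(\<alpha>, \<beta>, y0, y1, y2, \<nu>) \<in> ap_w'_set g c h \<longleftrightarrow>
     (\<forall>i. conjugate (\<lambda>z. - g i z) (y0 $ i)
         + (\<Sum>j\<in>UNIV. persp (conjugate (h j)) (y1 $ i $ j) (\<beta> $ j))
         + (\<Sum>l\<in>UNIV. persp (conjugate (c l)) (y2 $ i $ l) (\<nu> $ i $ l)) \<le> ereal \<alpha>) \<and>
     (\<forall>i. y0 $ i + (\<Sum>j\<in>UNIV. y1 $ i $ j) + (\<Sum>l\<in>UNIV. y2 $ i $ l) = 0) \<and>
     (\<forall>j. 0 \<le> \<beta> $ j) \<and> (\<forall>i l. 0 \<le> \<nu> $ i $ l)"
proof -
  have *: "x - ereal a \<le> 0 \<longleftrightarrow> x \<le> ereal a" for x a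
    by (cases x) auto
  show ?thesis
    unfolding ap_w'_set_def constraint_set_def ap_w'_ineqs_def ap_w'_eqs_def
    by (simp add: ball_Un * vec_eq_iff zero_ereal_def[symmetric] split_paired_all) blast
qed


subsection \<open>The finite convex program (AD-B')\<close>

text \<open>The variables are \<open>(\<tau>, lam, \<omega>, \<upsilon>)\<close>.\<close>

type_synonym ('n, 'i, 'j) ad_b'_var = "(real^'i) \<times> (real^'i) \<times> ((real^'j)^'i) \<times> ((real^'n)^'i)"

definition ad_b'_obj :: "('n::finite, 'i::finite, 'j::finite) ad_b'_var \<Rightarrow> ereal" where
  "ad_b'_obj = (\<lambda>(\<tau>, lam, \<omega>, \<upsilon>). ereal (\<Sum>i\<in>UNIV. \<tau> $ i))"

definition ad_b'_ineqs ::
  "('i \<Rightarrow> real^'n \<Rightarrow> ereal) \<Rightarrow> ('l \<Rightarrow> real^'n \<Rightarrow> ereal) \<Rightarrow> ('j \<Rightarrow> real^'n \<Rightarrow> ereal) \<Rightarrow> real^'j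
     \<Rightarrow> ('n::finite, 'i::finite, 'j::finite) ad_b'_var ineq set" where
  "ad_b'_ineqs g c h \<mu> =
     range (\<lambda>j. ({}, \<lambda>(\<tau>, lam, \<omega>, \<upsilon>). ereal ((\<Sum>i\<in>UNIV. \<omega> $ i $ j) - \<mu> $ j)))
     \<union> range (\<lambda>(i, l). ({\<lambda>(\<tau>, lam, \<omega>, \<upsilon>). lam $ i},
         \<lambda>(\<tau>, lam, \<omega>, \<upsilon>). persp (c l) (\<upsilon> $ i) (lam $ i)))
     \<union> range (\<lambda>(i, j). ({\<lambda>(\<tau>, lam, \<omega>, \<upsilon>). lam $ i},
         \<lambda>(\<tau>, lam, \<omega>, \<upsilon>). persp (h j) (\<upsilon> $ i) (lam $ i) - ereal (\<omega> $ i $ j)))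
     \<union> range (\<lambda>i. ({\<lambda>(\<tau>, lam, \<omega>, \<upsilon>). lam $ i},
         \<lambda>(\<tau>, lam, \<omega>, \<upsilon>). ereal (\<tau> $ i) - persp_concave (g i) (\<upsilon> $ i) (lam $ i)))
     \<union> range (\<lambda>i. ({}, \<lambda>(\<tau>, lam, \<omega>, \<upsilon>). ereal (- (lam $ i))))"

definition ad_b'_eqs :: "(('n::finite, 'i::finite, 'j::finite) ad_b'_var \<Rightarrow> ereal) set" where
  "ad_b'_eqs = {\<lambda>(\<tau>, lam, \<omega>, \<upsilon>). ereal ((\<Sum>i\<in>UNIV. lam $ i) - 1)}"

definition ad_b'_set ::
  "('i \<Rightarrow> real^'n \<Rightarrow> ereal) \<Rightarrow> ('l \<Rightarrow> real^'n \<Rightarrow> ereal) \<Rightarrow> ('j \<Rightarrow> real^'n \<Rightarrow> ereal) \<Rightarrow> real^'j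
     \<Rightarrow> ('n::finite, 'i::finite, 'j::finite) ad_b'_var set" where
  "ad_b'_set g c h \<mu> = constraint_set (ad_b'_ineqs g c h \<mu>) ad_b'_eqs"

lemma mem_ad_b'_set_iff:
  "(\<tau>, lam, \<omega>, \<upsilon>) \<in> ad_b'_set g c h \<mu> \<longleftrightarrow>
     (\<Sum>i\<in>UNIV. lam $ i) = 1 \<and>
     (\<forall>j. (\<Sum>i\<in>UNIV. \<omega> $ i $ j) \<le> \<mu> $ j) \<and>
     (\<forall>i l. persp (c l) (\<upsilon> $ i) (lam $ i) \<le> 0) \<and>
     (\<forall>i j. persp (h j) (\<upsilon> $ i) (lam $ i) \<le> ereal (\<omega> $ i $ j)) \<and>
     (\<forall>i. ereal (\<tau> $ i) \<le> persp_concave (g i) (\<upsilon> $ i) (lam $ i)) \<and>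
     (\<forall>i. 0 \<le> lam $ i)"
proof -
  have 1: "x - ereal a \<le> 0 \<longleftrightarrow> x \<le> ereal a" for x a
    by (cases x) auto
  have 2: "ereal a - x \<le> 0 \<longleftrightarrow> ereal a \<le> x" for x a
    by (cases x) auto
  show ?thesis
    unfolding ad_b'_set_def constraint_set_def ad_b'_ineqs_def ad_b'_eqs_def
    by (auto simp add: ball_Un 1 2)
qed

text \<open>The discrete distribution with mass \<open>lam $ i\<close> at \<open>\<upsilon> $ i / lam $ i\<close> for all \<open>i\<close> with
  \<open>lam $ i > 0\<close>, as a Borel measure; masses at coinciding points add up.\<close>

definition discrete_distribution :: "real^'i::finite \<Rightarrow> (real^'n::finite)^'i \<Rightarrow> (real^'n) measure" where
  "discrete_distribution lam \<upsilon> =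
     distr (point_measure {i. 0 < lam $ i} (\<lambda>i. ennreal (lam $ i))) borel
       (\<lambda>i. (\<upsilon> $ i) /\<^sub>R (lam $ i))"

text \<open>The optimal values of (AP-W'), (AP-W), (D-UQ), (P-UQ), (FR), (AD-B) and (AD-B') coincide.\<close>

definition all_values_equal ::
  "('i::finite \<Rightarrow> real^'n::finite \<Rightarrow> ereal) \<Rightarrow> ('l::finite \<Rightarrow> real^'n \<Rightarrow> ereal)
     \<Rightarrow> ('j::finite \<Rightarrow> real^'n \<Rightarrow> ereal) \<Rightarrow> real^'j \<Rightarrow> bool" where
  "all_values_equal g c h \<mu> \<longleftrightarrow>
     inf_value (ap_w'_set g c h) (ap_w'_obj \<mu>) = inf_value (ap_w_set g c h) (ab_obj \<mu>) \<and>
     inf_value (ap_w_set g c h) (ab_obj \<mu>) = inf_value (d_uq_set g c h) (ab_obj \<mu>) \<and>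
     inf_value (d_uq_set g c h) (ab_obj \<mu>) = sup_value (ambiguity_set c h \<mu>) (p_uq_obj g) \<and>
     sup_value (ambiguity_set c h \<mu>) (p_uq_obj g) = sup_value (fr_set g c h \<mu>) (fr_obj g) \<and>
     sup_value (fr_set g c h \<mu>) (fr_obj g) = sup_value (ad_b_set g c h \<mu>) ad_b_obj \<and>
     sup_value (ad_b_set g c h \<mu>) ad_b_obj = sup_value (ad_b'_set g c h \<mu>) ad_b'_obj"

end

(* Weak duality gives AP-W' >= AP-W = D-UQ >= P-UQ >= FR >= AD-B <= AD-B' <= AP-W', so it suffices to
   show AD-B >= AP-W'. In perspective variables AD-B and AP-W' are linear programs over products of
   cones {(t x, t, t r) | t > 0, (x, r) in G}, where G is an epigraph (or the graph of an affine
   function), with finitely many linear constraints coupling the factors. Lagrange multipliers for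
   these constraints exist as soon as a feasible point lies in the relative interior of the product;
   inequalities need not be strict there. By homogeneity the Lagrangian is nonnegative on every factor
   separately, and on the cones of one problem this is feasibility for the other one (by the
   biconjugate theorem in the case AP-W' to AD-B'). If S is bounded, then weight 0 forces the point
   to be 0, so AD-B' and AD-B have the same value. *)

theory Submission
  imports Defs
begin

section \<open>Lagrange multipliers for affine constraints on a convex set\<close>

text \<open>Perspectives are awkward at weight zero, so the cones contain positive weights only. In
  the problem that carries the Slater point this costs nothing: in (i) positivity of the weights is
  assumed, and in (ii) it is forced, because the domains of the perspectives reach larger weights
  but no negative ones, so a point with a zero weight is not relatively interior. Cone points then
  still yield feasible points of the original problem, and its optimal value bounds the objective on
  them. In the problem that is being solved, weights may vanish. There a perspective inequality is
  read as a family of real linear inequalities indexed by an epigraph (of the conjugate, or of the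
  function itself), and that form is the same for zero and for positive weights; the multipliers
  deliver exactly this form. The second obstacle is that a Slater point may be tight in affine
  constraints. Over such a point the epigraph offers no core point that is low enough, whereas the
  graph does; this is why the cones are built over two kinds of sets and why the multiplier theorem
  has to cope with inequalities that are tight at the core point.\<close>

definition affine_map :: "('x::real_vector \<Rightarrow> 'y::real_vector) \<Rightarrow> bool" where
  "affine_map a \<longleftrightarrow> (\<forall>x y t. a ((1 - t) *\<^sub>R x + t *\<^sub>R y) = (1 - t) *\<^sub>R a x + t *\<^sub>R a y)"

lemma affine_mapD:
  "affine_map a \<Longrightarrow> a ((1 - t) *\<^sub>R x + t *\<^sub>R y) = (1 - t) *\<^sub>R a x + t *\<^sub>R a y"
  by (simp add: affine_map_def)

text \<open>A step beyond \<open>x\<close> is the affine combination with parameter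
  \<open>- e\<close>; \<open>affine_map\<close> admits every real parameter, not only those in the
  unit interval.\<close>

lemma affine_map_extrapolate:
  assumes "affine_map a"
  shows "a (x + e *\<^sub>R (x - y)) = a x + e *\<^sub>R (a x - a y)"
  using affine_mapD[OF assms, of "- e" x y] by (simp add: algebra_simps)

lemma affine_map_add:
  "affine_map a \<Longrightarrow> affine_map b \<Longrightarrow> affine_map (\<lambda>x. a x + b x)"
  by (simp add: affine_map_def scaleR_add_right add_ac)

lemma affine_map_mult_left:
  fixes a :: "'x::real_vector \<Rightarrow> real"
  shows "affine_map a \<Longrightarrow> affine_map (\<lambda>x. r * a x)"
  by (simp add: affine_map_def distrib_left mult.left_commute)

lemma affine_map_sum:
  "(\<And>k. k \<in> K \<Longrightarrow> affine_map (a k)) \<Longrightarrow> affine_map (\<lambda>x. \<Sum>k\<in>K. a k x)"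
  by (simp add: affine_map_def sum.distrib scaleR_sum_right)

lemma affine_map_inner_right:
  fixes a :: "'x::real_vector \<Rightarrow> 'y::real_inner"
  shows "affine_map a \<Longrightarrow> affine_map (\<lambda>x. w \<bullet> a x)"
  by (simp add: affine_map_def inner_add_right)

text \<open>The algebraic counterpart of the relative interior. It needs no topology, so the Lagrange
  multiplier theorem can be applied to sets in arbitrary real vector spaces.\<close>

definition intrinsic_core :: "'x::real_vector set \<Rightarrow> 'x set" where
  "intrinsic_core C = {x \<in> C. \<forall>y\<in>C. \<exists>e>0. x + e *\<^sub>R (x - y) \<in> C}"

lemma intrinsic_coreD:
  assumes "x \<in> intrinsic_core C" "y \<in> C"
  obtains e where "e > 0" "x + e *\<^sub>R (x - y) \<in> C"
  using assms by (auto simp: intrinsic_core_def)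

lemma intrinsic_core_subset: "x \<in> intrinsic_core C \<Longrightarrow> x \<in> C"
  by (simp add: intrinsic_core_def)

text \<open>Admissible steps can be shortened, so several of them can be replaced by their
  minimum.\<close>

lemma convex_extrapolation_mono:
  fixes x y :: "'x::real_vector"
  assumes "convex C" "x \<in> C" "x + e *\<^sub>R (x - y) \<in> C" "0 \<le> d" "d \<le> e"
  shows "x + d *\<^sub>R (x - y) \<in> C"
proof (cases "e = 0")
  case False
  then have e: "e > 0"
    using assms by simp
  have "(1 - d / e) *\<^sub>R x + (d / e) *\<^sub>R (x + e *\<^sub>R (x - y)) \<in> C"
    using assms e by (intro convexD_alt) auto
  also have "(1 - d / e) *\<^sub>R x + (d / e) *\<^sub>R (x + e *\<^sub>R (x - y)) = x + d *\<^sub>R (x - y)"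
    using e by (simp add: algebra_simps)
  finally show ?thesis .
qed (use assms in auto)

text \<open>The bridge from Slater points to the algebraic setting: a step from \<open>x\<close>
  away from \<open>y\<close> never leaves the affine hull, and a short one stays in the
  ball.\<close>

lemma rel_interior_subset_intrinsic_core:
  fixes S :: "'x::euclidean_space set"
  shows "rel_interior S \<subseteq> intrinsic_core S"
proof
  fix x assume x: "x \<in> rel_interior S"
  then obtain r where r: "x \<in> S" "r > 0" "ball x r \<inter> affine hull S \<subseteq> S"
    by (auto simp: mem_rel_interior_ball)
  have "\<exists>e>0. x + e *\<^sub>R (x - y) \<in> S" if y: "y \<in> S" for y
  proof -
    \<comment> \<open>The summand 1 keeps \<open>n\<close> positive when
      \<open>x = y\<close>.\<close>
    define n where "n = norm (x - y) + 1"
    define e where "e = r / (2 * n)"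
    have n: "n > 0"
      by (simp add: n_def add_nonneg_pos)
    have e: "e > 0"
      using r n by (simp add: e_def)
    have "e * norm (x - y) < r"
    proof -
      have "e * norm (x - y) \<le> e * n"
        using e by (simp add: n_def)
      also have "\<dots> = r / 2"
        using n by (simp add: e_def)
      finally show ?thesis
        using r by simp
    qed
    then have 1: "x + e *\<^sub>R (x - y) \<in> ball x r"
      using e by (simp add: dist_norm)
    have "(1 + e) *\<^sub>R x + (- e) *\<^sub>R y \<in> affine hull S"
      using r y by (intro mem_affine[OF affine_affine_hull]) (auto intro: hull_inc)
    then have 2: "x + e *\<^sub>R (x - y) \<in> affine hull S"
      by (simp add: algebra_simps)
    show ?thesis
      using e 1 2 r by blast
  qed
  then show "x \<in> intrinsic_core S"
    using r by (simp add: intrinsic_core_def)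
qed

text \<open>Used to move a core point towards a point at which some constraint is strict without
  leaving the core. To pass the midpoint away from \<open>z\<close>, combine \<open>y\<close> with a
  point beyond \<open>x\<close>.\<close>

lemma intrinsic_core_midpoint:
  assumes C: "convex C" and x: "x \<in> intrinsic_core C" and y: "y \<in> C"
  shows "(1 - 1 / 2) *\<^sub>R x + (1 / 2) *\<^sub>R y \<in> intrinsic_core C" (is "?m \<in> _")
proof -
  have "\<exists>e>0. ?m + e *\<^sub>R (?m - z) \<in> C" if z: "z \<in> C" for z
  proof -
    obtain d where d: "d > 0" "x + d *\<^sub>R (x - z) \<in> C"
      using intrinsic_coreD[OF x z] .
    \<comment> \<open>The weight \<open>p\<close> is chosen so that \<open>x\<close> and
      \<open>y\<close> receive equal coefficients: \<open>1 - p = p * (1 + d)\<close>. The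
      coefficient of \<open>z\<close> is then \<open>- (p * d)\<close>, which dictates
      \<open>e\<close>.\<close>
    define e where "e = d / (2 + d)"
    define p where "p = 1 / (2 + d)"
    have e: "e > 0" "e = p * d" and p: "0 \<le> p" "p \<le> 1" "2 * p = 1 - p * d"
      using d by (auto simp: e_def p_def field_simps)
    have "(1 - p) *\<^sub>R y + p *\<^sub>R (x + d *\<^sub>R (x - z)) \<in> C"
      using C y d p by (intro convexD_alt) auto
    moreover have "(1 - p) *\<^sub>R y + p *\<^sub>R (x + d *\<^sub>R (x - z)) = ?m + e *\<^sub>R (?m - z)"
    proof -
      have a: "1 - p = 1 / 2 + e * (1 / 2)" "p * (1 + d) = 1 / 2 + e * (1 / 2)"
        using p(3) by (simp_all add: e(2) algebra_simps)
      have "(1 - p) *\<^sub>R y + p *\<^sub>R (x + d *\<^sub>R (x - z))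
          = (1 - p) *\<^sub>R y + (p * (1 + d)) *\<^sub>R x - (p * d) *\<^sub>R z"
        by (simp add: algebra_simps)
      also have "\<dots> = (1 / 2 + e * (1 / 2)) *\<^sub>R y + (1 / 2 + e * (1 / 2)) *\<^sub>R x - e *\<^sub>R z"
        by (simp only: a e(2)[symmetric])
      also have "\<dots> = ?m + e *\<^sub>R (?m - z)"
        by (simp add: algebra_simps)
      finally show ?thesis .
    qed
    ultimately show ?thesis
      using e by auto
  qed
  moreover have "?m \<in> C"
    using C x y by (intro convexD_alt) (auto dest: intrinsic_core_subset)
  ultimately show ?thesis
    by (simp add: intrinsic_core_def)
qed

section \<open>Slices of a convex set by affine constraints\<close>

lemma intrinsic_core_Int_eq:
  assumes "x \<in> intrinsic_core C" "\<And>k. k \<in> K \<Longrightarrow> affine_map (a k)" "\<And>k. k \<in> K \<Longrightarrow> a k x = 0"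
  shows "x \<in> intrinsic_core {y \<in> C. \<forall>k\<in>K. a k y = 0}"
proof -
  have "\<exists>e>0. x + e *\<^sub>R (x - y) \<in> {y \<in> C. \<forall>k\<in>K. a k y = 0}" if y: "y \<in> C" "\<forall>k\<in>K. a k y = 0" for y
  proof -
    obtain e where "e > 0" "x + e *\<^sub>R (x - y) \<in> C"
      using intrinsic_coreD[OF assms(1) y(1)] .
    moreover have "a k (x + e *\<^sub>R (x - y)) = 0" if "k \<in> K" for k
      using affine_map_extrapolate[OF assms(2)[OF that]] assms(3)[OF that] y(2) that by simp
    ultimately show ?thesis by auto
  qed
  then show ?thesis
    using assms by (auto simp: intrinsic_core_def)
qed

lemma intrinsic_core_Int_less:
  fixes a :: "'x::real_vector \<Rightarrow> real"
  assumes C: "convex C" and x: "x \<in> intrinsic_core C" and a: "affine_map a" "a x < 0"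
  shows "x \<in> intrinsic_core {y \<in> C. a y \<le> 0}"
proof -
  have "\<exists>e>0. x + e *\<^sub>R (x - y) \<in> {y \<in> C. a y \<le> 0}" if y: "y \<in> C" for y
  proof -
    obtain e where e: "e > 0" "x + e *\<^sub>R (x - y) \<in> C"
      using intrinsic_coreD[OF x y] .
    \<comment> \<open>So short that \<open>a\<close> grows by at most \<open>- a x\<close> along the
      step; the summand 1 avoids division by zero.\<close>
    define d where "d = min e (- a x / (\<bar>a x - a y\<bar> + 1))"
    have d: "0 < d" "d \<le> e"
      using e a by (auto simp: d_def divide_neg_pos)
    have "d * (a x - a y) \<le> d * (\<bar>a x - a y\<bar> + 1)"
      using d by simp
    also have "\<dots> \<le> (- a x / (\<bar>a x - a y\<bar> + 1)) * (\<bar>a x - a y\<bar> + 1)"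
      by (intro mult_right_mono) (auto simp: d_def)
    also have "\<dots> = - a x"
      by simp
    finally have "a (x + d *\<^sub>R (x - y)) \<le> 0"
      using affine_map_extrapolate[OF a(1)] by simp
    then show ?thesis
      using d convex_extrapolation_mono[OF C intrinsic_core_subset[OF x] e(2)] by auto
  qed
  then show ?thesis
    using a x by (auto simp: intrinsic_core_def)
qed

lemma convex_Int_eq:
  assumes "convex C" "\<And>k. k \<in> K \<Longrightarrow> affine_map (a k)"
  shows "convex {y \<in> C. \<forall>k\<in>K. a k y = 0}"
  using assms by (auto simp: convex_alt affine_mapD)

lemma convex_Int_le:
  fixes a :: "'x::real_vector \<Rightarrow> real"
  assumes "convex C" "affine_map a"
  shows "convex {y \<in> C. a y \<le> 0}"
  using assms by (auto simp: convex_alt affine_mapD intro!: add_nonpos_nonpos mult_nonneg_nonpos)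

text \<open>The image of \<open>C\<close> under \<open>(a, l)\<close> is a convex planar set that
  misses the open lower half of the vertical axis. Hence the quotients \<open>- l x / a x\<close> on
  the side \<open>a x > 0\<close> lie below those on the side \<open>a x < 0\<close>, and any number
  in between serves as \<open>s\<close>.\<close>

lemma multiplier_both_signs:
  fixes a l :: "'x::real_vector \<Rightarrow> real"
  assumes C: "convex C" and a: "affine_map a" and l: "affine_map l"
    and nonneg: "\<And>x. x \<in> C \<Longrightarrow> a x = 0 \<Longrightarrow> 0 \<le> l x"
    and p: "p \<in> C" "0 < a p" and q: "q \<in> C" "a q < 0"
  obtains s where "\<And>x. x \<in> C \<Longrightarrow> 0 \<le> l x + s * a x"
proof -
  have slope: "- l x / a x \<le> - l y / a y" if x: "x \<in> C" "0 < a x" and y: "y \<in> C" "a y < 0" for x y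
  proof -
    \<comment> \<open>The point where the segment from \<open>x\<close> to \<open>y\<close> crosses
      the hyperplane \<open>a = 0\<close>.\<close>
    define t where "t = a x / (a x - a y)"
    have t: "0 \<le> t" "t \<le> 1" "1 - t = - a y / (a x - a y)"
      using x y by (auto simp: t_def field_simps)
    have "(1 - t) * a x + t * a y = 0"
      using x y by (simp add: t t_def field_simps)
    moreover have "(1 - t) *\<^sub>R x + t *\<^sub>R y \<in> C"
      using C x y t by (intro convexD_alt) auto
    ultimately have "0 \<le> (1 - t) * l x + t * l y"
      using nonneg affine_mapD[OF a] affine_mapD[OF l] by (metis real_scaleR_def)
    then have "0 \<le> (a x - a y) * ((1 - t) * l x + t * l y)"
      using x y by simp
    also have "\<dots> = ((a x - a y) * (1 - t)) * l x + ((a x - a y) * t) * l y"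
      by (simp only: distrib_left mult.assoc)
    also have "(a x - a y) * (1 - t) = - a y"
      using x y by (simp add: t(3))
    also have "(a x - a y) * t = a x"
      using x y by (simp add: t_def)
    finally show ?thesis
      using x y by (simp add: field_simps)
  qed
  define s where "s = (SUP x\<in>{x \<in> C. 0 < a x}. - l x / a x)"
  have bdd: "bdd_above ((\<lambda>x. - l x / a x) ` {x \<in> C. 0 < a x})"
    using slope q by (intro bdd_aboveI2) blast
  have "0 \<le> l x + s * a x" if x: "x \<in> C" for x
  proof -
    consider "a x = 0" | "0 < a x" | "a x < 0"
      by linarith
    then show ?thesis
    proof cases
      case 1
      then show ?thesis using nonneg x by simp
    next
      case 2
      then have "- l x / a x \<le> s"
        unfolding s_def using x bdd by (intro cSUP_upper) auto
      then show ?thesis using 2 by (simp add: field_simps)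
    next
      case 3
      then have "s \<le> - l x / a x"
        unfolding s_def using x p slope by (intro cSUP_least) auto
      then show ?thesis using 3 by (simp add: field_simps)
    qed
  qed
  then show ?thesis
    using that by blast
qed

text \<open>Unless \<open>a\<close> vanishes on \<open>C\<close>, it takes both signs there: if
  \<open>a x\<close> is nonzero, a step from \<open>z\<close> beyond \<open>x\<close> reverses the
  sign, since \<open>a z = 0\<close>.\<close>

lemma multiplier_eq:
  fixes a l :: "'x::real_vector \<Rightarrow> real"
  assumes C: "convex C" and z: "z \<in> intrinsic_core C" "a z = 0"
    and a: "affine_map a" and l: "affine_map l"
    and nonneg: "\<And>x. x \<in> C \<Longrightarrow> a x = 0 \<Longrightarrow> 0 \<le> l x"
  obtains s where "\<And>x. x \<in> C \<Longrightarrow> 0 \<le> l x + s * a x"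
proof (cases "\<forall>x\<in>C. a x = 0")
  case True
  then show ?thesis
    using that[of 0] nonneg by simp
next
  case False
  then obtain x where x: "x \<in> C" "a x \<noteq> 0" by blast
  obtain e where e: "e > 0" "z + e *\<^sub>R (z - x) \<in> C"
    using intrinsic_coreD[OF z(1) x(1)] .
  have ae: "a (z + e *\<^sub>R (z - x)) = - (e * a x)"
    using affine_map_extrapolate[OF a] z by simp
  show ?thesis
  proof (cases "0 < a x")
    case True
    have *: "a (z + e *\<^sub>R (z - x)) < 0"
      using ae e True by simp
    show ?thesis
      using multiplier_both_signs[OF C a l nonneg x(1) True e(2) *, of thesis] that by blast
  next
    case False
    then have "0 < a (z + e *\<^sub>R (z - x))" "a x < 0"
      using x e ae by (auto simp: mult_pos_neg)
    then show ?thesis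
      using multiplier_both_signs[OF C a l nonneg e(2) _ x(1), of thesis] that by blast
  qed
qed

text \<open>One equation is moved into the set, where \<open>z\<close> stays in the intrinsic core,
  and the others are handled by induction. Then the enlarged objective is again affine and the first
  equation gets its multiplier.\<close>

lemma multipliers_eq:
  fixes a :: "'k \<Rightarrow> 'x::real_vector \<Rightarrow> real"
  assumes "finite K" "convex C" "z \<in> intrinsic_core C" "\<And>k. k \<in> K \<Longrightarrow> affine_map (a k)"
    "\<And>k. k \<in> K \<Longrightarrow> a k z = 0" "affine_map l"
    "\<And>x. x \<in> C \<Longrightarrow> (\<And>k. k \<in> K \<Longrightarrow> a k x = 0) \<Longrightarrow> 0 \<le> l x"
  shows "\<exists>s. \<forall>x\<in>C. 0 \<le> l x + (\<Sum>k\<in>K. s k * a k x)"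
  using assms
proof (induction K arbitrary: C rule: finite_induct)
  case empty
  then show ?case by simp
next
  case (insert m K)
  \<comment> \<open>The quantifier over a singleton gives the slice the shape of
    \<open>convex_Int_eq\<close> and \<open>intrinsic_core_Int_eq\<close>.\<close>
  let ?C = "{y \<in> C. \<forall>k\<in>{m}. a m y = 0}"
  have "\<exists>s. \<forall>x\<in>?C. 0 \<le> l x + (\<Sum>k\<in>K. s k * a k x)"
    using insert.prems
    by (intro insert.IH convex_Int_eq intrinsic_core_Int_eq) auto
  then obtain s where s: "\<And>x. x \<in> C \<Longrightarrow> a m x = 0 \<Longrightarrow> 0 \<le> l x + (\<Sum>k\<in>K. s k * a k x)"
    by auto
  have aff: "affine_map (\<lambda>x. l x + (\<Sum>k\<in>K. s k * a k x))"
    using insert.prems by (intro affine_map_add affine_map_sum affine_map_mult_left) auto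
  obtain r where r: "\<And>x. x \<in> C \<Longrightarrow> 0 \<le> l x + (\<Sum>k\<in>K. s k * a k x) + r * a m x"
    using multiplier_eq[OF insert.prems(1,2) insert.prems(4)[of m] insert.prems(3)[of m] aff s]
    by (metis insertI1)
  have "(\<Sum>k\<in>insert m K. (s(m := r)) k * a k x) = r * a m x + (\<Sum>k\<in>K. s k * a k x)" for x
    using insert.hyps by (simp, intro sum.cong) auto
  then show ?case
    using r by (intro exI[of _ "s(m := r)"]) (auto simp: algebra_simps)
qed

lemma multiplier_le:
  fixes a l :: "'x::real_vector \<Rightarrow> real"
  assumes C: "convex C" and z: "z \<in> C" "a z < 0"
    and a: "affine_map a" and l: "affine_map l"
    and nonneg: "\<And>x. x \<in> C \<Longrightarrow> a x \<le> 0 \<Longrightarrow> 0 \<le> l x"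
  obtains s where "0 \<le> s" "\<And>x. x \<in> C \<Longrightarrow> 0 \<le> l x + s * a x"
proof (cases "\<forall>x\<in>C. a x \<le> 0")
  case True
  then show ?thesis
    using that[of 0] nonneg by simp
next
  case False
  then obtain p where p: "p \<in> C" "0 < a p"
    by force
  obtain s where s: "\<And>x. x \<in> C \<Longrightarrow> 0 \<le> l x + s * a x"
    using multiplier_both_signs[OF C a l nonneg p z] by auto
  show ?thesis
  proof (cases "0 \<le> s")
    case True
    then show ?thesis using s that by blast
  next
    \<comment> \<open>A negative \<open>s\<close> can be replaced by 0: where
      \<open>a x > 0\<close>, it already makes \<open>l x\<close> nonnegative.\<close>
    case False
    have "0 \<le> l x" if x: "x \<in> C" for x
    proof (cases "a x \<le> 0")
      case True
      then show ?thesis using nonneg x by simp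
    next
      case False
      then have "s * a x \<le> 0"
        using \<open>\<not> 0 \<le> s\<close> by (simp add: mult_nonpos_nonneg)
      then show ?thesis using s[OF x] by simp
    qed
    then show ?thesis using that[of 0] by simp
  qed
qed

text \<open>A minimum of an affine function at a core point forces it to be constant, since a
  decrease on one side is an increase on the other.\<close>

lemma affine_map_nonneg_zero_core:
  fixes a :: "'x::real_vector \<Rightarrow> real"
  assumes "z \<in> intrinsic_core C" "affine_map a" "\<And>x. x \<in> C \<Longrightarrow> 0 \<le> a x" "a z \<le> 0" "x \<in> C"
  shows "a x = 0"
proof -
  obtain e where e: "e > 0" "z + e *\<^sub>R (z - x) \<in> C"
    using intrinsic_coreD[OF assms(1,5)] .
  have z: "a z = 0"
    using assms(3)[OF intrinsic_core_subset[OF assms(1)]] assms(4) by simp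
  have "0 \<le> a z + e * (a z - a x)"
    using assms(3)[OF e(2)] affine_map_extrapolate[OF assms(2)] by simp
  then have "e * a x \<le> 0"
    using z by simp
  then have "a x \<le> 0"
    using e by (simp add: mult_le_0_iff)
  then show ?thesis
    using assms(3)[OF assms(5)] by simp
qed

text \<open>The constraints need not be strict at \<open>z\<close>. If no feasible point of the intrinsic core makes
  any of them strict, then a nontrivial nonnegative combination of them vanishes on \<open>C\<close>. Those that
  occur in it are treated as equalities, and adding a large multiple of the combination makes their
  multipliers nonnegative.\<close>

lemma multipliers_le:
  fixes b :: "'k \<Rightarrow> 'x::real_vector \<Rightarrow> real"
  assumes "finite M" "convex C" "z \<in> intrinsic_core C" "\<And>m. m \<in> M \<Longrightarrow> affine_map (b m)"
    "\<And>m. m \<in> M \<Longrightarrow> b m z \<le> 0" "affine_map l"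
    "\<And>x. x \<in> C \<Longrightarrow> (\<And>m. m \<in> M \<Longrightarrow> b m x \<le> 0) \<Longrightarrow> 0 \<le> l x"
  shows "\<exists>s. (\<forall>m\<in>M. 0 \<le> s m) \<and> (\<forall>x\<in>C. 0 \<le> l x + (\<Sum>m\<in>M. s m * b m x))"
  using assms
proof (induction "card M" arbitrary: M C z l rule: less_induct)
  case less
  note fin = less.prems(1) and C = less.prems(2) and z = less.prems(3) and b = less.prems(4)
    and bz = less.prems(5) and l = less.prems(6) and nonneg = less.prems(7)
  show ?case
  proof (cases "M = {}")
    case True
    then show ?thesis using nonneg by simp
  next
    case False
    show ?thesis
    proof (cases "\<exists>x\<in>intrinsic_core C. (\<forall>m\<in>M. b m x \<le> 0) \<and> (\<exists>m\<in>M. b m x < 0)")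
      case True
      then obtain x m where x: "x \<in> intrinsic_core C" "\<And>k. k \<in> M \<Longrightarrow> b k x \<le> 0"
        and m: "m \<in> M" "b m x < 0" by blast
      \<comment> \<open>Strictness keeps \<open>x\<close> in the core of this half, so constraint
        \<open>m\<close> can be absorbed into the set and the induction runs on the remaining
        ones.\<close>
      let ?C = "{y \<in> C. b m y \<le> 0}"
      have "\<exists>s. (\<forall>k\<in>M - {m}. 0 \<le> s k) \<and> (\<forall>y\<in>?C. 0 \<le> l y + (\<Sum>k\<in>M - {m}. s k * b k y))"
        using less.prems x m
        by (intro less.hyps[of _ _ x] convex_Int_le intrinsic_core_Int_less card_Diff1_less)
          (auto, metis)
      then obtain s where s: "\<And>k. k \<in> M - {m} \<Longrightarrow> 0 \<le> s k"
        "\<And>y. y \<in> C \<Longrightarrow> b m y \<le> 0 \<Longrightarrow> 0 \<le> l y + (\<Sum>k\<in>M - {m}. s k * b k y)" by blast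
      have aff: "affine_map (\<lambda>y. l y + (\<Sum>k\<in>M - {m}. s k * b k y))"
        using b l by (intro affine_map_add affine_map_sum affine_map_mult_left) auto
      obtain r where r: "0 \<le> r" "\<And>y. y \<in> C \<Longrightarrow> 0 \<le> l y + (\<Sum>k\<in>M - {m}. s k * b k y) + r * b m y"
        using multiplier_le[OF C intrinsic_core_subset[OF x(1)] m(2) b[OF m(1)] aff s(2)] by blast
      have "(\<Sum>k\<in>M. (s(m := r)) k * b k y) = r * b m y + (\<Sum>k\<in>M - {m}. s k * b k y)" for y
        using fin m by (subst sum.remove[of _ m]) auto
      then show ?thesis
        using r s by (intro exI[of _ "s(m := r)"]) (auto simp: algebra_simps)
    next
      case no_strict: False
      then have bz0: "b m z = 0" if "m \<in> M" for m
        using z bz that by force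
      from False obtain m where m: "m \<in> M" by blast
      \<comment> \<open>Otherwise the midpoint of \<open>z\<close> and \<open>x\<close> is a
        feasible core point at which \<open>b m\<close> is strict. The induction hypothesis is then
        applied with \<open>b m\<close> as the objective.\<close>
      have "0 \<le> b m x" if x: "x \<in> C" "\<And>k. k \<in> M - {m} \<Longrightarrow> b k x \<le> 0" for x
      proof (rule ccontr)
        assume neg: "\<not> 0 \<le> b m x"
        let ?y = "(1 - 1 / 2) *\<^sub>R z + (1 / 2) *\<^sub>R x"
        have half: "b k ?y = b k x / 2" if "k \<in> M" for k
          using affine_mapD[OF b[OF that], of "1/2" z x] bz0[OF that] by simp
        have "b k ?y \<le> 0" if "k \<in> M" for k
          using half[OF that] neg x(2)[of k] that by (cases "k = m") auto
        moreover have "b m ?y < 0"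
          using half[OF m] neg by simp
        moreover have "?y \<in> intrinsic_core C"
          using intrinsic_core_midpoint[OF C z x(1)] .
        ultimately show False
          using no_strict m by blast
      qed
      then have "\<exists>s. (\<forall>k\<in>M - {m}. 0 \<le> s k) \<and> (\<forall>y\<in>C. 0 \<le> b m y + (\<Sum>k\<in>M - {m}. s k * b k y))"
        using less.prems m
        by (intro less.hyps[of _ _ z] card_Diff1_less) auto
      then obtain s where s: "\<And>k. k \<in> M - {m} \<Longrightarrow> 0 \<le> s k"
        "\<And>y. y \<in> C \<Longrightarrow> 0 \<le> b m y + (\<Sum>k\<in>M - {m}. s k * b k y)" by blast
      define t where "t = s(m := 1)"
      have t: "t m = 1" "\<And>k. k \<in> M \<Longrightarrow> 0 \<le> t k"
        using s by (auto simp: t_def)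
      have "(\<Sum>k\<in>M. t k * b k y) = b m y + (\<Sum>k\<in>M - {m}. s k * b k y)" for y
        using fin m by (subst sum.remove[of _ m]) (auto simp: t_def)
      then have t_sum_nonneg: "0 \<le> (\<Sum>k\<in>M. t k * b k y)" if "y \<in> C" for y
        using s that by simp
      \<comment> \<open>The combination is nonnegative on \<open>C\<close> and zero at the core
        point \<open>z\<close>, hence zero throughout.\<close>
      have t_sum: "(\<Sum>k\<in>M. t k * b k y) = 0" if "y \<in> C" for y
        using b bz0 t_sum_nonneg that
        by (intro affine_map_nonneg_zero_core[OF z]) (auto intro!: affine_map_sum affine_map_mult_left)
      define N where "N = {k \<in> M. 0 < t k}"
      have N: "N \<subseteq> M" "m \<in> N"
        using m t by (auto simp: N_def)
      have t_sum_N: "(\<Sum>k\<in>N. t k * b k y) = 0" if "y \<in> C" for y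
        using t_sum[OF that] t fin
        by (subst (asm) sum.mono_neutral_right[of M N]) (auto simp: N_def less_le)
      let ?C = "{y \<in> C. \<forall>k\<in>N. b k y = 0}"
      have cardN: "card (M - N) < card M"
        using fin m N by (intro psubset_card_mono) auto
      have nonneg': "0 \<le> l x" if "x \<in> ?C" "\<And>k. k \<in> M - N \<Longrightarrow> b k x \<le> 0" for x
        using that by (intro nonneg) (auto, metis Diff_iff order_refl)
      have "\<exists>s. (\<forall>k\<in>M - N. 0 \<le> s k) \<and> (\<forall>y\<in>?C. 0 \<le> l y + (\<Sum>k\<in>M - N. s k * b k y))"
        using less.prems N bz0 cardN nonneg'
        by (intro less.hyps[of _ _ z] convex_Int_eq intrinsic_core_Int_eq) auto
      then obtain r where r: "\<And>k. k \<in> M - N \<Longrightarrow> 0 \<le> r k"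
        "\<And>y. y \<in> C \<Longrightarrow> (\<And>k. k \<in> N \<Longrightarrow> b k y = 0) \<Longrightarrow> 0 \<le> l y + (\<Sum>k\<in>M - N. r k * b k y)" by blast
      have aff: "affine_map (\<lambda>y. l y + (\<Sum>k\<in>M - N. r k * b k y))"
        using b l by (intro affine_map_add affine_map_sum affine_map_mult_left) auto
      have finN: "finite N"
        using fin N finite_subset by blast
      have "\<exists>u. \<forall>y\<in>C. 0 \<le> l y + (\<Sum>k\<in>M - N. r k * b k y) + (\<Sum>k\<in>N. u k * b k y)"
        using C z b N bz0 aff r(2) finN by (intro multipliers_eq) auto
      then obtain u where
        u: "\<And>y. y \<in> C \<Longrightarrow> 0 \<le> l y + (\<Sum>k\<in>M - N. r k * b k y) + (\<Sum>k\<in>N. u k * b k y)" by blast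
      define q where "q = (\<Sum>k\<in>N. \<bar>u k\<bar> / t k)"
      have q: "0 \<le> u k + q * t k" if "k \<in> N" for k
      proof -
        have "\<bar>u k\<bar> / t k \<le> q"
          unfolding q_def using that finN by (intro member_le_sum) (auto simp: N_def)
        then show ?thesis
          using that by (simp add: N_def field_simps)
      qed
      define p where "p k = (if k \<in> N then u k + q * t k else r k)" for k
      have "0 \<le> l y + (\<Sum>k\<in>M. p k * b k y)" if y: "y \<in> C" for y
      proof -
        have "(\<Sum>k\<in>M. p k * b k y) = (\<Sum>k\<in>M - N. p k * b k y) + (\<Sum>k\<in>N. p k * b k y)"
          using fin N by (simp add: sum.subset_diff)
        also have "(\<Sum>k\<in>M - N. p k * b k y) = (\<Sum>k\<in>M - N. r k * b k y)"
          by (intro sum.cong) (auto simp: p_def)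
        also have "(\<Sum>k\<in>N. p k * b k y) = (\<Sum>k\<in>N. u k * b k y) + q * (\<Sum>k\<in>N. t k * b k y)"
          by (simp add: p_def sum.distrib algebra_simps sum_distrib_left)
        finally show ?thesis
          using u[OF y] t_sum_N[OF y] by simp
      qed
      moreover have "\<forall>k\<in>M. 0 \<le> p k"
        using q r by (auto simp: p_def)
      ultimately show ?thesis by blast
    qed
  qed
qed

text \<open>The inequalities come first, on the slice \<open>A x = 0\<close>; the equations, whose
  multipliers may have either sign, are then released one coordinate at a time.\<close>

theorem lagrange_multipliers:
  fixes A :: "'x::real_vector \<Rightarrow> 'e::euclidean_space" and B :: "'x \<Rightarrow> real^'m::finite"
  assumes C: "convex C" and z: "z \<in> intrinsic_core C" "A z = 0" "\<And>m. B z $ m \<le> 0"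
    and aff: "affine_map A" "affine_map B" "affine_map l"
    and nonneg: "\<And>x. x \<in> C \<Longrightarrow> A x = 0 \<Longrightarrow> (\<And>m. B x $ m \<le> 0) \<Longrightarrow> 0 \<le> l x"
  obtains y s where "\<And>m. 0 \<le> s $ m" "\<And>x. x \<in> C \<Longrightarrow> 0 \<le> l x + y \<bullet> A x + s \<bullet> B x"
proof -
  let ?C = "{x \<in> C. \<forall>k\<in>Basis. k \<bullet> A x = 0}"
  have C_iff: "x \<in> ?C \<longleftrightarrow> x \<in> C \<and> A x = 0" for x
    using euclidean_all_zero_iff[of "A x"] by (simp add: inner_commute)
  have affA: "affine_map (\<lambda>x. k \<bullet> A x)" for k
    using aff(1) by (rule affine_map_inner_right)
  have affB: "affine_map (\<lambda>x. B x $ m)" for m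
    using aff(2) by (simp add: affine_map_def)
  have conv: "convex ?C" and zC: "z \<in> intrinsic_core ?C"
    using convex_Int_eq[OF C affA] intrinsic_core_Int_eq[OF z(1) affA] z(2) by auto
  have "\<exists>s. (\<forall>m\<in>UNIV. 0 \<le> s m) \<and> (\<forall>x\<in>?C. 0 \<le> l x + (\<Sum>m\<in>UNIV. s m * B x $ m))"
    by (rule multipliers_le[OF _ conv zC affB _ aff(3)]) (use z(3) nonneg C_iff in auto)
  then obtain s where s: "\<And>m. 0 \<le> s m"
    "\<And>x. x \<in> ?C \<Longrightarrow> 0 \<le> l x + (\<Sum>m\<in>UNIV. s m * B x $ m)" by auto
  have aff': "affine_map (\<lambda>x. l x + (\<Sum>m\<in>UNIV. s m * B x $ m))"
    using affB aff(3) by (intro affine_map_add affine_map_sum affine_map_mult_left)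
  have "\<exists>y. \<forall>x\<in>C. 0 \<le> l x + (\<Sum>m\<in>UNIV. s m * B x $ m) + (\<Sum>k\<in>Basis. y k * (k \<bullet> A x))"
    by (rule multipliers_eq[OF _ C z(1) affA _ aff']) (use z(2) s(2) in auto)
  then obtain y where
    y: "\<And>x. x \<in> C \<Longrightarrow> 0 \<le> l x + (\<Sum>m\<in>UNIV. s m * B x $ m) + (\<Sum>k\<in>Basis. y k * (k \<bullet> A x))" by blast
  show ?thesis
  proof (rule that[of "\<chi> m. s m" "\<Sum>k\<in>Basis. y k *\<^sub>R k"])
    show "0 \<le> (\<chi> m. s m) $ m" for m
      using s(1) by simp
    show "0 \<le> l x + (\<Sum>k\<in>Basis. y k *\<^sub>R k) \<bullet> A x + (\<chi> m. s m) \<bullet> B x" if "x \<in> C" for x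
      using y[OF that] by (simp add: inner_sum_left inner_vec_def add_ac)
  qed
qed

section \<open>Conjugates and perspectives\<close>

definition epi :: "('a \<Rightarrow> ereal) \<Rightarrow> ('a \<times> real) set" where
  "epi f = {(x, r). f x \<le> ereal r}"

lemma mem_epi [simp]: "(x, r) \<in> epi f \<longleftrightarrow> f x \<le> ereal r"
  by (simp add: epi_def)

lemma less_PInf_iff: "x < \<infinity> \<longleftrightarrow> (\<exists>r. x \<le> ereal r)"
  by (cases x) (auto intro: exI[of _ 0])

lemma mem_effective_domain: "x \<in> effective_domain f \<longleftrightarrow> (\<exists>r. f x \<le> ereal r)"
  unfolding effective_domain_def mem_Collect_eq less_PInf_iff ..

lemma pcc_fun_gt_MInf: "pcc_fun f \<Longrightarrow> f x > - \<infinity>"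
  by (simp add: pcc_fun_def proper_fun_def)

lemma pcc_fun_ne_MInf: "pcc_fun f \<Longrightarrow> f x \<noteq> - \<infinity>"
  using pcc_fun_gt_MInf[of f x] by auto

lemma pcc_fun_domain_nonempty:
  assumes "pcc_fun f"
  obtains x r where "f x = ereal r"
proof -
  obtain x where "f x < \<infinity>"
    using assms by (auto simp: pcc_fun_def proper_fun_def effective_domain_def)
  then show ?thesis
    using that[of x] pcc_fun_ne_MInf[OF assms, of x] by (cases "f x") auto
qed

lemma convex_epi: "pcc_fun f \<Longrightarrow> convex (epi f)"
  by (simp add: pcc_fun_def convex_fun_def epi_def)

lemma closed_epi:
  fixes f :: "'a::euclidean_space \<Rightarrow> ereal"
  assumes "pcc_fun f"
  shows "closed (epi f)"
proof -
  have lsc: "f x \<le> Liminf (at x) f" for x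
    using assms by (simp add: pcc_fun_def closed_fun_def lsc_fun_def)
  have "(x, r) \<in> epi f" if X: "\<And>n. X n \<in> epi f" "X \<longlonglongrightarrow> (x, r)" for X x r
  proof (rule ccontr)
    assume "(x, r) \<notin> epi f"
    then have "ereal r < f x" by simp
    then obtain q where q: "ereal r < ereal q" "ereal q < f x"
      using ereal_dense2 by blast
    then have "\<forall>\<^sub>F y in at x. ereal q < f y"
      using lsc[of x] by (auto simp: le_Liminf_iff)
    \<comment> \<open>Lower semicontinuity speaks about the punctured neighbourhood;
      \<open>q < f x\<close> adds the point \<open>x\<close> itself.\<close>
    then have *: "\<forall>\<^sub>F y in nhds x. ereal q < f y"
      using q by (simp add: eventually_nhds_conv_at)
    have "(\<lambda>n. fst (X n)) \<longlonglongrightarrow> x" "(\<lambda>n. snd (X n)) \<longlonglongrightarrow> r"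
      using tendsto_fst[OF X(2)] tendsto_snd[OF X(2)] by simp_all
    then have "\<forall>\<^sub>F n in sequentially. ereal q < f (fst (X n))"
      "\<forall>\<^sub>F n in sequentially. snd (X n) < q"
      using eventually_compose_filterlim[OF *] q order_tendstoD(2) by auto
    then have "\<forall>\<^sub>F n in sequentially. False"
    proof eventually_elim
      case (elim n)
      have "f (fst (X n)) \<le> ereal (snd (X n))"
        using X(1)[of n] by (simp add: epi_def split_beta)
      then show False
        using elim by (metis ereal_less_eq(3) less_le_not_le order_less_le_trans order_le_less_trans)
    qed
    then show False by simp
  qed
  then show ?thesis
    unfolding closed_sequential_limits by (metis surj_pair)
qed

lemma closed_sublevel:
  fixes f :: "'a::euclidean_space \<Rightarrow> ereal"
  assumes "pcc_fun f"
  shows "closed {x. f x \<le> ereal r}"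
proof -
  have "closed ((\<lambda>x. (x, r)) -` epi f)"
    by (intro closed_vimage closed_epi assms continuous_intros)
  then show ?thesis
    by (simp add: vimage_def)
qed

lemma borel_measurable_pcc_fun:
  fixes f :: "'a::euclidean_space \<Rightarrow> ereal"
  assumes "pcc_fun f"
  shows "f \<in> borel_measurable borel"
proof (rule borel_measurableI_greater)
  fix y :: ereal
  show "{x \<in> space borel. y < f x} \<in> sets borel"
  proof (cases y)
    case (real r)
    have "{x. y < f x} = - {x. f x \<le> ereal r}"
      using real by auto
    then show ?thesis
      using closed_sublevel[OF assms, of r] by (auto intro: borel_open)
  next
    case MInf
    then have "{x. y < f x} = UNIV"
      using pcc_fun_gt_MInf[OF assms] by auto
    then show ?thesis by simp
  qed auto
qed

text \<open>Strict separation of a point from the closed convex epigraph; the last coefficient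
  cannot be negative because the epigraph is unbounded upwards.\<close>

lemma epi_supporting_halfspace:
  fixes f :: "'a::euclidean_space \<Rightarrow> ereal"
  assumes f: "pcc_fun f" and x: "(x, r) \<notin> epi f"
  obtains w v b where "0 \<le> v" "w \<bullet> x + v * r < b" "\<And>y q. f y \<le> ereal q \<Longrightarrow> b < w \<bullet> y + v * q"
proof -
  obtain a b where ab: "a \<bullet> (x, r) < b" "\<And>p. p \<in> epi f \<Longrightarrow> b < a \<bullet> p"
    using separating_hyperplane_closed_point[OF convex_epi[OF f] closed_epi[OF f] x] by blast
  obtain w v where a: "a = (w, v)" by fastforce
  have sep: "b < w \<bullet> y + v * q" if "f y \<le> ereal q" for y q
    using ab(2)[of "(y, q)"] that by (simp add: a)
  have "0 \<le> v"
  proof (rule ccontr)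
    assume v: "\<not> 0 \<le> v"
    obtain y q where y: "f y = ereal q"
      using pcc_fun_domain_nonempty[OF f] .
    \<comment> \<open>High enough above \<open>y\<close> to violate the separation if
      \<open>v\<close> were negative.\<close>
    define q' where "q' = max q ((b - w \<bullet> y) / v)"
    have "v * q' \<le> v * ((b - w \<bullet> y) / v)"
      using v by (intro mult_left_mono_neg) (auto simp: q'_def)
    then have "w \<bullet> y + v * q' \<le> b"
      using v by simp
    moreover have "f y \<le> ereal q'"
      using y by (simp add: q'_def)
    ultimately show False
      using sep by fastforce
  qed
  then show ?thesis
    using that[of v w b] ab(1) sep by (simp add: a)
qed

lemma exists_affine_minorant:
  fixes f :: "'a::euclidean_space \<Rightarrow> ereal"
  assumes f: "pcc_fun f"
  obtains w s where "\<And>y q. f y \<le> ereal q \<Longrightarrow> w \<bullet> y - q \<le> s"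
proof -
  obtain x m where x: "f x = ereal m"
    using pcc_fun_domain_nonempty[OF f] .
  then have "(x, m - 1) \<notin> epi f" by simp
  then obtain w v b where v: "0 \<le> v" and wx: "w \<bullet> x + v * (m - 1) < b"
    and sep: "\<And>y q. f y \<le> ereal q \<Longrightarrow> b < w \<bullet> y + v * q"
    using epi_supporting_halfspace[OF f] by metis
  \<comment> \<open>The separated point lies directly below a point of the epigraph, so the
    hyperplane is not vertical.\<close>
  have "v \<noteq> 0"
    using wx sep[of x m] x by auto
  then have v: "0 < v" using v by simp
  have "(- (1 / v) *\<^sub>R w) \<bullet> y - q \<le> - b / v" if "f y \<le> ereal q" for y q
    using sep[OF that] v by (simp add: divide_simps mult.commute)
  then show ?thesis
    using that by blast
qed

text \<open>The affine minorant tilts a vertical separating hyperplane into a nonvertical one.\<close>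

lemma exists_affine_minorant_above:
  fixes f :: "'a::euclidean_space \<Rightarrow> ereal"
  assumes f: "pcc_fun f" and x: "\<not> f x \<le> ereal r"
  obtains w s where "\<And>y q. f y \<le> ereal q \<Longrightarrow> w \<bullet> y - q \<le> s" "r < w \<bullet> x - s"
proof -
  obtain w v b where v: "0 \<le> v" and wx: "w \<bullet> x + v * r < b"
    and sep: "\<And>y q. f y \<le> ereal q \<Longrightarrow> b < w \<bullet> y + v * q"
    using epi_supporting_halfspace[OF f, of x r] x by (metis mem_epi)
  show ?thesis
  proof (cases "v = 0")
    case False
    with v have v: "0 < v" by simp
    show ?thesis
    proof (rule that[of "- (1 / v) *\<^sub>R w" "- b / v"])
      show "(- (1 / v) *\<^sub>R w) \<bullet> y - q \<le> - b / v" if "f y \<le> ereal q" for y q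
        using sep[OF that] v by (simp add: divide_simps mult.commute)
      show "r < (- (1 / v) *\<^sub>R w) \<bullet> x - - b / v"
        using wx v by (simp add: field_simps)
    qed
  next
    case True
    obtain w1 s1 where w1: "\<And>y q. f y \<le> ereal q \<Longrightarrow> w1 \<bullet> y - q \<le> s1"
      using exists_affine_minorant[OF f] by blast
    define d where "d = b - w \<bullet> x"
    have d: "0 < d" using wx True by (simp add: d_def)
    \<comment> \<open>Tilting by \<open>k\<close> raises the minorant at \<open>x\<close> by
      \<open>k * d\<close>, which exceeds whatever \<open>w1\<close> and \<open>s1\<close> fall
      short of \<open>r\<close>.\<close>
    define k where "k = (\<bar>r - w1 \<bullet> x + s1\<bar> + 1) / d"
    have k: "0 \<le> k" "k * d = \<bar>r - w1 \<bullet> x + s1\<bar> + 1"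
      using d by (auto simp: k_def)
    show ?thesis
    proof (rule that[of "w1 - k *\<^sub>R w" "s1 - k * b"])
      show "(w1 - k *\<^sub>R w) \<bullet> y - q \<le> s1 - k * b" if y: "f y \<le> ereal q" for y q
      proof -
        have "k * b \<le> k * (w \<bullet> y)"
          using sep[OF y] True k by (intro mult_left_mono) auto
        then show ?thesis
          using w1[OF y] by (simp add: inner_diff_left)
      qed
      have "(w1 - k *\<^sub>R w) \<bullet> x - (s1 - k * b) = w1 \<bullet> x - s1 + k * d"
        by (simp add: inner_diff_left d_def algebra_simps)
      then show "r < (w1 - k *\<^sub>R w) \<bullet> x - (s1 - k * b)"
        using k(2) by linarith
    qed
  qed
qed

section \<open>Conjugates as bounds over epigraph points, and the biconjugate theorem\<close>

lemma conjugate_le_iff: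
  assumes "\<And>x. f x \<noteq> - \<infinity>"
  shows "conjugate f w \<le> ereal s \<longleftrightarrow> (\<forall>y q. f y \<le> ereal q \<longrightarrow> w \<bullet> y - q \<le> s)"
proof -
  have "ereal (w \<bullet> y) - f y \<le> ereal s \<longleftrightarrow> (\<forall>q. f y \<le> ereal q \<longrightarrow> w \<bullet> y - q \<le> s)" for y
    using assms[of y] by (cases "f y") (simp_all, fastforce)
  then show ?thesis
    by (simp add: conjugate_def SUP_le_iff)
qed

lemma conjugate_ne_MInf:
  assumes "pcc_fun f"
  shows "conjugate f w \<noteq> - \<infinity>"
proof
  assume *: "conjugate f w = - \<infinity>"
  obtain x r where x: "f x = ereal r"
    using pcc_fun_domain_nonempty[OF assms] .
  have "conjugate f w \<le> ereal (w \<bullet> x - r - 1)"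
    using * by simp
  then show False
    unfolding conjugate_le_iff[OF pcc_fun_ne_MInf[OF assms]] using x by (auto dest!: spec[of _ x])
qed

lemma conjugate_domain_nonempty:
  fixes f :: "'a::euclidean_space \<Rightarrow> ereal"
  assumes "pcc_fun f"
  obtains w s where "conjugate f w = ereal s"
proof -
  obtain w s where "\<And>y q. f y \<le> ereal q \<Longrightarrow> w \<bullet> y - q \<le> s"
    using exists_affine_minorant[OF assms] by blast
  then have "conjugate f w \<le> ereal s"
    by (simp add: conjugate_le_iff[OF pcc_fun_ne_MInf[OF assms]])
  then show ?thesis
    using that[of w] conjugate_ne_MInf[OF assms, of w] by (cases "conjugate f w") auto
qed

text \<open>The identity of \<open>f\<close> with its biconjugate, with the biconjugate unfolded
  into real inequalities over the epigraph of the conjugate. Any point below the graph is cut off by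
  an affine minorant.\<close>

theorem fenchel_moreau:
  fixes f :: "'a::euclidean_space \<Rightarrow> ereal"
  assumes f: "pcc_fun f"
  shows "f x \<le> ereal r \<longleftrightarrow> (\<forall>w s. conjugate f w \<le> ereal s \<longrightarrow> w \<bullet> x - s \<le> r)"
proof (intro iffI allI impI)
  fix w s
  assume "f x \<le> ereal r" "conjugate f w \<le> ereal s"
  then have "w \<bullet> x - r \<le> s"
    unfolding conjugate_le_iff[OF pcc_fun_ne_MInf[OF f]] by blast
  then show "w \<bullet> x - s \<le> r" by simp
next
  assume *: "\<forall>w s. conjugate f w \<le> ereal s \<longrightarrow> w \<bullet> x - s \<le> r"
  show "f x \<le> ereal r"
  proof (rule ccontr)
    assume "\<not> f x \<le> ereal r"
    then obtain w s where w: "\<And>y q. f y \<le> ereal q \<Longrightarrow> w \<bullet> y - q \<le> s" "r < w \<bullet> x - s"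
      using exists_affine_minorant_above[OF f] by metis
    have "conjugate f w \<le> ereal s"
      unfolding conjugate_le_iff[OF pcc_fun_ne_MInf[OF f]] using w(1) by blast
    then have "w \<bullet> x - s \<le> r"
      using * by blast
    then show False
      using w(2) by simp
  qed
qed

text \<open>The perspective of \<open>conjugate f\<close> at weight 0 is by definition the support
  function of the domain of the biconjugate; here it becomes the domain of \<open>f\<close>.\<close>

lemma effective_domain_biconjugate:
  fixes f :: "'a::euclidean_space \<Rightarrow> ereal"
  assumes f: "pcc_fun f"
  shows "effective_domain (conjugate (conjugate f)) = effective_domain f"
  unfolding set_eq_iff mem_effective_domain conjugate_le_iff[OF conjugate_ne_MInf[OF f]]
    fenchel_moreau[OF f] by (simp add: inner_commute)

section \<open>Perspectives as families of linear inequalities, uniformly in the weight\<close>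

lemma ereal_mult_le_iff: "0 < t \<Longrightarrow> ereal t * x \<le> ereal r \<longleftrightarrow> x \<le> ereal (r / t)"
  by (cases x) (auto simp: field_simps)

lemma mult_inverse_diff_le_iff:
  fixes a t s r :: real
  assumes "0 < t"
  shows "inverse t * a - s \<le> r / t \<longleftrightarrow> a - t * s \<le> r"
proof -
  have "inverse t * a - s = (a - t * s) / t"
    using assms by (simp add: field_simps)
  then show ?thesis
    using assms by (simp add: divide_le_cancel)
qed

lemma support_fun_le_iff:
  "support_fun (effective_domain f) x \<le> ereal r \<longleftrightarrow> (\<forall>w s. f w \<le> ereal s \<longrightarrow> w \<bullet> x \<le> r)"
  by (auto simp: support_fun_def SUP_le_iff mem_effective_domain)

text \<open>For positive weight this is \<open>fenchel_moreau\<close> multiplied by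
  \<open>t\<close>, for weight 0 it is the support function. The common right-hand side removes the
  case distinction from the duality arguments.\<close>

lemma persp_le_iff:
  fixes f :: "'a::euclidean_space \<Rightarrow> ereal"
  assumes f: "pcc_fun f"
  shows "persp f x t \<le> ereal r \<longleftrightarrow>
    0 \<le> t \<and> (\<forall>w s. conjugate f w \<le> ereal s \<longrightarrow> w \<bullet> x - t * s \<le> r)"
proof -
  consider "t < 0" | "t = 0" | "0 < t" by linarith
  then show ?thesis
  proof cases
    case 3
    then have "w \<bullet> (x /\<^sub>R t) - s \<le> r / t \<longleftrightarrow> w \<bullet> x - t * s \<le> r" for w s
      using mult_inverse_diff_le_iff by simp
    then show ?thesis
      using 3 by (simp add: persp_def ereal_mult_le_iff fenchel_moreau[OF f])
  qed (auto simp: persp_def support_fun_le_iff)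
qed

text \<open>The mirror image of \<open>persp_le_iff\<close>, with the roles of \<open>f\<close> and
  its conjugate exchanged; the biconjugate enters only at weight 0.\<close>

lemma persp_conjugate_le_iff:
  fixes f :: "'a::euclidean_space \<Rightarrow> ereal"
  assumes f: "pcc_fun f"
  shows "persp (conjugate f) y b \<le> ereal r \<longleftrightarrow>
    0 \<le> b \<and> (\<forall>x s. f x \<le> ereal s \<longrightarrow> y \<bullet> x - b * s \<le> r)"
proof -
  consider "b < 0" | "b = 0" | "0 < b" by linarith
  then show ?thesis
  proof cases
    case 3
    then have "(y /\<^sub>R b) \<bullet> x - s \<le> r / b \<longleftrightarrow> y \<bullet> x - b * s \<le> r" for x s
      using mult_inverse_diff_le_iff by simp
    then show ?thesis
      using 3 by (simp add: persp_def ereal_mult_le_iff conjugate_le_iff[OF pcc_fun_ne_MInf[OF f]])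
  qed (auto simp: persp_def effective_domain_biconjugate[OF f] support_fun_le_iff inner_commute)
qed

lemma persp_1: "persp f x 1 = f x"
  by (simp add: persp_def flip: one_ereal_def)

lemma persp_conjugate_ne_MInf:
  fixes f :: "'a::euclidean_space \<Rightarrow> ereal"
  assumes f: "pcc_fun f"
  shows "persp (conjugate f) y b \<noteq> - \<infinity>"
proof
  assume *: "persp (conjugate f) y b = - \<infinity>"
  obtain x s where x: "f x = ereal s"
    using pcc_fun_domain_nonempty[OF f] .
  have "persp (conjugate f) y b \<le> ereal (y \<bullet> x - b * s - 1)"
    using * by simp
  then have "y \<bullet> u - b * q \<le> y \<bullet> x - b * s - 1" if "f u \<le> ereal q" for u q
    using that unfolding persp_conjugate_le_iff[OF f] by blast
  from this[of x s] x show False by simp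
qed

lemma ereal_le_persp_concave_iff:
  "ereal r \<le> persp_concave g x t \<longleftrightarrow> persp (\<lambda>z. - g z) x t \<le> ereal (- r)"
proof -
  have minus: "ereal r \<le> - u \<longleftrightarrow> u \<le> ereal (- r)" for u
    by (cases u) auto
  have mult: "ereal t * u = - (ereal t * - u)" for u
    by simp
  consider "t < 0" | "t = 0" | "0 < t" by linarith
  then show ?thesis
  proof cases
    case 3
    then show ?thesis
      by (simp only: persp_concave_def persp_def if_True mult[of "g (x /\<^sub>R t)"] minus)
  qed (simp_all add: persp_concave_def persp_def minus)
qed

text \<open>At weight 0 the perspective is the recession function: every affine minorant of
  \<open>f\<close> grows along \<open>v\<close> at rate at most \<open>q\<close>, and
  \<open>f\<close> is determined by its affine minorants.\<close>

lemma recession_direction: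
  fixes f :: "'a::euclidean_space \<Rightarrow> ereal"
  assumes f: "pcc_fun f" and x: "f x \<le> ereal r" and v: "persp f v 0 \<le> ereal q" and k: "0 \<le> k"
  shows "f (x + k *\<^sub>R v) \<le> ereal (r + k * q)"
  unfolding fenchel_moreau[OF f]
proof (intro allI impI)
  fix w s assume w: "conjugate f w \<le> ereal s"
  have "w \<bullet> x - s \<le> r"
    using x w unfolding fenchel_moreau[OF f] by blast
  moreover have "w \<bullet> v \<le> q"
    using v w unfolding persp_le_iff[OF f] by auto
  then have "k * (w \<bullet> v) \<le> k * q"
    using k by (rule mult_left_mono)
  ultimately show "w \<bullet> (x + k *\<^sub>R v) - s \<le> r + k * q"
    by (simp add: inner_add_right)
qed

text \<open>A Fenchel-Young inequality for perspectives of \<open>f\<close> and of its conjugate. If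
  one weight is positive, the inequalities of the other perspective are evaluated at the rescaled
  point. If both vanish, \<open>y\<close> is bounded above on the domain of \<open>f\<close>, which
  contains a ray in direction \<open>v\<close>, so the inner product is not positive.\<close>

lemma persp_inner_le:
  fixes f :: "'a::euclidean_space \<Rightarrow> ereal"
  assumes f: "pcc_fun f" and v: "persp f v t \<le> ereal q" and y: "persp (conjugate f) y b \<le> ereal s"
  shows "y \<bullet> v \<le> t * s + b * q"
proof -
  have v': "0 \<le> t" "\<And>w u. conjugate f w \<le> ereal u \<Longrightarrow> w \<bullet> v - t * u \<le> q"
    using v by (auto simp: persp_le_iff[OF f])
  have y': "0 \<le> b" "\<And>x u. f x \<le> ereal u \<Longrightarrow> y \<bullet> x - b * u \<le> s"
    using y by (auto simp: persp_conjugate_le_iff[OF f])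
  consider "0 < t" | "t = 0" "0 < b" | "t = 0" "b = 0"
    using v' y' by fastforce
  then show ?thesis
  proof cases
    case 1
    then have "f (v /\<^sub>R t) \<le> ereal (q / t)"
      using v by (simp add: persp_def ereal_mult_le_iff)
    then have "y \<bullet> (v /\<^sub>R t) - b * (q / t) \<le> s"
      by (rule y'(2))
    then show ?thesis
      using 1 by (simp add: field_simps)
  next
    case 2
    then have "conjugate f (y /\<^sub>R b) \<le> ereal (s / b)"
      using y by (simp add: persp_def ereal_mult_le_iff)
    then have "(y /\<^sub>R b) \<bullet> v - t * (s / b) \<le> q"
      by (rule v'(2))
    then show ?thesis
      using 2 by (simp add: field_simps)
  next
    case 3
    obtain x r where x: "f x = ereal r"
      using pcc_fun_domain_nonempty[OF f] .
    have le: "y \<bullet> x + k * (y \<bullet> v) \<le> s" if "0 \<le> k" for k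
      using y'(2)[OF recession_direction[OF f _ _ that, of x r v q]] x v 3
      by (simp add: inner_add_right)
    have "y \<bullet> v \<le> 0"
    proof (rule ccontr)
      assume "\<not> y \<bullet> v \<le> 0"
      then show False
        using le[of "(\<bar>s - y \<bullet> x\<bar> + 1) / (y \<bullet> v)"] by (simp split: if_splits)
    qed
    then show ?thesis
      using 3 by simp
  qed
qed

text \<open>Distributes one extended-real bound into a real bound per summand; in this form the
  constraint of (AP-W') matches the height coordinates of the cones.\<close>

lemma sum_ereal_le_iff:
  fixes f :: "'k \<Rightarrow> ereal"
  assumes K: "finite K" and f: "\<And>k. k \<in> K \<Longrightarrow> f k \<noteq> - \<infinity>"
  shows "(\<Sum>k\<in>K. f k) \<le> ereal a \<longleftrightarrow> (\<exists>r. (\<forall>k\<in>K. f k \<le> ereal (r k)) \<and> (\<Sum>k\<in>K. r k) \<le> a)"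
proof
  assume le: "(\<Sum>k\<in>K. f k) \<le> ereal a"
  then have "(\<Sum>k\<in>K. f k) \<noteq> \<infinity>" by auto
  then have fin: "f k \<noteq> \<infinity>" if "k \<in> K" for k
    using that K by (auto simp: sum_Pinfty)
  have fr: "f k = ereal (real_of_ereal (f k))" if "k \<in> K" for k
    using f[OF that] fin[OF that] by (cases "f k") auto
  have "(\<Sum>k\<in>K. f k) = ereal (\<Sum>k\<in>K. real_of_ereal (f k))"
    by (subst sum_ereal[symmetric]) (rule sum.cong[OF refl fr])
  then show "\<exists>r. (\<forall>k\<in>K. f k \<le> ereal (r k)) \<and> (\<Sum>k\<in>K. r k) \<le> a"
    using le fr by (intro exI[of _ "\<lambda>k. real_of_ereal (f k)"]) auto
next
  assume "\<exists>r. (\<forall>k\<in>K. f k \<le> ereal (r k)) \<and> (\<Sum>k\<in>K. r k) \<le> a"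
  then obtain r where r: "\<And>k. k \<in> K \<Longrightarrow> f k \<le> ereal (r k)" "(\<Sum>k\<in>K. r k) \<le> a" by blast
  have "(\<Sum>k\<in>K. f k) \<le> (\<Sum>k\<in>K. ereal (r k))"
    using r(1) by (rule sum_mono)
  also have "\<dots> \<le> ereal a"
    using r(2) by simp
  finally show "(\<Sum>k\<in>K. f k) \<le> ereal a" .
qed

section \<open>Intrinsic cores of epigraphs, cones and products\<close>

lemma convex_epi_conjugate:
  assumes f: "pcc_fun f"
  shows "convex (epi (conjugate f))"
proof -
  have "(1 - t) * (w \<bullet> y) + t * (w' \<bullet> y) - q \<le> (1 - t) * s + t * s'"
    if w: "conjugate f w \<le> ereal s" "conjugate f w' \<le> ereal s'" and t: "0 \<le> t" "t \<le> 1"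
      and y: "f y \<le> ereal q" for t w w' y q s s'
  proof -
    have "w \<bullet> y - q \<le> s" "w' \<bullet> y - q \<le> s'"
      using w y unfolding conjugate_le_iff[OF pcc_fun_ne_MInf[OF f]] by blast+
    then have "(1 - t) * (w \<bullet> y - q) + t * (w' \<bullet> y - q) \<le> (1 - t) * s + t * s'"
      using t by (intro add_mono mult_left_mono) auto
    then show ?thesis
      by (simp add: algebra_simps)
  qed
  then have "conjugate f ((1 - t) *\<^sub>R w + t *\<^sub>R w') \<le> ereal ((1 - t) * s + t * s')"
    if "conjugate f w \<le> ereal s" "conjugate f w' \<le> ereal s'" "0 \<le> t" "t \<le> 1" for t w w' s s'
    using that unfolding conjugate_le_iff[OF pcc_fun_ne_MInf[OF f], where w = "_ + _"]
    by (simp add: inner_add_left)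
  then show ?thesis
    by (auto simp: convex_alt)
qed

text \<open>The height \<open>p\<close> over the extrapolated point may be large, but convexity
  bounds \<open>f\<close> along the chord from \<open>(z, m)\<close>, and the gap
  \<open>r - m\<close> pays for a short part of it.\<close>

lemma intrinsic_core_epi:
  assumes conv: "convex (epi f)" and ne: "\<And>x. f x \<noteq> - \<infinity>"
    and z: "z \<in> intrinsic_core (effective_domain f)" "f z < ereal r"
  shows "(z, r) \<in> intrinsic_core (epi f)"
proof -
  obtain m where m: "f z = ereal m" "m < r"
    using z(2) ne[of z] by (cases "f z") auto
  have "\<exists>e>0. (z, r) + e *\<^sub>R ((z, r) - (y, q)) \<in> epi f" if y: "f y \<le> ereal q" for y q
  proof -
    have "y \<in> effective_domain f"
      using y by (auto simp: mem_effective_domain)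
    then obtain e where e: "e > 0" "z + e *\<^sub>R (z - y) \<in> effective_domain f"
      using intrinsic_coreD[OF z(1)] by blast
    then obtain p where p: "f (z + e *\<^sub>R (z - y)) \<le> ereal p"
      by (auto simp: mem_effective_domain)
    \<comment> \<open>\<open>a\<close> bounds the excess of the chord over the required line; adding
      \<open>r - m\<close> makes it positive and gives \<open>d\<close> at most 1.\<close>
    define a where "a = \<bar>p - m - e * (r - q)\<bar> + (r - m)"
    define d where "d = (r - m) / a"
    have a: "0 < a" "r - m \<le> a"
      using m by (auto simp: a_def)
    have d: "0 < d" "d \<le> 1" "d * a = r - m"
      using m a by (auto simp: d_def)
    have "d * (p - m - e * (r - q)) \<le> d * a"
      using d m by (intro mult_left_mono) (auto simp: a_def)
    then have le: "(1 - d) * m + d * p \<le> r + (d * e) * (r - q)"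
      using d(3) by (simp add: algebra_simps)
    have "(1 - d) *\<^sub>R (z, m) + d *\<^sub>R (z + e *\<^sub>R (z - y), p) \<in> epi f"
      using d m p by (intro convexD_alt[OF conv]) auto
    then have "f ((1 - d) *\<^sub>R z + d *\<^sub>R (z + e *\<^sub>R (z - y))) \<le> ereal ((1 - d) * m + d * p)"
      by simp
    also have "(1 - d) *\<^sub>R z + d *\<^sub>R (z + e *\<^sub>R (z - y)) = z + (d * e) *\<^sub>R (z - y)"
      by (simp add: algebra_simps)
    finally have "f (z + (d * e) *\<^sub>R (z - y)) \<le> ereal (r + (d * e) * (r - q))"
      using le by (meson ereal_less_eq(3) order_trans)
    then show ?thesis
      using d e by (intro exI[of _ "d * e"]) simp
  qed
  then show ?thesis
    using m by (auto simp: intrinsic_core_def)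
qed

text \<open>The open-weight cone over \<open>G\<close> placed at weight 1. For
  \<open>G = epi f\<close> it is the epigraph of the perspective restricted to positive
  weights.\<close>

definition homogenization :: "('a::real_vector \<times> real) set \<Rightarrow> ('a \<times> real \<times> real) set" where
  "homogenization G = {(x, t, r). 0 < t \<and> (x /\<^sub>R t, r / t) \<in> G}"

lemma mem_homogenization:
  "(x, t, r) \<in> homogenization G \<longleftrightarrow> 0 < t \<and> (x /\<^sub>R t, r / t) \<in> G"
  by (simp add: homogenization_def)

lemma homogenizationI: "0 < t \<Longrightarrow> (x, r) \<in> G \<Longrightarrow> (t *\<^sub>R x, t, t * r) \<in> homogenization G"
  by (simp add: homogenization_def)

lemma homogenizationE:
  assumes "p \<in> homogenization G"
  obtains t x r where "p = (t *\<^sub>R x, t, t * r)" "0 < t" "(x, r) \<in> G"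
proof -
  obtain y t q where p: "p = (y, t, q)" by (metis prod_cases3)
  show ?thesis
    using assms by (intro that[of t "y /\<^sub>R t" "q / t"]) (auto simp: p mem_homogenization)
qed

lemma homogenization_scale:
  assumes "p \<in> homogenization G" "0 < s"
  shows "s *\<^sub>R p \<in> homogenization G"
proof -
  obtain t x r where "p = (t *\<^sub>R x, t, t * r)" "0 < t" "(x, r) \<in> G"
    using homogenizationE[OF assms(1)] .
  then show ?thesis
    using homogenizationI[of "s * t" x r G] assms(2) by (simp add: mult.assoc)
qed

lemma convex_homogenization:
  assumes G: "convex G"
  shows "convex (homogenization G)"
proof (rule convexI)
  fix p q and u v :: real
  assume p: "p \<in> homogenization G" and q: "q \<in> homogenization G" and uv: "0 \<le> u" "0 \<le> v" "u + v = 1"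
  obtain t x r where p: "p = (t *\<^sub>R x, t, t * r)" "0 < t" "(x, r) \<in> G"
    using homogenizationE[OF p] .
  obtain s y m where q: "q = (s *\<^sub>R y, s, s * m)" "0 < s" "(y, m) \<in> G"
    using homogenizationE[OF q] .
  \<comment> \<open>The weight of the combination; normalizing by it turns the base points into a
    convex combination.\<close>
  define a where "a = u * t + v * s"
  have a: "0 < a"
    unfolding a_def using uv p q
    by (metis add_0 add_nonneg_pos add_pos_nonneg less_eq_real_def mult_nonneg_nonneg mult_pos_pos zero_neq_one)
  have "(u * t / a) *\<^sub>R (x, r) + (v * s / a) *\<^sub>R (y, m) \<in> G"
    using uv p q a by (intro convexD[OF G]) (auto simp: a_def[symmetric] add_divide_distrib[symmetric] less_imp_le)
  then have "(a *\<^sub>R ((u * t / a) *\<^sub>R x + (v * s / a) *\<^sub>R y), a, a * ((u * t / a) * r + (v * s / a) * m))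
    \<in> homogenization G"
    using a by (auto intro!: homogenizationI)
  moreover have "a *\<^sub>R ((u * t / a) *\<^sub>R x + (v * s / a) *\<^sub>R y) = u *\<^sub>R t *\<^sub>R x + v *\<^sub>R s *\<^sub>R y"
    using a by (simp add: scaleR_add_right)
  moreover have "a * ((u * t / a) * r + (v * s / a) * m) = u * (t * r) + v * (s * m)"
    using a by (simp add: distrib_left)
  ultimately show "u *\<^sub>R p + v *\<^sub>R q \<in> homogenization G"
    by (simp add: p q a_def)
qed

lemma intrinsic_core_homogenization:
  assumes G: "convex G" and z: "(z, r) \<in> intrinsic_core G" and t: "0 < t"
  shows "(t *\<^sub>R z, t, t * r) \<in> intrinsic_core (homogenization G)"
proof -
  have "\<exists>e>0. (t *\<^sub>R z, t, t * r) + e *\<^sub>R ((t *\<^sub>R z, t, t * r) - p) \<in> homogenization G"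
    if p: "p \<in> homogenization G" for p
  proof -
    obtain s y q where p: "p = (s *\<^sub>R y, s, s * q)" "0 < s" "(y, q) \<in> G"
      using homogenizationE[OF p] .
    obtain d where d: "d > 0" "(z, r) + d *\<^sub>R ((z, r) - (y, q)) \<in> G"
      using intrinsic_coreD[OF z p(3)] .
    \<comment> \<open>A step \<open>e\<close> in the cone is a step \<open>e * s / a\<close> in the
      base, where \<open>a\<close> is the new weight. The choice
      \<open>e * s * (1 + d) = d * t\<close> keeps \<open>a\<close> positive and this base step at
      most \<open>d\<close>.\<close>
    define e where "e = d * t / (s * (1 + d))"
    have e: "0 < e"
      using d t p by (simp add: e_def)
    have es: "e * s * (1 + d) = d * t"
      using d p by (simp add: e_def)
    define a where "a = t + e * (t - s)"
    have "e * s * (1 + d) < t * (1 + d)"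
      using es d t by (simp add: distrib_left)
    then have "e * s < t"
      using d by (simp add: mult_less_cancel_right)
    then have a: "0 < a"
      using e t by (simp add: a_def algebra_simps add_pos_pos) (smt (verit) mult_pos_pos)
    have "e * s \<le> d * a"
      using es d e t by (simp add: a_def algebra_simps)
    then have "(z, r) + (e * s / a) *\<^sub>R ((z, r) - (y, q)) \<in> G"
      using a e p intrinsic_core_subset[OF z]
      by (intro convex_extrapolation_mono[OF G _ d(2)]) (auto simp: field_simps)
    then have "(a *\<^sub>R (z + (e * s / a) *\<^sub>R (z - y)), a, a * (r + (e * s / a) * (r - q))) \<in> homogenization G"
      using a by (intro homogenizationI) auto
    also have "(a *\<^sub>R (z + (e * s / a) *\<^sub>R (z - y)), a, a * (r + (e * s / a) * (r - q)))
      = (t *\<^sub>R z, t, t * r) + e *\<^sub>R ((t *\<^sub>R z, t, t * r) - p)"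
      using a by (simp add: p distrib_left scaleR_add_right) (simp add: a_def algebra_simps)
    finally show ?thesis
      using e by blast
  qed
  then show ?thesis
    using t intrinsic_core_subset[OF z] by (auto simp: intrinsic_core_def intro: homogenizationI)
qed

lemma intrinsic_core_vec:
  fixes x :: "('x::real_vector)^'i::finite"
  assumes C: "\<And>i. convex (C i)" and x: "\<And>i. x $ i \<in> intrinsic_core (C i)"
  shows "x \<in> intrinsic_core {w. \<forall>i. w $ i \<in> C i}"
proof -
  have "\<exists>e>0. \<forall>i. (x + e *\<^sub>R (x - y)) $ i \<in> C i" if y: "\<And>i. y $ i \<in> C i" for y
  proof -
    have "\<exists>e>0. x $ i + e *\<^sub>R (x $ i - y $ i) \<in> C i" for i
      using intrinsic_coreD[OF x y] by metis
    then obtain e where e: "\<And>i. 0 < e i" "\<And>i. x $ i + e i *\<^sub>R (x $ i - y $ i) \<in> C i"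
      by metis
    define d where "d = Min (range e)"
    have d: "0 < d" "\<And>i. d \<le> e i"
      using e by (auto simp: d_def)
    have "x $ i + d *\<^sub>R (x $ i - y $ i) \<in> C i" for i
      by (rule convex_extrapolation_mono[OF C intrinsic_core_subset[OF x] e(2)]) (use d less_imp_le in auto)
    then show ?thesis
      using d by auto
  qed
  then show ?thesis
    using x by (auto simp: intrinsic_core_def)
qed

lemma convex_vec:
  "(\<And>i. convex (C i)) \<Longrightarrow> convex {w :: ('x::real_vector)^'i::finite. \<forall>i. w $ i \<in> C i}"
  by (simp add: convex_def)

lemma intrinsic_core_Times_UNIV:
  assumes "x \<in> intrinsic_core C"
  shows "(x, y) \<in> intrinsic_core (C \<times> UNIV)"
  using assms by (fastforce simp: intrinsic_core_def)

section \<open>Weak duality\<close>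

text \<open>Also covers weight 0, where both sides reduce to a bound at the origin; this lets points
  of (AD-B) with vanishing weights pass to (AD-B').\<close>

lemma persp_scale:
  fixes f :: "'a::euclidean_space \<Rightarrow> ereal"
  assumes f: "pcc_fun f" and z: "f z \<le> ereal r" and t: "0 \<le> t"
  shows "persp f (t *\<^sub>R z) t \<le> ereal (t * r)"
proof -
  have "w \<bullet> (t *\<^sub>R z) - t * s \<le> t * r" if "conjugate f w \<le> ereal s" for w s
  proof -
    have "w \<bullet> z - s \<le> r"
      using z that unfolding fenchel_moreau[OF f] by blast
    then have "t * (w \<bullet> z - s) \<le> t * r"
      using t by (rule mult_left_mono)
    then show ?thesis
      by (simp add: right_diff_distrib)
  qed
  then show ?thesis
    using t by (simp add: persp_le_iff[OF f])
qed

section \<open>The pointwise maximum and a common indexing of the functions\<close>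

lemma gmax_upper: "g i z \<le> gmax g z"
  by (simp add: gmax_def)

lemma gmax_attained:
  obtains i where "gmax g z = g i z"
proof -
  have "gmax g z \<in> range (\<lambda>i. g i z)"
    unfolding gmax_def by (intro Max_in) auto
  then show ?thesis
    using that by blast
qed

lemma sum_option_sum:
  fixes f :: "('j::finite + 'l::finite) option \<Rightarrow> 'b::comm_monoid_add"
  shows "(\<Sum>k\<in>UNIV. f k) = f None + (\<Sum>j\<in>UNIV. f (Some (Inl j))) + (\<Sum>l\<in>UNIV. f (Some (Inr l)))"
proof -
  have "(\<Sum>k\<in>UNIV. f k) = f None + (\<Sum>k\<in>UNIV. f (Some k))"
    by (simp add: UNIV_option_conv sum.reindex)
  also have "(\<Sum>k\<in>UNIV. f (Some k)) = (\<Sum>k\<in>UNIV <+> UNIV. f (Some k))"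
    by simp
  also have "\<dots> = (\<Sum>j\<in>UNIV. f (Some (Inl j))) + (\<Sum>l\<in>UNIV. f (Some (Inr l)))"
    by (subst sum.Plus) auto
  finally show ?thesis
    by (simp add: add.assoc)
qed

lemma all_option_sum:
  "(\<forall>k. P k) \<longleftrightarrow> P None \<and> (\<forall>j. P (Some (Inl j))) \<and> (\<forall>l. P (Some (Inr l)))"
  by (metis not_None_eq sum.exhaust)

text \<open>For each \<open>i\<close>, the functions \<open>- g i\<close>, \<open>h j\<close>, \<open>c l\<close> form one family over the index type
  \<open>('j + 'l) option\<close>. Quantities attached to its members, such as multipliers, slopes and upper
  bounds, are combined accordingly.\<close>

definition by_index :: "'b \<Rightarrow> 'b^'j \<Rightarrow> 'b^'l \<Rightarrow> ('j + 'l) option \<Rightarrow> 'b" where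
  "by_index a b c k = (case k of None \<Rightarrow> a | Some (Inl j) \<Rightarrow> b $ j | Some (Inr l) \<Rightarrow> c $ l)"

lemma by_index_simps [simp]:
  "by_index a b c None = a"
  "by_index a b c (Some (Inl j)) = b $ j"
  "by_index a b c (Some (Inr l)) = c $ l"
  by (simp_all add: by_index_def)

definition family ::
  "('i \<Rightarrow> 'a \<Rightarrow> ereal) \<Rightarrow> ('l \<Rightarrow> 'a \<Rightarrow> ereal) \<Rightarrow> ('j \<Rightarrow> 'a \<Rightarrow> ereal) \<Rightarrow> 'i \<Rightarrow> ('j + 'l) option \<Rightarrow> 'a \<Rightarrow> ereal"
  where
  "family g c h i k = (case k of None \<Rightarrow> (\<lambda>z. - g i z) | Some (Inl j) \<Rightarrow> h j | Some (Inr l) \<Rightarrow> c l)"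

lemma family_simps [simp]:
  "family g c h i None = (\<lambda>z. - g i z)"
  "family g c h i (Some (Inl j)) = h j"
  "family g c h i (Some (Inr l)) = c l"
  by (simp_all add: family_def)

lemma sum_by_index_mult:
  fixes \<beta> u :: "real^'j::finite" and n :: "real^'l::finite"
  shows "(\<Sum>k\<in>UNIV. by_index 1 \<beta> n k * by_index (- t) u 0 k) = \<beta> \<bullet> u - t"
  by (simp add: sum_option_sum inner_vec_def)

lemma uminus_le_ereal_uminus_iff: "- x \<le> ereal (- t) \<longleftrightarrow> ereal t \<le> x"
  by (cases x) auto

lemma mem_Uset_iff:
  "(z, u, t) \<in> Uset g c h i \<longleftrightarrow> (\<forall>k. family g c h i k z \<le> ereal (by_index (- t) u 0 k))"
  by (auto simp: Uset_def all_option_sum uminus_le_ereal_uminus_iff zero_ereal_def simp del: uminus_ereal.simps)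

lemma mem_ad_b'_set_iff_family:
  "(\<tau>, lam, \<omega>, \<upsilon>) \<in> ad_b'_set g c h \<mu> \<longleftrightarrow>
     (\<Sum>i\<in>UNIV. lam $ i) = 1 \<and> (\<forall>j. (\<Sum>i\<in>UNIV. \<omega> $ i $ j) \<le> \<mu> $ j) \<and> (\<forall>i. 0 \<le> lam $ i) \<and>
     (\<forall>i k. persp (family g c h i k) (\<upsilon> $ i) (lam $ i) \<le> ereal (by_index (- (\<tau> $ i)) (\<omega> $ i) 0 k))"
  by (auto simp: mem_ad_b'_set_iff all_option_sum ereal_le_persp_concave_iff zero_ereal_def
      simp del: uminus_ereal.simps)

lemma ap_w'_constraint_eq_sum:
  "conjugate (\<lambda>z. - g i z) y0 + (\<Sum>j\<in>UNIV. persp (conjugate (h j)) (y1 $ j) (\<beta> $ j))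
     + (\<Sum>l\<in>UNIV. persp (conjugate (c l)) (y2 $ l) (n $ l))
   = (\<Sum>k\<in>UNIV. persp (conjugate (family g c h i k)) (by_index y0 y1 y2 k) (by_index 1 \<beta> n k))"
  by (simp add: sum_option_sum persp_1)

lemma ap_w_set_iff:
  "(\<alpha>, \<beta>) \<in> ap_w_set g c h \<longleftrightarrow>
     (\<forall>j. 0 \<le> \<beta> $ j) \<and> (\<forall>i z u t. (z, u, t) \<in> Uset g c h i \<longrightarrow> t \<le> \<alpha> + \<beta> \<bullet> u)"
proof -
  have *: "ereal (t - \<alpha> - u \<bullet> \<beta>) \<le> 0 \<longleftrightarrow> t \<le> \<alpha> + \<beta> \<bullet> u" for t u
    by (auto simp: zero_ereal_def inner_commute)
  have "(SUP (z, u, t)\<in>Uset g c h i. ereal (t - \<alpha> - u \<bullet> \<beta>)) \<le> 0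
      \<longleftrightarrow> (\<forall>z u t. (z, u, t) \<in> Uset g c h i \<longrightarrow> ereal (t - \<alpha> - u \<bullet> \<beta>) \<le> 0)" for i
    by (auto simp: SUP_le_iff)
  then show ?thesis
    unfolding ap_w_set_def * by auto
qed

section \<open>Optimality criteria and comparison of optimal values\<close>

lemma solves_inf_I:
  assumes "x \<in> X" "f x \<noteq> \<infinity>" "f x \<le> inf_value X f"
  shows "solves_inf X f x"
proof -
  have "inf_value X f \<le> f x"
    using assms(1) by (auto simp: inf_value_def intro: INF_lower)
  then show ?thesis
    using assms by (auto simp: solves_inf_def)
qed

lemma solves_sup_I:
  assumes "x \<in> X" "f x \<noteq> - \<infinity>" "sup_value X f \<le> f x"
  shows "solves_sup X f x"
proof -
  have "f x \<le> sup_value X f"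
    using assms(1) by (auto simp: sup_value_def intro: SUP_upper)
  then show ?thesis
    using assms by (auto simp: solves_sup_def)
qed

lemma sup_value_le_inf_value:
  "(\<And>x y. x \<in> X \<Longrightarrow> y \<in> Y \<Longrightarrow> f x \<le> f' y) \<Longrightarrow> sup_value X f \<le> inf_value Y f'"
  unfolding sup_value_def inf_value_def by (intro SUP_least INF_greatest)

locale uq =
  fixes g :: "'i::finite \<Rightarrow> real^'n::finite \<Rightarrow> ereal"
    and c :: "'l::finite \<Rightarrow> real^'n \<Rightarrow> ereal"
    and h :: "'j::finite \<Rightarrow> real^'n \<Rightarrow> ereal"
    and \<mu> :: "real^'j"
  assumes pcc_g: "pcc_fun (\<lambda>z. - g i z)"
    and pcc_c: "pcc_fun (c l)"
    and pcc_h: "pcc_fun (h j)"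
    and Sbar_ne: "Sbar_i g c h i \<noteq> {}"
begin

abbreviation "F \<equiv> family g c h"

lemma pcc_F: "pcc_fun (F i k)"
  using pcc_g pcc_c pcc_h by (auto simp: family_def split: option.split sum.split)

lemma mem_ap_w'_set_iff_family:
  "(\<alpha>, \<beta>, y0, y1, y2, \<nu>) \<in> ap_w'_set g c h \<longleftrightarrow>
     (\<forall>j. 0 \<le> \<beta> $ j) \<and> (\<forall>i l. 0 \<le> \<nu> $ i $ l) \<and>
     (\<forall>i. (\<Sum>k\<in>UNIV. by_index (y0 $ i) (y1 $ i) (y2 $ i) k) = 0) \<and>
     (\<forall>i. \<exists>s. (\<forall>k. persp (conjugate (F i k)) (by_index (y0 $ i) (y1 $ i) (y2 $ i) k)
                (by_index 1 \<beta> (\<nu> $ i) k) \<le> ereal (s k)) \<and> (\<Sum>k\<in>UNIV. s k) \<le> \<alpha>)"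
proof -
  have *: "(\<Sum>k\<in>UNIV. by_index (y0 $ i) (y1 $ i) (y2 $ i) k)
      = y0 $ i + (\<Sum>j\<in>UNIV. y1 $ i $ j) + (\<Sum>l\<in>UNIV. y2 $ i $ l)" for i
    by (simp add: sum_option_sum)
  show ?thesis
    unfolding mem_ap_w'_set_iff ap_w'_constraint_eq_sum *
    by (subst sum_ereal_le_iff) (auto simp: persp_conjugate_ne_MInf[OF pcc_F])
qed

text \<open>Add \<open>persp_inner_le\<close> over the whole family at the common point
  \<open>v\<close>: the slopes sum to zero, so the left-hand side disappears.\<close>

lemma weak_duality_component:
  assumes t: "0 \<le> t" and v: "\<And>k. persp (F i k) v t \<le> ereal (by_index (- \<tau>) w 0 k)"
    and y: "\<And>k. persp (conjugate (F i k)) (y k) (by_index 1 \<beta> n k) \<le> ereal (s k)"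
    and sums: "(\<Sum>k\<in>UNIV. y k) = 0" "(\<Sum>k\<in>UNIV. s k) \<le> \<alpha>"
  shows "\<tau> \<le> t * \<alpha> + \<beta> \<bullet> w"
proof -
  have "0 = (\<Sum>k\<in>UNIV. y k \<bullet> v)"
    using sums by (simp flip: inner_sum_left)
  also have "\<dots> \<le> (\<Sum>k\<in>UNIV. t * s k + by_index 1 \<beta> n k * by_index (- \<tau>) w 0 k)"
    by (intro sum_mono persp_inner_le[OF pcc_F v y])
  also have "\<dots> = t * (\<Sum>k\<in>UNIV. s k) + (\<beta> \<bullet> w - \<tau>)"
    by (simp add: sum.distrib sum_distrib_left sum_by_index_mult)
  also have "\<dots> \<le> t * \<alpha> + (\<beta> \<bullet> w - \<tau>)"
    using t sums by (simp add: mult_left_mono)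
  finally show ?thesis by simp
qed

lemma ap_w'_subset_ap_w:
  assumes "(\<alpha>, \<beta>, y0, y1, y2, \<nu>) \<in> ap_w'_set g c h"
  shows "(\<alpha>, \<beta>) \<in> ap_w_set g c h"
  unfolding ap_w_set_iff
proof (intro conjI allI impI)
  note A = assms[unfolded mem_ap_w'_set_iff_family]
  show "0 \<le> \<beta> $ j" for j
    using A by blast
  fix i z u t
  assume U: "(z, u, t) \<in> Uset g c h i"
  obtain s where s: "\<And>k. persp (conjugate (F i k)) (by_index (y0 $ i) (y1 $ i) (y2 $ i) k)
      (by_index 1 \<beta> (\<nu> $ i) k) \<le> ereal (s k)" "(\<Sum>k\<in>UNIV. s k) \<le> \<alpha>"
    using A by metis
  \<comment> \<open>Weight 1, where the perspective is the function itself.\<close>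
  have "t \<le> 1 * \<alpha> + \<beta> \<bullet> u"
    by (rule weak_duality_component[OF _ _ s(1) _ s(2)])
      (use A U in \<open>auto simp: mem_Uset_iff persp_1\<close>)
  then show "t \<le> \<alpha> + \<beta> \<bullet> u" by simp
qed

lemma ad_b'_le_ap_w':
  "sup_value (ad_b'_set g c h \<mu>) ad_b'_obj \<le> inf_value (ap_w'_set g c h) (ap_w'_obj \<mu>)"
proof (rule sup_value_le_inf_value)
  fix x p
  assume x: "x \<in> ad_b'_set g c h \<mu>" and p: "p \<in> ap_w'_set g c h"
  obtain \<tau> lam \<omega> \<upsilon> where x_eq: "x = (\<tau>, lam, \<omega>, \<upsilon>)"
    by (metis prod_cases4)
  obtain \<alpha> \<beta> y0 y1 y2 \<nu> where p_eq: "p = (\<alpha>, \<beta>, y0, y1, y2, \<nu>)"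
    by (metis prod_cases6)
  note X = x[unfolded x_eq mem_ad_b'_set_iff_family]
  note P = p[unfolded p_eq mem_ap_w'_set_iff_family]
  have "\<tau> $ i \<le> lam $ i * \<alpha> + \<beta> \<bullet> (\<omega> $ i)" for i
  proof -
    obtain s where s: "\<And>k. persp (conjugate (F i k)) (by_index (y0 $ i) (y1 $ i) (y2 $ i) k)
        (by_index 1 \<beta> (\<nu> $ i) k) \<le> ereal (s k)" "(\<Sum>k\<in>UNIV. s k) \<le> \<alpha>"
      using P by metis
    show ?thesis
      by (rule weak_duality_component[OF _ _ s(1) _ s(2)]) (use X P in auto)
  qed
  then have "(\<Sum>i\<in>UNIV. \<tau> $ i) \<le> (\<Sum>i\<in>UNIV. lam $ i * \<alpha> + \<beta> \<bullet> (\<omega> $ i))"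
    by (intro sum_mono)
  also have "\<dots> = \<alpha> + \<beta> \<bullet> (\<Sum>i\<in>UNIV. \<omega> $ i)"
    using X by (simp add: sum.distrib inner_sum_right flip: sum_distrib_right)
  also have "\<beta> \<bullet> (\<Sum>i\<in>UNIV. \<omega> $ i) \<le> \<mu> \<bullet> \<beta>"
    using X P by (auto simp: inner_vec_def mult.commute intro!: sum_mono mult_left_mono)
  finally show "ad_b'_obj x \<le> ap_w'_obj \<mu> p"
    by (simp add: x_eq p_eq ad_b'_obj_def ap_w'_obj_def)
qed

lemma ap_w_le_ap_w':
  "inf_value (ap_w_set g c h) (ab_obj \<mu>) \<le> inf_value (ap_w'_set g c h) (ap_w'_obj \<mu>)"
  unfolding inf_value_def
proof (rule INF_greatest)
  fix p assume p: "p \<in> ap_w'_set g c h"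
  obtain \<alpha> \<beta> y0 y1 y2 \<nu> where p_eq: "p = (\<alpha>, \<beta>, y0, y1, y2, \<nu>)"
    by (metis prod_cases6)
  have "Inf (ab_obj \<mu> ` ap_w_set g c h) \<le> ab_obj \<mu> (\<alpha>, \<beta>)"
    by (rule INF_lower) (rule ap_w'_subset_ap_w[OF p[unfolded p_eq]])
  then show "Inf (ab_obj \<mu> ` ap_w_set g c h) \<le> ap_w'_obj \<mu> p"
    by (simp add: p_eq ab_obj_def ap_w'_obj_def)
qed

lemma g_ne_PInf: "g i z \<noteq> \<infinity>"
  using pcc_fun_ne_MInf[OF pcc_g, of i z] by auto

text \<open>All values on \<open>Sbar\<close> are finite, which turns the constraints of (D-UQ) and
  (FR) into real arithmetic. The maximum is finite although single \<open>g i\<close> may be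
  \<open>- \<infinity>\<close>.\<close>

lemma mem_SbarE:
  assumes "z \<in> Sbar g c h"
  obtains H G where "z \<in> supp_set c" "\<And>j. h j z = ereal (H $ j)" "gmax g z = ereal G"
proof -
  obtain i where i: "z \<in> Sbar_i g c h i"
    using assms by (auto simp: Sbar_def)
  have "h j z = ereal (real_of_ereal (h j z))" for j
  proof -
    have "h j z \<noteq> \<infinity>"
      using i by (auto simp: Sbar_i_def effective_domain_def)
    then show ?thesis
      using pcc_fun_ne_MInf[OF pcc_h, of j z] by (cases "h j z") auto
  qed
  moreover obtain i' where i': "gmax g z = g i' z"
    using gmax_attained .
  moreover have "g i z \<noteq> - \<infinity>"
    using i by (auto simp: Sbar_i_def effective_domain_def)
  then have "gmax g z \<noteq> - \<infinity>"
    using gmax_upper[of g i z] by auto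
  moreover have "gmax g z \<noteq> \<infinity>"
    using i' g_ne_PInf by simp
  then have "gmax g z = ereal (real_of_ereal (gmax g z))"
    using \<open>gmax g z \<noteq> - \<infinity>\<close> by (cases "gmax g z") auto
  moreover have "z \<in> supp_set c"
    using i by (simp add: Sbar_i_def)
  ultimately show ?thesis
    using that[of "\<chi> j. real_of_ereal (h j z)" "real_of_ereal (gmax g z)"] by simp
qed

lemma mem_SbarI:
  assumes "z \<in> supp_set c" "\<And>j. h j z < \<infinity>" "gmax g z \<noteq> - \<infinity>"
  shows "z \<in> Sbar g c h"
proof -
  obtain i where "gmax g z = g i z"
    using gmax_attained .
  then have "z \<in> Sbar_i g c h i"
    using assms by (cases "g i z") (auto simp: Sbar_i_def effective_domain_def)
  then show ?thesis
    by (auto simp: Sbar_def)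
qed

lemma mem_Uset_imp_Sbar:
  assumes "(z, u, t) \<in> Uset g c h i"
  shows "z \<in> Sbar g c h" "ereal t \<le> gmax g z" "\<And>j. h j z \<le> ereal (u $ j)"
proof -
  show le: "ereal t \<le> gmax g z"
    using assms gmax_upper[of g i z] by (auto simp: Uset_def intro: order_trans)
  show u: "h j z \<le> ereal (u $ j)" for j
    using assms by (simp add: Uset_def)
  have "h j z < \<infinity>" for j
    using u[of j] by auto
  moreover have "z \<in> supp_set c"
    using assms by (simp add: Uset_def supp_set_def)
  ultimately show "z \<in> Sbar g c h"
    using le by (intro mem_SbarI) auto
qed

lemma d_uq_set_iff:
  "(\<alpha>, \<beta>) \<in> d_uq_set g c h \<longleftrightarrow> (\<forall>j. 0 \<le> \<beta> $ j) \<and>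
     (\<forall>z H G. z \<in> supp_set c \<longrightarrow> (\<forall>j. h j z = ereal (H $ j)) \<longrightarrow> gmax g z = ereal G \<longrightarrow> G \<le> \<alpha> + \<beta> \<bullet> H)"
    (is "_ \<longleftrightarrow> _ \<and> (\<forall>z. ?P z)")
proof -
  have sum: "(\<Sum>j\<in>UNIV. h j z * ereal (\<beta> $ j)) = ereal (\<beta> \<bullet> H)" if "\<And>j. h j z = ereal (H $ j)" for z H
    using that by (simp add: inner_vec_def mult.commute)
  have eq: "gmax g z - ereal \<alpha> - (\<Sum>j\<in>UNIV. h j z * ereal (\<beta> $ j)) \<le> 0 \<longleftrightarrow> G \<le> \<alpha> + \<beta> \<bullet> H"
    if "\<And>j. h j z = ereal (H $ j)" "gmax g z = ereal G" for z H G
    unfolding sum[of z H, OF that(1)] that(2) by (auto simp: zero_ereal_def)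
  have Sb: "z \<in> Sbar g c h" if "z \<in> supp_set c" "\<And>j. h j z = ereal (H $ j)" "gmax g z = ereal G" for z H G
    using that by (intro mem_SbarI) auto
  have "(\<forall>z\<in>Sbar g c h. gmax g z - ereal \<alpha> - (\<Sum>j\<in>UNIV. h j z * ereal (\<beta> $ j)) \<le> 0) \<longleftrightarrow> (\<forall>z. ?P z)"
  proof (intro iffI ballI allI impI)
    fix z H G
    assume all: "\<forall>z\<in>Sbar g c h. gmax g z - ereal \<alpha> - (\<Sum>j\<in>UNIV. h j z * ereal (\<beta> $ j)) \<le> 0"
      and z: "z \<in> supp_set c" "\<forall>j. h j z = ereal (H $ j)" "gmax g z = ereal G"
    show "G \<le> \<alpha> + \<beta> \<bullet> H"
      using bspec[OF all Sb[of z H G]] z eq[of z H G] by blast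
  next
    fix z
    assume all: "\<forall>z. ?P z" and z: "z \<in> Sbar g c h"
    obtain H G where "z \<in> supp_set c" "\<And>j. h j z = ereal (H $ j)" "gmax g z = ereal G"
      using mem_SbarE[OF z] by blast
    then show "gmax g z - ereal \<alpha> - (\<Sum>j\<in>UNIV. h j z * ereal (\<beta> $ j)) \<le> 0"
      using all eq[of z H G] by blast
  qed
  then show ?thesis
    by (auto simp: d_uq_set_def SUP_le_iff)
qed

text \<open>Not only the values but the feasible sets agree. Over each \<open>z\<close> the tightest
  choice in \<open>Uset\<close> is \<open>u = h z\<close> and \<open>t = gmax g z\<close>, realized
  by an index attaining the maximum; larger \<open>u\<close> and smaller \<open>t\<close> only relax
  the inequality since \<open>\<beta>\<close> is nonnegative.\<close>

lemma d_uq_set_eq_ap_w_set: "d_uq_set g c h = ap_w_set g c h"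
proof -
  have "(\<alpha>, \<beta>) \<in> d_uq_set g c h \<longleftrightarrow> (\<alpha>, \<beta>) \<in> ap_w_set g c h" for \<alpha> \<beta>
  proof
    assume D: "(\<alpha>, \<beta>) \<in> d_uq_set g c h"
    have "t \<le> \<alpha> + \<beta> \<bullet> u" if U: "(z, u, t) \<in> Uset g c h i" for i z u t
    proof -
      note U' = mem_Uset_imp_Sbar[OF U]
      obtain H G where z: "z \<in> supp_set c" "\<And>j. h j z = ereal (H $ j)" "gmax g z = ereal G"
        using mem_SbarE[OF U'(1)] by blast
      have "t \<le> G"
        using U'(2) z by simp
      also have "G \<le> \<alpha> + \<beta> \<bullet> H"
        using D z unfolding d_uq_set_iff by blast
      also have "\<beta> \<bullet> H \<le> \<beta> \<bullet> u"
        using U'(3) z D by (auto simp: inner_vec_def d_uq_set_iff intro!: sum_mono mult_left_mono)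
      finally show ?thesis by simp
    qed
    then show "(\<alpha>, \<beta>) \<in> ap_w_set g c h"
      using D by (auto simp: ap_w_set_iff d_uq_set_iff)
  next
    assume A: "(\<alpha>, \<beta>) \<in> ap_w_set g c h"
    have "G \<le> \<alpha> + \<beta> \<bullet> H"
      if z: "z \<in> supp_set c" "\<And>j. h j z = ereal (H $ j)" "gmax g z = ereal G" for z H G
    proof -
      obtain i where "gmax g z = g i z"
        using gmax_attained .
      then have "(z, H, G) \<in> Uset g c h i"
        using z by (simp add: Uset_def supp_set_def)
      then show ?thesis
        using A by (auto simp: ap_w_set_iff)
    qed
    then show "(\<alpha>, \<beta>) \<in> d_uq_set g c h"
      using A by (auto simp: ap_w_set_iff d_uq_set_iff)
  qed
  then show ?thesis by auto
qed

text \<open>Multiply points and bounds by the weights. The substitution need not be reversible: at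
  weight 0, (AD-B') may still use recession directions.\<close>

lemma ad_b_le_ad_b':
  "sup_value (ad_b_set g c h \<mu>) ad_b_obj \<le> sup_value (ad_b'_set g c h \<mu>) ad_b'_obj"
  unfolding sup_value_def
proof (rule SUP_least)
  fix x assume x: "x \<in> ad_b_set g c h \<mu>"
  obtain lam z u t where x_eq: "x = (lam, z, u, t)"
    by (metis prod_cases4)
  note X = x[unfolded x_eq ad_b_set_def, simplified]
  let ?y = "(\<chi> i. lam $ i * t $ i, lam, \<chi> i. lam $ i *\<^sub>R (u $ i), \<chi> i. lam $ i *\<^sub>R (z $ i))"
  have "persp (F i k) (lam $ i *\<^sub>R (z $ i)) (lam $ i)
      \<le> ereal (by_index (- (lam $ i * t $ i)) (lam $ i *\<^sub>R (u $ i)) 0 k)" for i k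
  proof -
    have "F i k (z $ i) \<le> ereal (by_index (- (t $ i)) (u $ i) 0 k)"
      using X by (simp add: mem_Uset_iff)
    then have "persp (F i k) (lam $ i *\<^sub>R (z $ i)) (lam $ i)
        \<le> ereal (lam $ i * by_index (- (t $ i)) (u $ i) 0 k)"
      using X by (intro persp_scale pcc_F) auto
    also have "lam $ i * by_index (- (t $ i)) (u $ i) 0 k = by_index (- (lam $ i * t $ i)) (lam $ i *\<^sub>R (u $ i)) 0 k"
      by (auto simp: by_index_def split: option.split sum.split)
    finally show ?thesis .
  qed
  then have "?y \<in> ad_b'_set g c h \<mu>"
    using X by (simp add: mem_ad_b'_set_iff_family)
  then have "ad_b'_obj ?y \<le> Sup (ad_b'_obj ` ad_b'_set g c h \<mu>)"
    by (rule SUP_upper)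
  then show "ad_b_obj x \<le> Sup (ad_b'_obj ` ad_b'_set g c h \<mu>)"
    by (simp add: x_eq ad_b'_obj_def ad_b_obj_def)
qed

lemma ad_b_le_fr:
  "sup_value (ad_b_set g c h \<mu>) ad_b_obj \<le> sup_value (fr_set g c h \<mu>) (fr_obj g)"
  unfolding sup_value_def
proof (rule SUP_least)
  fix x assume x: "x \<in> ad_b_set g c h \<mu>"
  obtain lam z u t where x_eq: "x = (lam, z, u, t)"
    by (metis prod_cases4)
  note X = x[unfolded x_eq ad_b_set_def, simplified]
  have U: "z $ i \<in> Sbar g c h" "ereal (t $ i) \<le> gmax g (z $ i)" "h j (z $ i) \<le> ereal (u $ i $ j)" for i j
    using mem_Uset_imp_Sbar[of "z $ i" "u $ i" "t $ i" i] X by auto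
  have "(\<Sum>i\<in>UNIV. ereal (lam $ i) * h j (z $ i)) \<le> ereal (\<mu> $ j)" for j
  proof -
    have "(\<Sum>i\<in>UNIV. ereal (lam $ i) * h j (z $ i)) \<le> (\<Sum>i\<in>UNIV. ereal (lam $ i) * ereal (u $ i $ j))"
      using U X by (intro sum_mono ereal_mult_left_mono) auto
    also have "\<dots> \<le> ereal (\<mu> $ j)"
      using X by simp
    finally show ?thesis .
  qed
  then have "(lam, z) \<in> fr_set g c h \<mu>"
    using X U by (simp add: fr_set_def)
  then have "fr_obj g (lam, z) \<le> Sup (fr_obj g ` fr_set g c h \<mu>)"
    by (rule SUP_upper)
  moreover have "(\<Sum>i\<in>UNIV. ereal (lam $ i) * ereal (t $ i)) \<le> fr_obj g (lam, z)"
    unfolding fr_obj_def prod.case using U X by (intro sum_mono ereal_mult_left_mono) auto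
  ultimately show "ad_b_obj x \<le> Sup (fr_obj g ` fr_set g c h \<mu>)"
    by (simp add: x_eq ad_b_obj_def)
qed

end

section \<open>Distributions\<close>

lemma ennreal_max_0: "ennreal (max 0 x) = ennreal x"
  by (cases "0 \<le> x") (auto simp: max_def ennreal_neg)

lemma ennreal_weighted_sum:
  assumes "\<And>j. j \<in> J \<Longrightarrow> 0 \<le> b j"
  shows "(\<Sum>j\<in>J. ennreal (b j) * ennreal (x j)) = ennreal (\<Sum>j\<in>J. b j * max 0 (x j))"
proof -
  have "ennreal (b j) * ennreal (x j) = ennreal (b j * max 0 (x j))" if "j \<in> J" for j
    using assms[OF that] by (simp add: ennreal_mult ennreal_max_0)
  then have "(\<Sum>j\<in>J. ennreal (b j) * ennreal (x j)) = (\<Sum>j\<in>J. ennreal (b j * max 0 (x j)))"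
    by (intro sum.cong) auto
  also have "\<dots> = ennreal (\<Sum>j\<in>J. b j * max 0 (x j))"
    using assms by (intro sum_ennreal) auto
  finally show ?thesis .
qed

text \<open>The negative parts are moved to the other side, so that no truncating subtraction of
  \<^typ>\<open>ennreal\<close> occurs.\<close>

lemma ennreal_parts_le:
  assumes b: "\<And>j. j \<in> J \<Longrightarrow> 0 \<le> b j" and le: "G \<le> a + (\<Sum>j\<in>J. b j * H j)"
  shows "ennreal G + (\<Sum>j\<in>J. ennreal (b j) * ennreal (- H j)) + ennreal (- a)
    \<le> ennreal (- G) + (\<Sum>j\<in>J. ennreal (b j) * ennreal (H j)) + ennreal a"
proof -
  have nonneg: "0 \<le> (\<Sum>j\<in>J. b j * max 0 (x j))" for x
    using b by (intro sum_nonneg) auto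
  have split: "max 0 x - max 0 (- x) = x" for x :: real
    by (simp add: max_def)
  have "(\<Sum>j\<in>J. b j * max 0 (H j)) - (\<Sum>j\<in>J. b j * max 0 (- H j)) = (\<Sum>j\<in>J. b j * H j)"
    by (simp add: sum_subtractf[symmetric] right_diff_distrib[symmetric] split)
  then have "max 0 G + (\<Sum>j\<in>J. b j * max 0 (- H j)) + max 0 (- a)
      \<le> max 0 (- G) + (\<Sum>j\<in>J. b j * max 0 (H j)) + max 0 a"
    using le split[of G] split[of a] by linarith
  then have "ennreal (max 0 G + (\<Sum>j\<in>J. b j * max 0 (- H j)) + max 0 (- a))
      \<le> ennreal (max 0 (- G) + (\<Sum>j\<in>J. b j * max 0 (H j)) + max 0 a)"
    by (rule ennreal_leI)
  then show ?thesis
    using nonneg by (simp add: ennreal_weighted_sum[OF b] ennreal_max_0)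
qed

text \<open>The default \<open>\<infinity>\<close> rules out an infinite positive part under a
  finite bound. The negative part may still be infinite, so the real inequality is
  conditional.\<close>

lemma ext_expectation_le_D:
  assumes "ext_expectation \<infinity> M f \<le> ereal m"
  shows "(\<integral>\<^sup>+ x. e2ennreal (f x) \<partial>M) < \<infinity>"
    and "(\<integral>\<^sup>+ x. e2ennreal (- f x) \<partial>M) < \<infinity> \<Longrightarrow>
      enn2real (\<integral>\<^sup>+ x. e2ennreal (f x) \<partial>M) - enn2real (\<integral>\<^sup>+ x. e2ennreal (- f x) \<partial>M) \<le> m"
proof -
  define p where "p = (\<integral>\<^sup>+ x. e2ennreal (f x) \<partial>M)"
  define n where "n = (\<integral>\<^sup>+ x. e2ennreal (- f x) \<partial>M)"
  have le: "(if p = \<infinity> \<and> n = \<infinity> then \<infinity> else enn2ereal p - enn2ereal n) \<le> ereal m"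
    using assms unfolding ext_expectation_def Let_def p_def[symmetric] n_def[symmetric] .
  then have "p \<noteq> \<infinity>"
    by (cases n) (auto split: if_splits)
  then show "(\<integral>\<^sup>+ x. e2ennreal (f x) \<partial>M) < \<infinity>"
    by (simp add: p_def less_top)
  assume "(\<integral>\<^sup>+ x. e2ennreal (- f x) \<partial>M) < \<infinity>"
  then have "n \<noteq> \<infinity>"
    by (simp add: n_def less_top)
  then show "enn2real (\<integral>\<^sup>+ x. e2ennreal (f x) \<partial>M) - enn2real (\<integral>\<^sup>+ x. e2ennreal (- f x) \<partial>M) \<le> m"
    using le \<open>p \<noteq> \<infinity>\<close> unfolding p_def[symmetric] n_def[symmetric]
    by (cases p; cases n) auto
qed

section \<open>Finitely supported distributions\<close>

lemma nn_integral_discrete_distribution: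
  assumes [measurable]: "f \<in> borel_measurable borel"
  shows "nn_integral (discrete_distribution lam \<upsilon>) f
    = (\<Sum>i | 0 < lam $ i. ennreal (lam $ i) * f (\<upsilon> $ i /\<^sub>R lam $ i))"
  unfolding discrete_distribution_def
  by (subst nn_integral_distr) (auto simp: nn_integral_point_measure_finite mult.commute)

lemma sets_discrete_distribution [simp]: "sets (discrete_distribution lam \<upsilon>) = sets borel"
  by (simp add: discrete_distribution_def)

lemma emeasure_discrete_distribution:
  assumes lam: "(\<Sum>i\<in>UNIV. lam $ i) = 1" "\<And>i. 0 \<le> lam $ i"
    and A: "A \<in> sets borel" "\<And>i. 0 < lam $ i \<Longrightarrow> \<upsilon> $ i /\<^sub>R lam $ i \<in> A"
  shows "emeasure (discrete_distribution lam \<upsilon>) A = 1"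
proof -
  have "emeasure (discrete_distribution lam \<upsilon>) A = nn_integral (discrete_distribution lam \<upsilon>) (indicator A)"
    using A by simp
  also have "\<dots> = (\<Sum>i | 0 < lam $ i. ennreal (lam $ i) * indicator A (\<upsilon> $ i /\<^sub>R lam $ i))"
    using A by (intro nn_integral_discrete_distribution) auto
  also have "\<dots> = (\<Sum>i | 0 < lam $ i. ennreal (lam $ i))"
    using A by (intro sum.cong) auto
  also have "\<dots> = ennreal (\<Sum>i | 0 < lam $ i. lam $ i)"
    by (intro sum_ennreal) auto
  also have "(\<Sum>i | 0 < lam $ i. lam $ i) = (\<Sum>i\<in>UNIV. lam $ i)"
    using lam(2) by (intro sum.mono_neutral_left) (auto simp: not_less order_antisym)
  finally show ?thesis
    using lam(1) by simp
qed

lemma prob_space_discrete_distribution: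
  assumes "(\<Sum>i\<in>UNIV. lam $ i) = 1" "\<And>i. 0 \<le> lam $ i"
  shows "prob_space (discrete_distribution lam \<upsilon>)"
proof
  have "space (discrete_distribution lam \<upsilon>) = UNIV"
    by (simp add: discrete_distribution_def)
  then show "emeasure (discrete_distribution lam \<upsilon>) (space (discrete_distribution lam \<upsilon>)) = 1"
    using emeasure_discrete_distribution[OF assms, of UNIV] by simp
qed

lemma ext_expectation_discrete_distribution:
  assumes f: "f \<in> borel_measurable borel"
    and r: "\<And>i. 0 < lam $ i \<Longrightarrow> f (\<upsilon> $ i /\<^sub>R lam $ i) = ereal (r i)"
  shows "ext_expectation v (discrete_distribution lam \<upsilon>) f = ereal (\<Sum>i | 0 < lam $ i. lam $ i * r i)"
proof -
  have [measurable]: "f \<in> borel_measurable borel" by (fact f)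
  have "(\<integral>\<^sup>+ x. e2ennreal (f x) \<partial>discrete_distribution lam \<upsilon>)
      = (\<Sum>i | 0 < lam $ i. ennreal (lam $ i) * ennreal (r i))"
    by (subst nn_integral_discrete_distribution) (auto intro!: sum.cong simp: r)
  then have p: "(\<integral>\<^sup>+ x. e2ennreal (f x) \<partial>discrete_distribution lam \<upsilon>)
      = ennreal (\<Sum>i | 0 < lam $ i. lam $ i * max 0 (r i))"
    by (subst (asm) ennreal_weighted_sum) auto
  have "(\<integral>\<^sup>+ x. e2ennreal (- f x) \<partial>discrete_distribution lam \<upsilon>)
      = (\<Sum>i | 0 < lam $ i. ennreal (lam $ i) * ennreal (- r i))"
    by (subst nn_integral_discrete_distribution) (auto intro!: sum.cong simp: r)
  then have n: "(\<integral>\<^sup>+ x. e2ennreal (- f x) \<partial>discrete_distribution lam \<upsilon>)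
      = ennreal (\<Sum>i | 0 < lam $ i. lam $ i * max 0 (- r i))"
    by (subst (asm) ennreal_weighted_sum) auto
  have split: "max 0 x - max 0 (- x) = x" for x :: real
    by (simp add: max_def)
  have "0 \<le> (\<Sum>i | 0 < lam $ i. lam $ i * max 0 (x i))" for x
    by (intro sum_nonneg) auto
  then have "ext_expectation v (discrete_distribution lam \<upsilon>) f
      = ereal ((\<Sum>i | 0 < lam $ i. lam $ i * max 0 (r i)) - (\<Sum>i | 0 < lam $ i. lam $ i * max 0 (- r i)))"
    by (simp add: ext_expectation_def Let_def p n enn2ereal_ennreal)
  also have "(\<Sum>i | 0 < lam $ i. lam $ i * max 0 (r i)) - (\<Sum>i | 0 < lam $ i. lam $ i * max 0 (- r i))
      = (\<Sum>i | 0 < lam $ i. lam $ i * r i)"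
    by (simp add: sum_subtractf[symmetric] right_diff_distrib[symmetric] split)
  finally show ?thesis .
qed

context uq
begin

section \<open>The value of (P-UQ) between (FR) and (D-UQ)\<close>

lemma borel_measurable_h: "h j \<in> borel_measurable borel"
  by (rule borel_measurable_pcc_fun[OF pcc_h])

lemma borel_measurable_gmax: "gmax g \<in> borel_measurable borel"
proof -
  have "(\<lambda>z. - (- g i z)) \<in> borel_measurable borel" for i
    using borel_measurable_pcc_fun[OF pcc_g] by (rule borel_measurable_uminus_ereal)
  then have "g i \<in> borel_measurable borel" for i
    by simp
  then have "(\<lambda>z. SUP i. g i z) \<in> borel_measurable borel"
    by (intro borel_measurable_SUP) auto
  moreover have "gmax g = (\<lambda>z. SUP i. g i z)"
    by (auto simp: gmax_def fun_eq_iff Max_Sup)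
  ultimately show ?thesis by simp
qed

lemma supp_set_borel: "supp_set c \<in> sets borel"
proof -
  have "supp_set c = (\<Inter>l. {z. c l z \<le> ereal 0})"
    by (auto simp: supp_set_def zero_ereal_def)
  then have "closed (supp_set c)"
    using closed_sublevel[OF pcc_c] by auto
  then show ?thesis by (rule borel_closed)
qed

text \<open>The inequality defining (D-UQ) is integrated. Since parts of the integrands may have
  infinite integrals, it is first brought into the subtraction-free form of
  \<open>ennreal_parts_le\<close>, and infinite values are sorted out afterwards.\<close>

lemma p_uq_le_d_uq:
  "sup_value (ambiguity_set c h \<mu>) (p_uq_obj g) \<le> inf_value (d_uq_set g c h) (ab_obj \<mu>)"
proof (rule sup_value_le_inf_value)
  fix M p
  assume M: "M \<in> ambiguity_set c h \<mu>" and p: "p \<in> d_uq_set g c h"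
  obtain \<alpha> \<beta> where p_eq: "p = (\<alpha>, \<beta>)" by fastforce
  have sets [measurable_cong]: "sets M = sets borel" and prob: "prob_space M"
    and S: "emeasure M (supp_set c) = 1"
    and h_le: "\<And>j. ext_expectation \<infinity> M (h j) \<le> ereal (\<mu> $ j)"
    using M by (auto simp: ambiguity_set_def distributions_on_def)
  interpret prob_space M by (fact prob)
  have [measurable]: "h j \<in> borel_measurable borel" "gmax g \<in> borel_measurable borel" for j
    using borel_measurable_h borel_measurable_gmax by auto
  note D = p[unfolded p_eq d_uq_set_iff]
  define P N where "P j = (\<integral>\<^sup>+ x. e2ennreal (h j x) \<partial>M)"
    and "N j = (\<integral>\<^sup>+ x. e2ennreal (- h j x) \<partial>M)" for j
  define PG NG where "PG = (\<integral>\<^sup>+ x. e2ennreal (gmax g x) \<partial>M)"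
    and "NG = (\<integral>\<^sup>+ x. e2ennreal (- gmax g x) \<partial>M)"
  have P: "P j < \<infinity>" and PN: "N j < \<infinity> \<Longrightarrow> enn2real (P j) - enn2real (N j) \<le> \<mu> $ j" for j
    using ext_expectation_le_D[OF h_le] by (auto simp: P_def N_def)
  have AE_S: "AE x in M. x \<in> supp_set c"
    using S by (intro AE_prob_1) (simp add: measure_def)
  have "AE x in M. e2ennreal (h j x) \<noteq> \<infinity>" for j
    using P[of j] unfolding P_def by (intro nn_integral_PInf_AE) auto
  then have AE_h: "AE x in M. \<forall>j. e2ennreal (h j x) \<noteq> \<infinity>"
    by (subst AE_all_countable) auto
  \<comment> \<open>Where \<open>gmax g\<close> is \<open>- \<infinity>\<close>, the right-hand side
    is infinite; at the other admissible points \<open>x\<close> belongs to \<open>Sbar\<close> and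
    all values are real.\<close>
  have pointwise: "e2ennreal (gmax g x) + (\<Sum>j\<in>UNIV. ennreal (\<beta> $ j) * e2ennreal (- h j x)) + ennreal (- \<alpha>)
      \<le> e2ennreal (- gmax g x) + (\<Sum>j\<in>UNIV. ennreal (\<beta> $ j) * e2ennreal (h j x)) + ennreal \<alpha>"
    if x: "x \<in> supp_set c" "\<forall>j. e2ennreal (h j x) \<noteq> \<infinity>" for x
  proof (cases "gmax g x = - \<infinity>")
    case True
    then show ?thesis by simp
  next
    case False
    have "h j x < \<infinity>" for j
      using x(2)[rule_format, of j] by auto
    then have "x \<in> Sbar g c h"
      using x False by (intro mem_SbarI)
    then obtain H G where z: "x \<in> supp_set c" "\<And>j. h j x = ereal (H $ j)" "gmax g x = ereal G"
      using mem_SbarE by blast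
    then have "G \<le> \<alpha> + \<beta> \<bullet> H"
      using D by blast
    then show ?thesis
      using ennreal_parts_le[of UNIV "\<lambda>j. \<beta> $ j" G \<alpha> "\<lambda>j. H $ j"] D z by (simp add: inner_vec_def)
  qed
  have "(\<integral>\<^sup>+ x. e2ennreal (gmax g x) + (\<Sum>j\<in>UNIV. ennreal (\<beta> $ j) * e2ennreal (- h j x)) + ennreal (- \<alpha>) \<partial>M)
      \<le> (\<integral>\<^sup>+ x. e2ennreal (- gmax g x) + (\<Sum>j\<in>UNIV. ennreal (\<beta> $ j) * e2ennreal (h j x)) + ennreal \<alpha> \<partial>M)"
  proof (rule nn_integral_mono_AE)
    show "AE x in M. e2ennreal (gmax g x) + (\<Sum>j\<in>UNIV. ennreal (\<beta> $ j) * e2ennreal (- h j x)) + ennreal (- \<alpha>)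
      \<le> e2ennreal (- gmax g x) + (\<Sum>j\<in>UNIV. ennreal (\<beta> $ j) * e2ennreal (h j x)) + ennreal \<alpha>"
      using AE_S AE_h by eventually_elim (rule pointwise)
  qed
  then have ineq: "PG + (\<Sum>j\<in>UNIV. ennreal (\<beta> $ j) * N j) + ennreal (- \<alpha>)
      \<le> NG + (\<Sum>j\<in>UNIV. ennreal (\<beta> $ j) * P j) + ennreal \<alpha>"
    by (simp add: nn_integral_add nn_integral_sum nn_integral_cmult emeasure_space_1 PG_def NG_def P_def N_def)
  show "p_uq_obj g M \<le> ab_obj \<mu> p"
  proof (cases "NG = \<infinity>")
    \<comment> \<open>Whether the positive part is finite or not, the objective is
      \<open>- \<infinity>\<close>, in the latter case by the default value.\<close>
    case True
    then have "p_uq_obj g M = - \<infinity>"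
      by (cases PG) (auto simp: p_uq_obj_def ext_expectation_def Let_def PG_def NG_def)
    then show ?thesis by simp
  next
    case NG: False
    have "(\<Sum>j\<in>UNIV. ennreal (\<beta> $ j) * P j) < \<infinity>"
      using P by (auto simp: ennreal_mult_less_top)
    then have "NG + (\<Sum>j\<in>UNIV. ennreal (\<beta> $ j) * P j) + ennreal \<alpha> < \<infinity>"
      using NG by (simp add: less_top)
    then have "PG + (\<Sum>j\<in>UNIV. ennreal (\<beta> $ j) * N j) + ennreal (- \<alpha>) < \<infinity>"
      using ineq by (rule le_less_trans[rotated])
    then have PG: "PG < \<infinity>" and fin: "(\<Sum>j\<in>UNIV. ennreal (\<beta> $ j) * N j) < \<infinity>"
      by auto
    have fin: "ennreal (\<beta> $ j) * N j < \<infinity>" for j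
      using fin by simp
    define q n where "q j = enn2real (P j)" and "n j = enn2real (N j)" for j
    have P_eq: "P j = ennreal (q j)" for j
      using P[of j] by (simp add: q_def)
    have N_eq: "ennreal (\<beta> $ j) * N j = ennreal (\<beta> $ j) * ennreal (n j)"
      and qn: "\<beta> $ j * q j - \<beta> $ j * n j \<le> \<beta> $ j * \<mu> $ j" for j
    proof -
      \<comment> \<open>\<open>N j\<close> can be infinite only if \<open>\<beta> $ j = 0\<close>,
        and then the product in \<open>ennreal\<close> is 0, so \<open>N j\<close> may be replaced
        by its real truncation.\<close>
      have *: "\<beta> $ j = 0 \<or> N j < \<infinity>"
        using fin[of j] D by (auto simp: ennreal_mult_less_top)
      then show "ennreal (\<beta> $ j) * N j = ennreal (\<beta> $ j) * ennreal (n j)"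
        by (auto simp: n_def)
      show "\<beta> $ j * q j - \<beta> $ j * n j \<le> \<beta> $ j * \<mu> $ j"
        using * PN[of j] D unfolding q_def n_def right_diff_distrib[symmetric]
        by (auto intro: mult_left_mono)
    qed
    have nn: "0 \<le> q j" "0 \<le> n j" for j
      by (auto simp: q_def n_def)
    obtain pg ng where pg: "PG = ennreal pg" "0 \<le> pg" "NG = ennreal ng" "0 \<le> ng"
      using PG NG by (cases PG; cases NG) auto
    have "ennreal (pg + (\<Sum>j\<in>UNIV. \<beta> $ j * n j) + max 0 (- \<alpha>))
        \<le> ennreal (ng + (\<Sum>j\<in>UNIV. \<beta> $ j * q j) + max 0 \<alpha>)"
    proof -
      have s: "0 \<le> (\<Sum>j\<in>UNIV. \<beta> $ j * q j)" "0 \<le> (\<Sum>j\<in>UNIV. \<beta> $ j * n j)"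
        using D nn by (auto intro!: sum_nonneg)
      have "(\<Sum>j\<in>UNIV. ennreal (\<beta> $ j) * N j) = ennreal (\<Sum>j\<in>UNIV. \<beta> $ j * n j)"
        "(\<Sum>j\<in>UNIV. ennreal (\<beta> $ j) * P j) = ennreal (\<Sum>j\<in>UNIV. \<beta> $ j * q j)"
        unfolding N_eq P_eq using D nn by (auto simp: ennreal_weighted_sum max_absorb2)
      then show ?thesis
        using ineq s pg by (simp add: ennreal_max_0)
    qed
    then have "pg + (\<Sum>j\<in>UNIV. \<beta> $ j * n j) + max 0 (- \<alpha>) \<le> ng + (\<Sum>j\<in>UNIV. \<beta> $ j * q j) + max 0 \<alpha>"
      using pg D nn by (subst (asm) ennreal_le_iff) (auto intro!: add_nonneg_nonneg sum_nonneg)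
    moreover have "(\<Sum>j\<in>UNIV. \<beta> $ j * q j) - (\<Sum>j\<in>UNIV. \<beta> $ j * n j) \<le> (\<Sum>j\<in>UNIV. \<beta> $ j * \<mu> $ j)"
      unfolding sum_subtractf[symmetric] by (intro sum_mono qn)
    moreover have "(\<Sum>j\<in>UNIV. \<beta> $ j * \<mu> $ j) = \<mu> \<bullet> \<beta>"
      by (simp add: inner_vec_def mult.commute)
    moreover have "max 0 \<alpha> - max 0 (- \<alpha>) = \<alpha>"
      by (simp add: max_def)
    ultimately have "pg - ng \<le> \<alpha> + \<mu> \<bullet> \<beta>"
      by linarith
    moreover have "p_uq_obj g M = ereal (pg - ng)"
      using pg by (simp add: p_uq_obj_def ext_expectation_def Let_def enn2ereal_ennreal
          flip: PG_def NG_def)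
    ultimately show ?thesis
      by (simp add: p_eq ab_obj_def)
  qed
qed

lemma discrete_distribution_ambiguity_set:
  assumes lam: "(\<Sum>i\<in>UNIV. lam $ i) = 1" "\<And>i. 0 \<le> lam $ i"
    and S: "\<And>i. 0 < lam $ i \<Longrightarrow> \<upsilon> $ i /\<^sub>R lam $ i \<in> supp_set c"
    and H: "\<And>i j. 0 < lam $ i \<Longrightarrow> h j (\<upsilon> $ i /\<^sub>R lam $ i) = ereal (H i j)"
    and le: "\<And>j. (\<Sum>i | 0 < lam $ i. lam $ i * H i j) \<le> \<mu> $ j"
  shows "discrete_distribution lam \<upsilon> \<in> ambiguity_set c h \<mu>"
proof -
  have "ext_expectation \<infinity> (discrete_distribution lam \<upsilon>) (h j) \<le> ereal (\<mu> $ j)" for j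
    using le[of j] ext_expectation_discrete_distribution[where v = "\<infinity>" and lam = lam, OF borel_measurable_h H] by simp
  then show ?thesis
    using prob_space_discrete_distribution[OF lam] emeasure_discrete_distribution[OF lam supp_set_borel S]
    by (simp add: ambiguity_set_def distributions_on_def)
qed

lemma fr_le_p_uq:
  "sup_value (fr_set g c h \<mu>) (fr_obj g) \<le> sup_value (ambiguity_set c h \<mu>) (p_uq_obj g)"
  unfolding sup_value_def
proof (rule SUP_least)
  fix x assume x: "x \<in> fr_set g c h \<mu>"
  obtain lam z where x_eq: "x = (lam, z)" by fastforce
  note X = x[unfolded x_eq fr_set_def, simplified]
  have "\<exists>H G. (\<forall>j. h j (z $ i) = ereal (H $ j)) \<and> gmax g (z $ i) = ereal G \<and> z $ i \<in> supp_set c" for i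
    using mem_SbarE[of "z $ i"] X by metis
  then obtain H G where HG: "\<And>i j. h j (z $ i) = ereal (H i $ j)" "\<And>i. gmax g (z $ i) = ereal (G i)"
    "\<And>i. z $ i \<in> supp_set c"
    by metis
  \<comment> \<open>\<open>discrete_distribution\<close> divides by the weights, so the points are
    multiplied by them beforehand.\<close>
  define \<upsilon> where "\<upsilon> = (\<chi> i. lam $ i *\<^sub>R (z $ i))"
  have \<upsilon>: "\<upsilon> $ i /\<^sub>R lam $ i = z $ i" if "0 < lam $ i" for i
    using that by (simp add: \<upsilon>_def)
  have sum_pos: "(\<Sum>i | 0 < lam $ i. lam $ i * r i) = (\<Sum>i\<in>UNIV. lam $ i * r i)" for r
    using X by (intro sum.mono_neutral_left) (auto simp: not_less order_antisym)
  have "discrete_distribution lam \<upsilon> \<in> ambiguity_set c h \<mu>"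
    using X HG \<upsilon> by (intro discrete_distribution_ambiguity_set[where H = "\<lambda>i j. H i $ j"])
      (auto simp: sum_pos)
  then have "p_uq_obj g (discrete_distribution lam \<upsilon>) \<le> Sup (p_uq_obj g ` ambiguity_set c h \<mu>)"
    by (rule SUP_upper)
  moreover have "p_uq_obj g (discrete_distribution lam \<upsilon>) = ereal (\<Sum>i\<in>UNIV. lam $ i * G i)"
    unfolding p_uq_obj_def sum_pos[symmetric]
    using HG \<upsilon> by (intro ext_expectation_discrete_distribution borel_measurable_gmax) auto
  moreover have "fr_obj g x = ereal (\<Sum>i\<in>UNIV. lam $ i * G i)"
    using HG by (simp add: x_eq fr_obj_def)
  ultimately show "fr_obj g x \<le> Sup (p_uq_obj g ` ambiguity_set c h \<mu>)"
    by simp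
qed

lemma all_values_equalI:
  assumes "inf_value (ap_w'_set g c h) (ap_w'_obj \<mu>) \<le> sup_value (ad_b_set g c h \<mu>) ad_b_obj"
  shows "all_values_equal g c h \<mu>"
  using assms ap_w_le_ap_w' p_uq_le_d_uq fr_le_p_uq ad_b_le_fr ad_b_le_ad_b' ad_b'_le_ap_w'
  unfolding all_values_equal_def d_uq_set_eq_ap_w_set by (intro conjI) order+

end

section \<open>Strong duality with a Slater point of (AD-B')\<close>

text \<open>Small \<open>s\<close> gives the first claim, large \<open>s\<close> the second.\<close>

lemma nonneg_affine_ray:
  fixes a d :: real
  assumes "\<And>s. 0 < s \<Longrightarrow> 0 \<le> a + s * d"
  shows "0 \<le> a" "0 \<le> d"
proof -
  show "0 \<le> d"
  proof (rule ccontr)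
    assume d: "\<not> 0 \<le> d"
    then have "0 < (\<bar>a\<bar> + 1) / - d"
      by (intro divide_pos_pos) auto
    from assms[OF this] d show False
      by simp
  qed
  show "0 \<le> a"
  proof (rule ccontr)
    assume a: "\<not> 0 \<le> a"
    then have "0 < - a / (2 * (\<bar>d\<bar> + 1))"
      by (intro divide_pos_pos) auto
    from assms[OF this] have "0 \<le> a + - a / (2 * (\<bar>d\<bar> + 1)) * d" .
    also have "- a / (2 * (\<bar>d\<bar> + 1)) * d \<le> - a / (2 * (\<bar>d\<bar> + 1)) * (\<bar>d\<bar> + 1)"
      using a by (intro mult_left_mono divide_nonneg_nonneg) auto
    also have "\<dots> = - a / 2"
      by (simp add: divide_simps)
    finally show False
      using a by simp
  qed
qed

text \<open>This splits the Lagrangian: shrinking all factors together leaves only the constant, and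
  blowing up one factor while the others stay fixed isolates its own term.\<close>

lemma nonneg_on_product_of_cones:
  fixes K :: "'i::finite \<Rightarrow> 'k::finite \<Rightarrow> 'x::real_vector set"
  assumes ne: "\<And>i k. K i k \<noteq> {}"
    and cone: "\<And>i k s x. 0 < s \<Longrightarrow> x \<in> K i k \<Longrightarrow> s *\<^sub>R x \<in> K i k"
    and scale: "\<And>i k s x. \<phi> i k (s *\<^sub>R x) = s * \<phi> i k x"
    and nonneg: "\<And>w. (\<And>i k. w i k \<in> K i k) \<Longrightarrow> 0 \<le> a + (\<Sum>i\<in>UNIV. \<Sum>k\<in>UNIV. \<phi> i k (w i k) :: real)"
  shows "0 \<le> a" "x \<in> K i k \<Longrightarrow> 0 \<le> \<phi> i k x"
proof -
  define p where "p i k = (SOME x. x \<in> K i k)" for i k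
  have p: "p i k \<in> K i k" for i k
    using ne[of i k] by (simp add: p_def some_in_eq)
  have "0 \<le> a + s * (\<Sum>i\<in>UNIV. \<Sum>k\<in>UNIV. \<phi> i k (p i k))" if "0 < s" for s
    using nonneg[of "\<lambda>i k. s *\<^sub>R p i k"] cone[OF that p] by (simp add: scale sum_distrib_left)
  then show "0 \<le> a"
    by (rule nonneg_affine_ray)
  assume x: "x \<in> K i k"
  let ?R = "\<Sum>(i', k')\<in>UNIV - {(i, k)}. \<phi> i' k' (p i' k')"
  have "0 \<le> (a + ?R) + s * \<phi> i k x" if "0 < s" for s
  proof -
    let ?w = "\<lambda>i' k'. if (i', k') = (i, k) then s *\<^sub>R x else p i' k'"
    have "0 \<le> a + (\<Sum>i\<in>UNIV. \<Sum>k\<in>UNIV. \<phi> i k (?w i k))"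
      using p cone[OF that x] by (intro nonneg) auto
    also have "(\<Sum>i\<in>UNIV. \<Sum>k\<in>UNIV. \<phi> i k (?w i k)) = (\<Sum>(i', k')\<in>UNIV. \<phi> i' k' (?w i' k'))"
      by (simp add: sum.cartesian_product)
    also have "\<dots> = \<phi> i k (s *\<^sub>R x) + (\<Sum>(i', k')\<in>UNIV - {(i, k)}. \<phi> i' k' (?w i' k'))"
      by (subst sum.remove[of _ "(i, k)"]) auto
    also have "(\<Sum>(i', k')\<in>UNIV - {(i, k)}. \<phi> i' k' (?w i' k')) = ?R"
      by (intro sum.cong) (auto split: if_splits)
    finally show ?thesis
      by (simp add: scale)
  qed
  then show "0 \<le> \<phi> i k x"
    by (rule nonneg_affine_ray)
qed

lemma linear_bounded_below_eq_0:
  fixes \<psi> :: "'x::real_vector \<Rightarrow> real"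
  assumes "\<And>s x. \<psi> (s *\<^sub>R x) = s * \<psi> x" "\<And>x. 0 \<le> a + \<psi> x"
  shows "\<psi> x = 0"
proof -
  have "0 \<le> \<psi> y" for y
    using assms(2)[of "_ *\<^sub>R y"] nonneg_affine_ray(2)[of a "\<psi> y"] by (simp add: assms(1))
  from this[of x] this[of "- 1 *\<^sub>R x"] show ?thesis
    by (simp only: assms(1))
qed

lemma sum_UNIV_sum:
  fixes f :: "'a::finite + 'b::finite \<Rightarrow> 'c::comm_monoid_add"
  shows "(\<Sum>m\<in>UNIV. f m) = (\<Sum>a\<in>UNIV. f (Inl a)) + (\<Sum>b\<in>UNIV. f (Inr b))"
  unfolding UNIV_Plus_UNIV[symmetric] by (subst sum.Plus) auto

lemma sum_UNIV_prod:
  fixes f :: "'a::finite \<times> 'b::finite \<Rightarrow> 'c::comm_monoid_add"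
  shows "(\<Sum>p\<in>UNIV. f p) = (\<Sum>a\<in>UNIV. \<Sum>b\<in>UNIV. f (a, b))"
  by (simp add: sum.cartesian_product)

context uq
begin

text \<open>Each function \<open>F i k\<close> gets its own copy of the point and of its weight. The multipliers of the
  equations that identify the copies are the slopes and the upper bounds of the perspectives of the
  conjugates in (AP-W').\<close>

lemma exists_ap_w'_le:
  fixes G :: "'i \<Rightarrow> ('j + 'l) option \<Rightarrow> ((real^'n) \<times> real) set"
  assumes G_epi: "\<And>i k. G i k \<subseteq> epi (F i k)" and G_conv: "\<And>i k. convex (G i k)"
    and G_graph: "\<And>i k x m. F i k x = ereal m \<Longrightarrow> (x, m) \<in> G i k"
    and core: "\<And>i k. (z i, r i k) \<in> intrinsic_core (G i k)"
    and lam: "\<And>i. 0 < lam i" "(\<Sum>i\<in>UNIV. lam i) = 1"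
    and r_h: "\<And>j. (\<Sum>i\<in>UNIV. lam i * r i (Some (Inl j))) \<le> \<mu> $ j"
    and r_c: "\<And>i l. r i (Some (Inr l)) \<le> 0"
    and V: "sup_value (ad_b_set g c h \<mu>) ad_b_obj \<le> ereal V"
  obtains p where "p \<in> ap_w'_set g c h" "ap_w'_obj \<mu> p \<le> ereal V"
proof -
  define K where "K i k = homogenization (G i k)" for i k
  \<comment> \<open>The unconstrained second component holds, for each \<open>i\<close>, the point
    and the weight that all copies in \<open>w $ i\<close> have to agree with.\<close>
  define C where "C = {w :: ((real^'n) \<times> real \<times> real)^(('j + 'l) option)^'i. \<forall>i. w $ i \<in> {v. \<forall>k. v $ k \<in> K i k}}
    \<times> (UNIV :: (((real^'n) \<times> real)^'i) set)"
  define A where "A = (\<lambda>(w :: ((real^'n) \<times> real \<times> real)^(('j + 'l) option)^'i, f :: ((real^'n) \<times> real)^'i).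
    (\<chi> i. \<chi> k. (fst (w $ i $ k) - fst (f $ i), fst (snd (w $ i $ k)) - snd (f $ i)), (\<Sum>i\<in>UNIV. snd (f $ i)) - 1))"
  \<comment> \<open>The multipliers of the first kind of inequality become \<open>\<beta>\<close>,
    those of the second kind \<open>\<nu>\<close>.\<close>
  define B where "B = (\<lambda>(w :: ((real^'n) \<times> real \<times> real)^(('j + 'l) option)^'i, f :: ((real^'n) \<times> real)^'i).
    \<chi> m. case m of Inl j \<Rightarrow> (\<Sum>i\<in>UNIV. snd (snd (w $ i $ Some (Inl j)))) - \<mu> $ j
      | Inr (i, l) \<Rightarrow> snd (snd (w $ i $ Some (Inr l))))"
  define l where "l = (\<lambda>(w :: ((real^'n) \<times> real \<times> real)^(('j + 'l) option)^'i, f :: ((real^'n) \<times> real)^'i).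
    V + (\<Sum>i\<in>UNIV. snd (snd (w $ i $ None))))"
  define x where "x = (\<chi> i. \<chi> k. (lam i *\<^sub>R z i, lam i, lam i * r i k), \<chi> i. (lam i *\<^sub>R z i, lam i))"
  have K_conv: "convex (K i k)" for i k
    unfolding K_def by (rule convex_homogenization[OF G_conv])
  have C_conv: "convex C"
    unfolding C_def by (intro convex_Times convex_vec K_conv convex_UNIV)
  have x_core: "x \<in> intrinsic_core C"
    unfolding x_def C_def
    by (intro intrinsic_core_Times_UNIV intrinsic_core_vec convex_vec K_conv)
      (simp add: K_def intrinsic_core_homogenization[OF G_conv core lam(1)])
  have Ax: "A x = 0"
    using lam by (simp add: A_def x_def vec_eq_iff zero_prod_def)
  have Bx: "B x $ m \<le> 0" for m
    using r_h r_c lam by (auto simp: B_def x_def less_imp_le mult_nonneg_nonpos split: sum.split)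
  have aff_A: "affine_map A"
    by (auto simp: affine_map_def A_def vec_eq_iff sum.distrib sum_subtractf sum_distrib_left[symmetric] algebra_simps)
  have aff_B: "affine_map B"
    by (auto simp: affine_map_def B_def vec_eq_iff sum.distrib sum_subtractf sum_distrib_left[symmetric] algebra_simps
        split: sum.split)
  have aff_l: "affine_map l"
    by (auto simp: affine_map_def l_def sum.distrib sum_subtractf sum_distrib_left[symmetric] algebra_simps)
  have nonneg: "0 \<le> l q" if q: "q \<in> C" "A q = 0" "\<And>m. B q $ m \<le> 0" for q
  proof -
    obtain w f where q_eq: "q = (w, f)" by fastforce
    define la where "la i = snd (f $ i)" for i
    define rr where "rr i k = snd (snd (w $ i $ k))" for i k
    have w_eq: "w $ i $ k = (fst (f $ i), la i, rr i k)" for i k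
      using q(2) by (auto simp: q_eq A_def vec_eq_iff zero_prod_def prod_eq_iff la_def rr_def)
    have la_sum: "(\<Sum>i\<in>UNIV. la i) = 1"
      using q(2) by (simp add: q_eq A_def la_def zero_prod_def)
    have "w $ i $ k \<in> K i k" for i k
      using q(1) by (simp add: q_eq C_def)
    then have la: "0 < la i" and G: "(fst (f $ i) /\<^sub>R la i, rr i k / la i) \<in> G i k" for i k
      by (simp_all add: w_eq K_def mem_homogenization)
    have rr_h: "(\<Sum>i\<in>UNIV. rr i (Some (Inl j))) \<le> \<mu> $ j" for j
      using q(3)[of "Inl j"] by (simp add: q_eq B_def rr_def)
    have rr_c: "rr i (Some (Inr n)) \<le> 0" for i n
      using q(3)[of "Inr (i, n)"] by (simp add: q_eq B_def rr_def)
    \<comment> \<open>Dividing by the positive weights turns a feasible cone point into a point of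
      (AD-B), whose objective is at most \<open>V\<close>.\<close>
    let ?y = "(\<chi> i. la i, \<chi> i. fst (f $ i) /\<^sub>R la i, \<chi> i. \<chi> j. rr i (Some (Inl j)) / la i, \<chi> i. - rr i None / la i)"
    have "(fst (f $ i) /\<^sub>R la i, \<chi> j. rr i (Some (Inl j)) / la i, - rr i None / la i) \<in> Uset g c h i" for i
      unfolding mem_Uset_iff
    proof
      fix k
      have "F i k (fst (f $ i) /\<^sub>R la i) \<le> ereal (rr i k / la i)"
        using subsetD[OF G_epi G] by simp
      also have "rr i k / la i \<le> by_index (- (- rr i None / la i)) (\<chi> j. rr i (Some (Inl j)) / la i) 0 k"
        using rr_c la[of i] by (auto simp: by_index_def divide_nonpos_pos split: option.split sum.split)
      finally show "F i k (fst (f $ i) /\<^sub>R la i)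
        \<le> ereal (by_index (- (- rr i None / la i)) (\<chi> j. rr i (Some (Inl j)) / la i) 0 k)" by simp
    qed
    moreover have "la i * (rr i k / la i) = rr i k" for i k
      using la[of i] by simp
    ultimately have "?y \<in> ad_b_set g c h \<mu>"
      using la la_sum rr_h by (simp add: ad_b_set_def less_imp_le)
    then have "ad_b_obj ?y \<le> sup_value (ad_b_set g c h \<mu>) ad_b_obj"
      unfolding sup_value_def by (rule SUP_upper)
    also have "\<dots> \<le> ereal V" by (rule V)
    finally have "- (\<Sum>i\<in>UNIV. rr i None) \<le> V"
      using la by (simp add: ad_b_obj_def less_imp_neq[symmetric] sum_negf)
    then show ?thesis
      by (simp add: q_eq l_def rr_def)
  qed
  obtain Y s where s: "\<And>m. 0 \<le> s $ m"
    and L: "\<And>q. q \<in> C \<Longrightarrow> 0 \<le> l q + Y \<bullet> A q + s \<bullet> B q"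
    using lagrange_multipliers[OF C_conv x_core Ax Bx aff_A aff_B aff_l nonneg] by metis
  \<comment> \<open>The multiplier \<open>a\<close> of the normalization of the weights takes the
    place of \<open>\<alpha>\<close> in (AP-W').\<close>
  obtain Y' a where Y: "Y = (Y', a)" by fastforce
  define \<beta> where "\<beta> = (\<chi> j. s $ Inl j)"
  define \<nu> where "\<nu> = (\<chi> i. \<chi> l. s $ Inr (i, l))"
  define b where "b i k = by_index 1 \<beta> (\<nu> $ i) k" for i k
  define \<phi> where "\<phi> i k p = fst (Y' $ i $ k) \<bullet> fst p + snd (Y' $ i $ k) * fst (snd p) + b i k * snd (snd p)" for i k p
  \<comment> \<open>The part of the Lagrangian that is linear in the free variables. Being bounded
    below it vanishes, and its coefficients say that the slopes sum to 0 and the bounds sum to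
    \<open>a\<close>.\<close>
  define \<psi> where "\<psi> f = (\<Sum>i\<in>UNIV. a * snd (f $ i) - (\<Sum>k\<in>UNIV. fst (Y' $ i $ k) \<bullet> fst (f $ i) + snd (Y' $ i $ k) * snd (f $ i)))"
    for f :: "((real^'n) \<times> real)^'i"
  have L_eq: "l (w, f) + Y \<bullet> A (w, f) + s \<bullet> B (w, f)
      = (V - a - \<mu> \<bullet> \<beta>) + (\<Sum>i\<in>UNIV. \<Sum>k\<in>UNIV. \<phi> i k (w $ i $ k)) + \<psi> f" for w f
  proof -
    define rr where "rr i k = snd (snd (w $ i $ k))" for i k
    have "(\<Sum>k\<in>UNIV. b i k * rr i k) = rr i None + (\<Sum>j\<in>UNIV. \<beta> $ j * rr i (Some (Inl j)))
        + (\<Sum>n\<in>UNIV. \<nu> $ i $ n * rr i (Some (Inr n)))" for i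
      by (simp add: sum_option_sum b_def)
    then have b_sum: "(\<Sum>i\<in>UNIV. \<Sum>k\<in>UNIV. b i k * rr i k) = (\<Sum>i\<in>UNIV. rr i None)
        + (\<Sum>i\<in>UNIV. \<Sum>j\<in>UNIV. \<beta> $ j * rr i (Some (Inl j)))
        + (\<Sum>i\<in>UNIV. \<Sum>n\<in>UNIV. \<nu> $ i $ n * rr i (Some (Inr n)))"
      by (simp add: sum.distrib)
    have "s \<bullet> B (w, f) = (\<Sum>j\<in>UNIV. \<beta> $ j * ((\<Sum>i\<in>UNIV. rr i (Some (Inl j))) - \<mu> $ j))
        + (\<Sum>i\<in>UNIV. \<Sum>n\<in>UNIV. \<nu> $ i $ n * rr i (Some (Inr n)))"
      by (simp add: inner_vec_def B_def sum_UNIV_sum sum_UNIV_prod \<beta>_def \<nu>_def rr_def)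
    also have "(\<Sum>j\<in>UNIV. \<beta> $ j * ((\<Sum>i\<in>UNIV. rr i (Some (Inl j))) - \<mu> $ j))
        = (\<Sum>j\<in>UNIV. \<Sum>i\<in>UNIV. \<beta> $ j * rr i (Some (Inl j))) - \<mu> \<bullet> \<beta>"
      by (simp add: right_diff_distrib sum_subtractf sum_distrib_left inner_vec_def mult.commute)
    also have "(\<Sum>j\<in>UNIV. \<Sum>i\<in>UNIV. \<beta> $ j * rr i (Some (Inl j)))
        = (\<Sum>i\<in>UNIV. \<Sum>j\<in>UNIV. \<beta> $ j * rr i (Some (Inl j)))"
      by (rule sum.swap)
    finally have sB: "l (w, f) + s \<bullet> B (w, f) = V - \<mu> \<bullet> \<beta> + (\<Sum>i\<in>UNIV. \<Sum>k\<in>UNIV. b i k * rr i k)"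
      unfolding b_sum by (simp add: l_def) (simp add: rr_def)
    have inner: "Y' \<bullet> M = (\<Sum>i\<in>UNIV. \<Sum>k\<in>UNIV. Y' $ i $ k \<bullet> M $ i $ k)" for M
      by (simp only: inner_vec_def)
    have "Y \<bullet> A (w, f) = (\<Sum>i\<in>UNIV. \<Sum>k\<in>UNIV. fst (Y' $ i $ k) \<bullet> fst (w $ i $ k) + snd (Y' $ i $ k) * fst (snd (w $ i $ k)))
        + \<psi> f - a"
      by (simp add: Y A_def \<psi>_def inner inner_prod_def
          inner_diff_right sum.distrib sum_subtractf sum_distrib_left algebra_simps)
    then show ?thesis
      using sB by (simp add: \<phi>_def rr_def sum.distrib)
  qed
  have L': "0 \<le> (V - a - \<mu> \<bullet> \<beta>) + (\<Sum>i\<in>UNIV. \<Sum>k\<in>UNIV. \<phi> i k (w i k)) + \<psi> f"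
    if "\<And>i k. w i k \<in> K i k" for w f
    using L[of "(\<chi> i. \<chi> k. w i k, f)"] that unfolding L_eq by (simp add: C_def)
  have K_ne: "K i k \<noteq> {}" for i k
    using homogenizationI[OF zero_less_one intrinsic_core_subset[OF core]] by (auto simp: K_def)
  define p where "p i k = (SOME x. x \<in> K i k)" for i k
  have p: "p i k \<in> K i k" for i k
    using K_ne[of i k] by (simp add: p_def some_in_eq)
  have \<psi>_scale: "\<psi> (t *\<^sub>R f) = t * \<psi> f" for t f
    by (simp add: \<psi>_def sum_distrib_left algebra_simps)
  have \<psi>_0: "\<psi> f = 0" for f
    using linear_bounded_below_eq_0[OF \<psi>_scale L'[OF p]] .
  \<comment> \<open>Test with \<open>f\<close> supported at a single index \<open>i\<close>.\<close>
  have \<psi>_single: "a * m = (\<Sum>k\<in>UNIV. fst (Y' $ i $ k)) \<bullet> v + (\<Sum>k\<in>UNIV. snd (Y' $ i $ k)) * m" for i v m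
  proof -
    have "\<psi> (\<chi> i'. if i' = i then (v, m) else 0) = (\<Sum>i'\<in>UNIV. if i' = i then
        a * m - (\<Sum>k\<in>UNIV. fst (Y' $ i $ k) \<bullet> v + snd (Y' $ i $ k) * m) else 0)"
      unfolding \<psi>_def by (intro sum.cong) auto
    then show ?thesis
      by (simp add: \<psi>_0 sum.distrib inner_sum_left sum_distrib_right)
  qed
  have Y_fst: "(\<Sum>k\<in>UNIV. fst (Y' $ i $ k)) = 0" for i
    using \<psi>_single[of 0 i "\<Sum>k\<in>UNIV. fst (Y' $ i $ k)"] by simp
  have Y_snd: "(\<Sum>k\<in>UNIV. snd (Y' $ i $ k)) = a" for i
    using \<psi>_single[of 1 i 0] by simp
  have \<phi>_scale: "\<phi> i k (t *\<^sub>R p) = t * \<phi> i k p" for i k t p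
    by (simp add: \<phi>_def algebra_simps)
  have K_scale: "0 < t \<Longrightarrow> p \<in> K i k \<Longrightarrow> t *\<^sub>R p \<in> K i k" for i k t p
    by (simp add: K_def homogenization_scale)
  have L'': "0 \<le> (V - a - \<mu> \<bullet> \<beta>) + (\<Sum>i\<in>UNIV. \<Sum>k\<in>UNIV. \<phi> i k (w i k))"
    if "\<And>i k. w i k \<in> K i k" for w
    using L'[OF that] by (simp add: \<psi>_0)
  have const: "a + \<mu> \<bullet> \<beta> \<le> V"
    using nonneg_on_product_of_cones(1)[of K \<phi>, OF K_ne K_scale \<phi>_scale L''] by simp
  have \<phi>_nonneg: "0 \<le> \<phi> i k p" if "p \<in> K i k" for i k p
    using nonneg_on_product_of_cones(2)[of K \<phi>, OF K_ne K_scale \<phi>_scale L'' that] .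
  have b_nonneg: "0 \<le> b i k" for i k
    using s by (auto simp: b_def by_index_def \<beta>_def \<nu>_def split: option.split sum.split)
  have persp: "persp (conjugate (F i k)) (- fst (Y' $ i $ k)) (b i k) \<le> ereal (snd (Y' $ i $ k))" for i k
    unfolding persp_conjugate_le_iff[OF pcc_F]
  proof (intro conjI allI impI b_nonneg)
    fix x q assume "F i k x \<le> ereal q"
    then obtain m where m: "F i k x = ereal m" "m \<le> q"
      using pcc_fun_ne_MInf[OF pcc_F, of i k x] by (cases "F i k x") auto
    \<comment> \<open>Only the point on the graph is known to lie in \<open>G i k\<close>; the rest
      of the epigraph follows by raising \<open>m\<close> to \<open>q\<close>, as
      \<open>b i k\<close> is nonnegative.\<close>
    have "(x, 1, m) \<in> K i k"
      using G_graph[OF m(1)] by (simp add: K_def mem_homogenization)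
    then have "0 \<le> fst (Y' $ i $ k) \<bullet> x + snd (Y' $ i $ k) + b i k * m"
      using \<phi>_nonneg[of "(x, 1, m)"] by (simp add: \<phi>_def)
    moreover have "b i k * m \<le> b i k * q"
      using b_nonneg m(2) by (rule mult_left_mono[rotated])
    ultimately show "(- fst (Y' $ i $ k)) \<bullet> x - b i k * q \<le> snd (Y' $ i $ k)"
      by simp
  qed
  let ?y0 = "\<chi> i. - fst (Y' $ i $ None)" and ?y1 = "\<chi> i. \<chi> j. - fst (Y' $ i $ Some (Inl j))"
    and ?y2 = "\<chi> i. \<chi> l. - fst (Y' $ i $ Some (Inr l))"
  have by_index: "by_index (?y0 $ i) (?y1 $ i) (?y2 $ i) k = - fst (Y' $ i $ k)" for i k
    by (auto simp: by_index_def split: option.split sum.split)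
  have "(a, \<beta>, ?y0, ?y1, ?y2, \<nu>) \<in> ap_w'_set g c h"
    unfolding mem_ap_w'_set_iff_family by_index
  proof (intro conjI allI)
    show "0 \<le> \<beta> $ j" "0 \<le> \<nu> $ i $ l" for i j l
      using s by (simp_all add: \<beta>_def \<nu>_def)
    show "(\<Sum>k\<in>UNIV. - fst (Y' $ i $ k)) = 0" for i
      by (simp add: sum_negf Y_fst)
    show "\<exists>s. (\<forall>k. persp (conjugate (F i k)) (- fst (Y' $ i $ k)) (by_index 1 \<beta> (\<nu> $ i) k) \<le> ereal (s k)) \<and>
        (\<Sum>k\<in>UNIV. s k) \<le> a" for i
      using persp[of i] Y_snd[of i] by (intro exI[of _ "\<lambda>k. snd (Y' $ i $ k)"]) (simp add: b_def)
  qed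
  moreover have "ap_w'_obj \<mu> (a, \<beta>, ?y0, ?y1, ?y2, \<nu>) \<le> ereal V"
    using const by (simp add: ap_w'_obj_def)
  ultimately show ?thesis
    by (rule that)
qed

end

section \<open>Core points obtained from a Slater point of (AD-B')\<close>

definition affine_ereal :: "('x::real_vector \<Rightarrow> ereal) \<Rightarrow> bool" where
  "affine_ereal f \<longleftrightarrow> (\<exists>a. affine_map a \<and> (\<forall>x. f x = ereal (a x)))"

text \<open>On an affine slice where the scalars in \<open>T\<close> are nonnegative, the infinite
  branch of \<open>regarded_linear\<close> does not occur. The slice at weight 1 shows that a
  perspective regarded as linear comes from an affine function.\<close>

lemma regarded_linear_affine_ereal:
  assumes q: "regarded_linear (T, q)" and P: "affine_map P" and T: "\<And>z t. t \<in> T \<Longrightarrow> 0 \<le> t (P z)"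
  shows "affine_ereal (\<lambda>z. q (P z))"
proof -
  obtain a b where a: "linear a" "\<And>x. q x = (if \<forall>t\<in>T. 0 \<le> t x then ereal (a x + b) else \<infinity>)"
    using q by (auto simp: regarded_linear_def)
  have "q (P z) = ereal (a (P z) + b)" for z
    using a(2)[of "P z"] T by simp
  moreover have "affine_map (\<lambda>z. a (P z) + b)"
    by (simp add: affine_map_def affine_mapD[OF P] linear_add[OF a(1)] linear_scale[OF a(1)])
      (simp add: algebra_simps)
  ultimately show ?thesis
    by (auto simp: affine_ereal_def)
qed

text \<open>A Slater point may satisfy an affine constraint with equality. For affine \<open>f\<close> it then lies in
  the intrinsic core of the graph of \<open>f\<close>, but not in that of the epigraph.\<close>

definition graph_or_epi :: "('x::real_vector \<Rightarrow> ereal) \<Rightarrow> ('x \<times> real) set" where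
  "graph_or_epi f = (if affine_ereal f then {(x, r). f x = ereal r} else epi f)"

lemma graph_or_epi_subset: "graph_or_epi f \<subseteq> epi f"
  by (auto simp: graph_or_epi_def)

lemma graph_subset_graph_or_epi: "f x = ereal m \<Longrightarrow> (x, m) \<in> graph_or_epi f"
  by (auto simp: graph_or_epi_def)

lemma convex_graph_or_epi:
  assumes "pcc_fun f"
  shows "convex (graph_or_epi f)"
proof (cases "affine_ereal f")
  case True
  then obtain a where a: "affine_map a" "\<And>x. f x = ereal (a x)"
    by (auto simp: affine_ereal_def)
  then show ?thesis
    using True by (auto simp: graph_or_epi_def convex_alt affine_mapD)
next
  case False
  then show ?thesis
    using convex_epi[OF assms] by (simp add: graph_or_epi_def)
qed

text \<open>In the affine case \<open>r\<close> drops to the value at \<open>z\<close>, which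
  respects a tight bound \<open>m\<close>, and the reflection of the graph in \<open>(z, r)\<close>
  is the graph itself. Otherwise strictness permits \<open>r = m\<close>.\<close>

lemma intrinsic_core_graph_or_epi:
  assumes f: "pcc_fun f" and z: "z \<in> intrinsic_core (effective_domain f)"
    and le: "f z \<le> ereal m" and less: "\<not> affine_ereal f \<Longrightarrow> f z < ereal m"
  obtains r where "r \<le> m" "(z, r) \<in> intrinsic_core (graph_or_epi f)"
proof (cases "affine_ereal f")
  case True
  then obtain a where a: "affine_map a" "\<And>x. f x = ereal (a x)"
    by (auto simp: affine_ereal_def)
  have "(z, a z) + 1 *\<^sub>R ((z, a z) - (y, q)) \<in> graph_or_epi f" if "(y, q) \<in> graph_or_epi f" for y q
    using that True affine_map_extrapolate[OF a(1), of z 1 y] by (simp add: graph_or_epi_def a(2))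
  then have "\<exists>e>0. (z, a z) + e *\<^sub>R ((z, a z) - p) \<in> graph_or_epi f" if "p \<in> graph_or_epi f" for p
    using that zero_less_one by (metis surj_pair)
  then have "(z, a z) \<in> intrinsic_core (graph_or_epi f)"
    using True a(2) by (simp add: intrinsic_core_def) (simp add: graph_or_epi_def)
  then show ?thesis
    using that[of "a z"] le a(2) by simp
next
  case False
  then have "(z, m) \<in> intrinsic_core (graph_or_epi f)"
    using intrinsic_core_epi[OF convex_epi[OF f] pcc_fun_ne_MInf[OF f] z less]
    by (simp add: graph_or_epi_def)
  then show ?thesis
    using that[of m] by simp
qed

lemma persp_mult_less_PInf: "0 < t \<Longrightarrow> persp f (t *\<^sub>R y) t < \<infinity> \<longleftrightarrow> f y < \<infinity>"
  by (cases "f y") (auto simp: persp_def)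

lemma persp_le_pos:
  assumes "0 < t"
  shows "persp f v t \<le> ereal r \<longleftrightarrow> f (v /\<^sub>R t) \<le> ereal (r / t)"
    and "persp f v t < ereal r \<longleftrightarrow> f (v /\<^sub>R t) < ereal (r / t)"
  using assms by (cases "f (v /\<^sub>R t)"; simp add: persp_def field_simps)+

lemma persp_concave_eq: "persp_concave g x t = - persp (\<lambda>z. - g z) x t"
proof -
  have "ereal t * u = - (ereal t * - u)" for u
    by simp
  then show ?thesis
    unfolding persp_concave_def persp_def by simp
qed

text \<open>Varying one argument of a perspective and freezing all other variables, including the
  weight \<open>t\<close>, gives an affine slice of the domain of the constraint. Core points stay
  core points in it, and division by \<open>t\<close> maps it onto the domain of
  \<open>f\<close>.\<close>

lemma intrinsic_core_persp_slice:
  assumes x: "x \<in> intrinsic_core (effective_domain q)" and P: "affine_map P" "P v = x"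
    and t: "0 < t" and dom: "\<And>u. P u \<in> effective_domain q \<longleftrightarrow> persp f u t < \<infinity>"
  shows "v /\<^sub>R t \<in> intrinsic_core (effective_domain f)"
proof -
  let ?z = "v /\<^sub>R t"
  have tz: "t *\<^sub>R ?z = v"
    using t by simp
  have dom': "P (t *\<^sub>R y) \<in> effective_domain q \<longleftrightarrow> y \<in> effective_domain f" for y
    unfolding dom persp_mult_less_PInf[OF t] by (simp add: effective_domain_def)
  have "\<exists>e>0. ?z + e *\<^sub>R (?z - y) \<in> effective_domain f" if y: "y \<in> effective_domain f" for y
  proof -
    have "P (t *\<^sub>R y) \<in> effective_domain q"
      using y dom' by simp
    then obtain e where e: "0 < e" "x + e *\<^sub>R (x - P (t *\<^sub>R y)) \<in> effective_domain q"
      using intrinsic_coreD[OF x] by blast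
    have "x + e *\<^sub>R (x - P (t *\<^sub>R y)) = P (v + e *\<^sub>R (v - t *\<^sub>R y))"
      using affine_map_extrapolate[OF P(1), of v e "t *\<^sub>R y"] P(2) by simp
    also have "v + e *\<^sub>R (v - t *\<^sub>R y) = t *\<^sub>R (?z + e *\<^sub>R (?z - y))"
      using t by (simp add: algebra_simps)
    finally show ?thesis
      using e dom' by auto
  qed
  moreover have "?z \<in> effective_domain f"
    using intrinsic_core_subset[OF x] dom'[of ?z] P(2) tz by simp
  ultimately show ?thesis
    by (simp add: intrinsic_core_def)
qed

lemma affine_map_update:
  "affine_map (\<lambda>v. (\<tau>, lam, \<omega>, \<chi> i'. if i' = i then v else \<upsilon> $ i'))"
  by (auto simp: affine_map_def vec_eq_iff algebra_simps)

lemma affine_map_embed: "affine_map (\<lambda>z. (0, \<chi> _. 1, 0, \<chi> _. z))"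
  by (auto simp: affine_map_def vec_eq_iff algebra_simps)

context uq
begin

lemma slater_ad_b'_imp_exists_ap_w'_le:
  assumes slater: "slater_point_sup ad_b'_obj (ad_b'_ineqs g c h \<mu>) ad_b'_eqs (\<tau>, lam, \<omega>, \<upsilon>)"
    and lam: "\<And>i. 0 < lam $ i"
    and V: "sup_value (ad_b_set g c h \<mu>) ad_b_obj \<le> ereal V"
  obtains p where "p \<in> ap_w'_set g c h" "ap_w'_obj \<mu> p \<le> ereal V"
proof -
  let ?x = "(\<tau>, lam, \<omega>, \<upsilon>)"
  have ri: "?x \<in> intrinsic_core (effective_domain q)" if "(T, q) \<in> ad_b'_ineqs g c h \<mu>" for T q
    using slater that rel_interior_subset_intrinsic_core
    by (fastforce simp: slater_point_sup_def slater_point_def)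
  have strict: "q ?x < 0" if "(T, q) \<in> ad_b'_ineqs g c h \<mu>" "\<not> regarded_linear (T, q)" for T q
    using slater that by (fastforce simp: slater_point_sup_def slater_point_def)
  have "?x \<in> ad_b'_set g c h \<mu>"
    using slater by (simp add: slater_point_sup_def slater_point_def ad_b'_set_def)
  note feas = this[unfolded mem_ad_b'_set_iff_family]
  define z where "z i = \<upsilon> $ i /\<^sub>R lam $ i" for i
  define P where "P i v = (\<tau>, lam, \<omega>, \<chi> i'. if i' = i then v else \<upsilon> $ i')" for i and v :: "real^'n"
  have P: "affine_map (P i)" "P i (\<upsilon> $ i) = ?x" for i
    unfolding P_def by (rule affine_map_update) (simp add: vec_eq_iff)
  have core: "z i \<in> intrinsic_core (effective_domain (F i k))" for i k
  proof -
    consider "k = None" | j where "k = Some (Inl j)" | n where "k = Some (Inr n)"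
      by (metis not_None_eq sum.exhaust)
    then show ?thesis
    proof cases
      case 1
      let ?q = "\<lambda>(\<tau>, lam, \<omega>, \<upsilon>). ereal (\<tau> $ i) - persp_concave (g i) (\<upsilon> $ i) (lam $ i)"
      have "({\<lambda>(\<tau>, lam, \<omega>, \<upsilon>). lam $ i}, ?q) \<in> ad_b'_ineqs g c h \<mu>"
        by (auto simp: ad_b'_ineqs_def)
      moreover have "ereal a - - u < \<infinity> \<longleftrightarrow> u < \<infinity>" for a u
        by (cases u) auto
      ultimately show ?thesis
        unfolding z_def 1 family_simps
        by (intro intrinsic_core_persp_slice[OF ri P lam]) (auto simp: P_def effective_domain_def persp_concave_eq)
    next
      case (2 j)
      let ?q = "\<lambda>(\<tau>, lam, \<omega>, \<upsilon>). persp (h j) (\<upsilon> $ i) (lam $ i) - ereal (\<omega> $ i $ j)"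
      have "({\<lambda>(\<tau>, lam, \<omega>, \<upsilon>). lam $ i}, ?q) \<in> ad_b'_ineqs g c h \<mu>"
        by (auto simp: ad_b'_ineqs_def)
      moreover have "u - ereal a < \<infinity> \<longleftrightarrow> u < \<infinity>" for a u
        by (cases u) auto
      ultimately show ?thesis
        unfolding z_def 2 family_simps
        by (intro intrinsic_core_persp_slice[OF ri P lam]) (auto simp: P_def effective_domain_def)
    next
      case (3 n)
      let ?q = "\<lambda>(\<tau>, lam, \<omega>, \<upsilon>). persp (c n) (\<upsilon> $ i) (lam $ i)"
      have "({\<lambda>(\<tau>, lam, \<omega>, \<upsilon>). lam $ i}, ?q) \<in> ad_b'_ineqs g c h \<mu>"
        by (auto simp: ad_b'_ineqs_def)
      then show ?thesis
        unfolding z_def 3 family_simps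
        by (intro intrinsic_core_persp_slice[OF ri P lam]) (auto simp: P_def effective_domain_def)
    qed
  qed
  \<comment> \<open>The height of \<open>- g i\<close> enters only the objective, so it is raised by
    1 to make its inequality strict even where no strictness is assumed.\<close>
  define m where "m i k = (case k of None \<Rightarrow> - (\<tau> $ i) / lam $ i + 1 | Some (Inl j) \<Rightarrow> \<omega> $ i $ j / lam $ i | Some (Inr n) \<Rightarrow> 0)"
    for i and k :: "('j + 'l) option"
  have F_le: "F i k (z i) \<le> ereal (by_index (- (\<tau> $ i)) (\<omega> $ i) 0 k / lam $ i)" for i k
    using feas persp_le_pos(1)[OF lam] unfolding z_def by blast
  have F_le_m: "F i k (z i) \<le> ereal (m i k)" for i k
    by (rule order_trans[OF F_le]) (auto simp: m_def by_index_def split: option.split sum.split)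
  have h_less: "h j (z i) < ereal (\<omega> $ i $ j / lam $ i)" if "\<not> affine_ereal (h j)" for i j
  proof -
    let ?q = "\<lambda>(\<tau>, lam, \<omega>, \<upsilon>). persp (h j) (\<upsilon> $ i) (lam $ i) - ereal (\<omega> $ i $ j)"
    let ?T = "{\<lambda>(\<tau>, lam, \<omega>, \<upsilon>). lam $ i}"
    \<comment> \<open>Restricted to weight 1 and \<open>\<omega> = 0\<close>, the constraint
      function is \<open>h j\<close>, which is not affine.\<close>
    have "\<not> regarded_linear (?T, ?q)"
      using regarded_linear_affine_ereal[OF _ affine_map_embed, of ?T ?q] that by (auto simp: persp_1)
    then have "?q ?x < 0"
      by (intro strict) (auto simp: ad_b'_ineqs_def)
    then have "persp (h j) (\<upsilon> $ i) (lam $ i) < ereal (\<omega> $ i $ j)"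
      by (cases "persp (h j) (\<upsilon> $ i) (lam $ i)") auto
    then show ?thesis
      unfolding persp_le_pos(2)[OF lam] z_def .
  qed
  have c_less: "c n (z i) < ereal 0" if "\<not> affine_ereal (c n)" for i n
  proof -
    let ?q = "\<lambda>(\<tau>, lam, \<omega>, \<upsilon>). persp (c n) (\<upsilon> $ i) (lam $ i)"
    let ?T = "{\<lambda>(\<tau>, lam, \<omega>, \<upsilon>). lam $ i}"
    have "\<not> regarded_linear (?T, ?q)"
      using regarded_linear_affine_ereal[OF _ affine_map_embed, of ?T ?q] that by (auto simp: persp_1)
    then have "?q ?x < 0"
      by (intro strict) (auto simp: ad_b'_ineqs_def)
    then have "persp (c n) (\<upsilon> $ i) (lam $ i) < ereal 0"
      by (simp add: zero_ereal_def)
    then show ?thesis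
      unfolding persp_le_pos(2)[OF lam] z_def by simp
  qed
  have F_less_m: "F i k (z i) < ereal (m i k)" if "\<not> affine_ereal (F i k)" for i k
  proof (cases k)
    case None
    have "F i k (z i) \<le> ereal (- (\<tau> $ i) / lam $ i)"
      using F_le[of i k] None by simp
    also have "\<dots> < ereal (m i k)"
      by (simp add: None m_def)
    finally show ?thesis .
  next
    case (Some k')
    then show ?thesis
      using that h_less c_less by (cases k') (auto simp: m_def)
  qed
  have "\<exists>r. r \<le> m i k \<and> (z i, r) \<in> intrinsic_core (graph_or_epi (F i k))" for i k
    using intrinsic_core_graph_or_epi[OF pcc_F core F_le_m F_less_m] by metis
  then obtain r where r: "\<And>i k. r i k \<le> m i k" "\<And>i k. (z i, r i k) \<in> intrinsic_core (graph_or_epi (F i k))"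
    by metis
  show ?thesis
  proof (rule exists_ap_w'_le[where G = "\<lambda>i k. graph_or_epi (F i k)" and lam = "\<lambda>i. lam $ i" and V = V])
    show "(\<Sum>i\<in>UNIV. lam $ i * r i (Some (Inl j))) \<le> \<mu> $ j" for j
    proof -
      have "lam $ i * r i (Some (Inl j)) \<le> \<omega> $ i $ j" for i
        using r(1)[of i "Some (Inl j)"] lam[of i] by (simp add: m_def field_simps)
      then have "(\<Sum>i\<in>UNIV. lam $ i * r i (Some (Inl j))) \<le> (\<Sum>i\<in>UNIV. \<omega> $ i $ j)"
        by (rule sum_mono)
      also have "\<dots> \<le> \<mu> $ j"
        using feas by blast
      finally show ?thesis .
    qed
    show "r i (Some (Inr n)) \<le> 0" for i n
      using r(1)[of i "Some (Inr n)"] by (simp add: m_def)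
  qed (use r(2) lam feas V that in \<open>auto intro: convex_graph_or_epi[OF pcc_F] graph_subset_graph_or_epi
      dest: subsetD[OF graph_or_epi_subset]\<close>)
qed

lemma solves_ap_w'_imp_solves_d_uq:
  assumes eq: "all_values_equal g c h \<mu>"
    and sol: "solves_inf (ap_w'_set g c h) (ap_w'_obj \<mu>) (\<alpha>, \<beta>, y0, y1, y2, \<nu>)"
  shows "solves_inf (d_uq_set g c h) (ab_obj \<mu>) (\<alpha>, \<beta>)"
proof -
  have val: "inf_value (ap_w'_set g c h) (ap_w'_obj \<mu>) = inf_value (d_uq_set g c h) (ab_obj \<mu>)"
    using eq by (simp add: all_values_equal_def)
  have obj: "ap_w'_obj \<mu> q \<noteq> \<infinity>" for q
    by (auto simp: ap_w'_obj_def split: prod.split)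
  show ?thesis
  proof (cases "ap_w'_set g c h = {}")
    \<comment> \<open>Every point solves an infeasible (AP-W'), so (D-UQ) has to be infeasible as
      well; this follows from the common value \<open>\<infinity>\<close>.\<close>
    case True
    then have "inf_value (d_uq_set g c h) (ab_obj \<mu>) = \<infinity>"
      unfolding val[symmetric] by (simp add: inf_value_def top_ereal_def)
    then have "ab_obj \<mu> q = \<infinity>" if "q \<in> d_uq_set g c h" for q
      using INF_lower[OF that, of "ab_obj \<mu>"] by (simp add: inf_value_def)
    then show ?thesis
      by (auto simp: solves_inf_def)
  next
    case False
    then have "\<exists>q\<in>ap_w'_set g c h. ap_w'_obj \<mu> q \<noteq> \<infinity>"
      using obj by blast
    then have "(\<alpha>, \<beta>, y0, y1, y2, \<nu>) \<in> ap_w'_set g c h"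
      and "ap_w'_obj \<mu> (\<alpha>, \<beta>, y0, y1, y2, \<nu>) = inf_value (ap_w'_set g c h) (ap_w'_obj \<mu>)"
      using sol unfolding solves_inf_def by blast+
    then show ?thesis
      using ap_w'_subset_ap_w unfolding val d_uq_set_eq_ap_w_set
      by (intro solves_inf_I) (auto simp: ap_w'_obj_def ab_obj_def)
  qed
qed

lemma slater_ad_b'_imp_values_equal:
  assumes slater: "slater_point_sup ad_b'_obj (ad_b'_ineqs g c h \<mu>) ad_b'_eqs (\<tau>, lam, \<omega>, \<upsilon>)"
    and lam: "\<And>i. 0 < lam $ i"
  shows "all_values_equal g c h \<mu>" "solvable_inf (ap_w'_set g c h) (ap_w'_obj \<mu>)"
proof -
  let ?P = "inf_value (ap_w'_set g c h) (ap_w'_obj \<mu>)" and ?D = "sup_value (ad_b_set g c h \<mu>) ad_b_obj"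
  have DP: "?D \<le> ?P"
    using ad_b_le_ad_b' ad_b'_le_ap_w' by (rule order_trans)
  have "all_values_equal g c h \<mu> \<and> solvable_inf (ap_w'_set g c h) (ap_w'_obj \<mu>)"
  proof (cases ?D)
    \<comment> \<open>Then (AP-W') is infeasible and solvable by convention.\<close>
    case PInf
    then have "?P = \<infinity>"
      using DP by simp
    then have "ap_w'_obj \<mu> p = \<infinity>" if "p \<in> ap_w'_set g c h" for p
      using INF_lower[OF that, of "ap_w'_obj \<mu>"] by (simp add: inf_value_def)
    then show ?thesis
      using PInf by (auto simp: solvable_inf_def solves_inf_def intro: all_values_equalI)
  next
    case (real V)
    then obtain p where p: "p \<in> ap_w'_set g c h" "ap_w'_obj \<mu> p \<le> ?D"
      using slater_ad_b'_imp_exists_ap_w'_le[OF slater lam] by (metis order_refl)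
    have "?P \<le> ap_w'_obj \<mu> p"
      using p(1) unfolding inf_value_def by (rule INF_lower)
    moreover have "ap_w'_obj \<mu> p \<noteq> \<infinity>"
      using p(2) real by auto
    ultimately show ?thesis
      unfolding solvable_inf_def using p DP
      by (intro conjI all_values_equalI exI[of _ p] solves_inf_I) auto
  next
    \<comment> \<open>Any real \<open>V\<close> is now admissible. One less than the objective at
      the Slater point contradicts weak duality with (AD-B').\<close>
    case MInf
    have feas: "(\<tau>, lam, \<omega>, \<upsilon>) \<in> ad_b'_set g c h \<mu>"
      using slater by (simp add: slater_point_sup_def slater_point_def ad_b'_set_def)
    have "?D \<le> ereal ((\<Sum>i\<in>UNIV. \<tau> $ i) - 1)"
      using MInf by simp
    then obtain p where p: "p \<in> ap_w'_set g c h" "ap_w'_obj \<mu> p \<le> ereal ((\<Sum>i\<in>UNIV. \<tau> $ i) - 1)"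
      using slater_ad_b'_imp_exists_ap_w'_le[OF slater lam] by metis
    have "ad_b'_obj (\<tau>, lam, \<omega>, \<upsilon>) \<le> sup_value (ad_b'_set g c h \<mu>) ad_b'_obj"
      using feas unfolding sup_value_def by (rule SUP_upper)
    also have "\<dots> \<le> ?P"
      by (rule ad_b'_le_ap_w')
    also have "\<dots> \<le> ap_w'_obj \<mu> p"
      using p(1) unfolding inf_value_def by (rule INF_lower)
    finally show ?thesis
      using p(2) by (auto simp: ad_b'_obj_def dest: order_trans)
  qed
  then show "all_values_equal g c h \<mu>" "solvable_inf (ap_w'_set g c h) (ap_w'_obj \<mu>)"
    by auto
qed

end

section \<open>Strong duality with a Slater point of (AP-W')\<close>

text \<open>If every \<open>c l\<close> has \<open>v\<close> as a recession direction,
  \<open>supp_set c\<close> contains the whole ray from \<open>z\<close> along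
  \<open>v\<close>.\<close>

lemma recession_cone_bounded:
  fixes c :: "'l \<Rightarrow> 'a::euclidean_space \<Rightarrow> ereal"
  assumes pcc: "\<And>l. pcc_fun (c l)" and bounded: "bounded (supp_set c)" and z: "z \<in> supp_set c"
    and v: "\<And>l. persp (c l) v 0 \<le> 0"
  shows "v = 0"
proof (rule ccontr)
  assume "v \<noteq> 0"
  obtain M where M: "\<And>x. x \<in> supp_set c \<Longrightarrow> norm x \<le> M"
    using bounded by (auto simp: bounded_iff)
  \<comment> \<open>A displacement of length \<open>M + norm z + 1\<close> leaves the ball of radius
    \<open>M\<close>.\<close>
  define k where "k = (M + norm z + 1) / norm v"
  have "0 \<le> M"
    using M[OF z] norm_ge_zero order_trans by blast
  then have k: "0 \<le> k" "norm (k *\<^sub>R v) = M + norm z + 1"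
    using \<open>v \<noteq> 0\<close> by (simp_all add: k_def)
  have "c l (z + k *\<^sub>R v) \<le> ereal (0 + k * 0)" for l
    using z v[of l] k(1) by (intro recession_direction[OF pcc]) (auto simp: supp_set_def simp flip: zero_ereal_def)
  then have "norm (z + k *\<^sub>R v) \<le> M"
    by (intro M) (simp add: supp_set_def zero_ereal_def)
  moreover have "norm (k *\<^sub>R v) \<le> norm (z + k *\<^sub>R v) + norm z"
    using norm_triangle_ineq4[of "z + k *\<^sub>R v" z] by simp
  ultimately show False
    using k(2) by simp
qed

context uq
begin

text \<open>Dually, the multipliers of the equations between the slopes and between the weights yield the
  points \<open>\<upsilon> i\<close> and the bounds \<open>\<tau>\<close>, \<open>\<omega>\<close>; those of the inequalities yield the weights \<open>lam\<close>.\<close>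

lemma exists_ad_b'_ge:
  assumes core: "\<And>i k. y i k /\<^sub>R b i k \<in> intrinsic_core (effective_domain (conjugate (F i k)))"
    and y: "\<And>i. (\<Sum>k\<in>UNIV. y i k) = 0"
    and b: "\<And>i k. 0 < b i k" "\<And>i. b i None = 1" "\<And>i j. b i (Some (Inl j)) = \<beta>0 $ j"
    and V: "ereal V \<le> inf_value (ap_w'_set g c h) (ap_w'_obj \<mu>)"
  obtains x where "x \<in> ad_b'_set g c h \<mu>" "ereal V \<le> ad_b'_obj x"
proof -
  define K where "K i k = homogenization (epi (conjugate (F i k)))" for i k
  define C where "C = {w :: ((real^'n) \<times> real \<times> real)^(('j + 'l) option)^'i. \<forall>i. w $ i \<in> {v. \<forall>k. v $ k \<in> K i k}}
    \<times> (UNIV :: (real \<times> (real^'j)) set)"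
  \<comment> \<open>The equations fix the weight of \<open>- g i\<close> to 1 and tie the weights of
    \<open>h j\<close> for all \<open>i\<close> to the same \<open>\<beta> $ j\<close>. The weights
    of \<open>c l\<close>, that is \<open>\<nu>\<close>, are coupled to nothing.\<close>
  define A where "A = (\<lambda>(w :: ((real^'n) \<times> real \<times> real)^(('j + 'l) option)^'i, \<alpha> :: real, \<beta> :: real^'j).
    (\<chi> i. \<Sum>k\<in>UNIV. fst (w $ i $ k),
     \<chi> i. (fst (snd (w $ i $ None)) - 1, \<chi> j. fst (snd (w $ i $ Some (Inl j))) - \<beta> $ j)))"
  define B where "B = (\<lambda>(w :: ((real^'n) \<times> real \<times> real)^(('j + 'l) option)^'i, \<alpha> :: real, \<beta> :: real^'j).
    \<chi> i. (\<Sum>k\<in>UNIV. snd (snd (w $ i $ k))) - \<alpha>)"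
  define l where "l = (\<lambda>(w :: ((real^'n) \<times> real \<times> real)^(('j + 'l) option)^'i, \<alpha> :: real, \<beta> :: real^'j).
    \<alpha> + \<mu> \<bullet> \<beta> - V)"
  have conv: "convex (epi (conjugate (F i k)))" for i k
    by (rule convex_epi_conjugate[OF pcc_F])
  have "\<exists>r. conjugate (F i k) (y i k /\<^sub>R b i k) < ereal r" for i k
  proof -
    have "conjugate (F i k) (y i k /\<^sub>R b i k) < \<infinity>"
      using intrinsic_core_subset[OF core] by (simp add: effective_domain_def)
    then show ?thesis
      by (meson less_PInf_Ex_of_nat ereal_dense2)
  qed
  then obtain r where r: "\<And>i k. conjugate (F i k) (y i k /\<^sub>R b i k) < ereal (r i k)"
    by metis
  have core_epi: "(y i k /\<^sub>R b i k, r i k) \<in> intrinsic_core (epi (conjugate (F i k)))" for i k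
    by (rule intrinsic_core_epi[OF conv conjugate_ne_MInf[OF pcc_F] core r])
  define s0 where "s0 i k = b i k * r i k" for i k
  have core_K: "(y i k, b i k, s0 i k) \<in> intrinsic_core (K i k)" for i k
    using intrinsic_core_homogenization[OF conv core_epi b(1), of i k i k] b(1)[of i k]
    by (simp add: K_def s0_def)
  \<comment> \<open>One number above all the sums over \<open>k\<close>, whatever their
    signs.\<close>
  define \<alpha>0 where "\<alpha>0 = (\<Sum>i\<in>UNIV. \<bar>\<Sum>k\<in>UNIV. s0 i k\<bar>)"
  have \<alpha>0: "(\<Sum>k\<in>UNIV. s0 i k) \<le> \<alpha>0" for i
  proof -
    have "\<bar>\<Sum>k\<in>UNIV. s0 i k\<bar> \<le> \<alpha>0"
      unfolding \<alpha>0_def by (rule member_le_sum) auto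
    then show ?thesis by linarith
  qed
  define x where "x = (\<chi> i. \<chi> k. (y i k, b i k, s0 i k), \<alpha>0, \<beta>0)"
  have K_conv: "convex (K i k)" for i k
    unfolding K_def by (rule convex_homogenization[OF conv])
  have C_conv: "convex C"
    unfolding C_def by (intro convex_Times convex_vec K_conv convex_UNIV)
  have x_core: "x \<in> intrinsic_core C"
    unfolding x_def C_def
    by (intro intrinsic_core_Times_UNIV intrinsic_core_vec convex_vec K_conv) (simp add: core_K)
  have Ax: "A x = 0"
    using y b by (simp add: A_def x_def vec_eq_iff zero_prod_def)
  have Bx: "B x $ m \<le> 0" for m
    using \<alpha>0 by (simp add: B_def x_def)
  have aff_A: "affine_map A"
    by (auto simp: affine_map_def A_def vec_eq_iff sum.distrib sum_subtractf sum_distrib_left[symmetric]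
        scaleR_sum_right[symmetric] algebra_simps)
  have aff_B: "affine_map B"
    by (auto simp: affine_map_def B_def vec_eq_iff sum.distrib sum_subtractf sum_distrib_left[symmetric] algebra_simps)
  have aff_l: "affine_map l"
    by (auto simp: affine_map_def l_def inner_add_right algebra_simps)
  have nonneg: "0 \<le> l q" if q: "q \<in> C" "A q = 0" "\<And>m. B q $ m \<le> 0" for q
  proof -
    obtain w \<alpha> \<beta> where q_eq: "q = (w, \<alpha>, \<beta>)" by (metis prod_cases3)
    define yy bb ss where "yy i k = fst (w $ i $ k)" and "bb i k = fst (snd (w $ i $ k))"
      and "ss i k = snd (snd (w $ i $ k))" for i k
    have "w $ i $ k \<in> K i k" for i k
      using q(1) by (simp add: q_eq C_def)
    then have "(yy i k, bb i k, ss i k) \<in> K i k" for i k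
      by (simp add: yy_def bb_def ss_def)
    then have bb: "0 < bb i k" and epi: "conjugate (F i k) (yy i k /\<^sub>R bb i k) \<le> ereal (ss i k / bb i k)" for i k
      by (simp_all add: K_def mem_homogenization)
    have bb_eq: "bb i None = 1" "bb i (Some (Inl j)) = \<beta> $ j" and yy: "(\<Sum>k\<in>UNIV. yy i k) = 0" for i j
      using q(2) by (auto simp: q_eq A_def vec_eq_iff zero_prod_def prod_eq_iff bb_def yy_def)
    have ss: "(\<Sum>k\<in>UNIV. ss i k) \<le> \<alpha>" for i
      using q(3)[of i] by (simp add: q_eq B_def ss_def)
    let ?y0 = "\<chi> i. yy i None" and ?y1 = "\<chi> i. \<chi> j. yy i (Some (Inl j))"
      and ?y2 = "\<chi> i. \<chi> n. yy i (Some (Inr n))" and ?\<nu> = "\<chi> i. \<chi> n. bb i (Some (Inr n))"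
    have y_index: "by_index (?y0 $ i) (?y1 $ i) (?y2 $ i) k = yy i k"
      and b_index: "by_index 1 \<beta> (?\<nu> $ i) k = bb i k" for i k
      using bb_eq by (auto simp: by_index_def split: option.split sum.split)
    have "(\<alpha>, \<beta>, ?y0, ?y1, ?y2, ?\<nu>) \<in> ap_w'_set g c h"
      unfolding mem_ap_w'_set_iff_family y_index b_index
    proof (intro conjI allI)
      \<comment> \<open>\<open>\<beta> $ j\<close> is the weight of \<open>h j\<close> for every
        \<open>i\<close>, so an arbitrary index serves.\<close>
      show "0 \<le> \<beta> $ j" for j
        using bb[of undefined "Some (Inl j)"] bb_eq by simp
      show "0 \<le> ?\<nu> $ i $ n" for i n
        using bb[of i "Some (Inr n)"] by simp
      show "\<exists>s. (\<forall>k. persp (conjugate (F i k)) (yy i k) (bb i k) \<le> ereal (s k)) \<and> (\<Sum>k\<in>UNIV. s k) \<le> \<alpha>" for i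
        using epi ss by (intro exI[of _ "ss i"]) (simp add: persp_le_pos(1)[OF bb])
    qed (use yy in auto)
    then have "inf_value (ap_w'_set g c h) (ap_w'_obj \<mu>) \<le> ap_w'_obj \<mu> (\<alpha>, \<beta>, ?y0, ?y1, ?y2, ?\<nu>)"
      unfolding inf_value_def by (rule INF_lower)
    with V have "ereal V \<le> ap_w'_obj \<mu> (\<alpha>, \<beta>, ?y0, ?y1, ?y2, ?\<nu>)"
      by (rule order_trans)
    then show ?thesis
      by (simp add: ap_w'_obj_def q_eq l_def)
  qed
  obtain Y s where s: "\<And>m. 0 \<le> s $ m"
    and L: "\<And>q. q \<in> C \<Longrightarrow> 0 \<le> l q + Y \<bullet> A q + s \<bullet> B q"
    using lagrange_multipliers[OF C_conv x_core Ax Bx aff_A aff_B aff_l nonneg] by metis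
  obtain Y1 Y2 where Y: "Y = (Y1, Y2)" by fastforce
  \<comment> \<open>The multipliers of the weight equations become the bounds of the perspectives.
    As the weights of \<open>c l\<close> are uncoupled, the bound there is 0, which is the support
    constraint of (AD-B').\<close>
  define om where "om i k = by_index (fst (Y2 $ i)) (snd (Y2 $ i)) 0 k" for i and k :: "('j + 'l) option"
  define \<phi> where "\<phi> i k p = Y1 $ i \<bullet> fst p + om i k * fst (snd p) + s $ i * snd (snd p)"
    for i k and p :: "(real^'n) \<times> real \<times> real"
  \<comment> \<open>The part that is linear in \<open>\<alpha>\<close> and \<open>\<beta>\<close>;
    its vanishing gives weights with sum 1 and \<open>\<omega>\<close> with sum
    \<open>\<mu>\<close>.\<close>
  define \<psi> where "\<psi> f = fst f * (1 - (\<Sum>i\<in>UNIV. s $ i)) + (\<mu> - (\<Sum>i\<in>UNIV. snd (Y2 $ i))) \<bullet> snd f"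
    for f :: "real \<times> (real^'j)"
  have L_eq: "l (w, f) + Y \<bullet> A (w, f) + s \<bullet> B (w, f)
      = (- V - (\<Sum>i\<in>UNIV. fst (Y2 $ i))) + (\<Sum>i\<in>UNIV. \<Sum>k\<in>UNIV. \<phi> i k (w $ i $ k)) + \<psi> f" for w f
  proof -
    obtain \<alpha> \<beta> where f: "f = (\<alpha>, \<beta>)" by fastforce
    define bb where "bb i k = fst (snd (w $ i $ k))" for i k
    have om_sum: "(\<Sum>k\<in>UNIV. om i k * bb i k) = fst (Y2 $ i) * bb i None + (\<Sum>j\<in>UNIV. snd (Y2 $ i) $ j * bb i (Some (Inl j)))" for i
      by (simp add: sum_option_sum om_def)
    have inner1: "Y1 \<bullet> M = (\<Sum>i\<in>UNIV. Y1 $ i \<bullet> M $ i)" for M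
      by (subst inner_vec_def) (rule refl)
    have inner2: "Y2 \<bullet> M = (\<Sum>i\<in>UNIV. Y2 $ i \<bullet> M $ i)" for M
      by (subst inner_vec_def) (rule refl)
    have "Y2 $ i \<bullet> (bb i None - 1, \<chi> j. bb i (Some (Inl j)) - \<beta> $ j)
        = (\<Sum>k\<in>UNIV. om i k * bb i k) - fst (Y2 $ i) - snd (Y2 $ i) \<bullet> \<beta>" for i
      unfolding om_sum
      by (simp add: inner_prod_def inner_vec_def right_diff_distrib sum_subtractf)
    then have "Y \<bullet> A (w, f) = (\<Sum>i\<in>UNIV. Y1 $ i \<bullet> (\<Sum>k\<in>UNIV. fst (w $ i $ k)))
        + (\<Sum>i\<in>UNIV. (\<Sum>k\<in>UNIV. om i k * bb i k) - fst (Y2 $ i) - snd (Y2 $ i) \<bullet> \<beta>)"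
      by (simp add: Y A_def f inner1 inner2 flip: bb_def)
    moreover have "s \<bullet> B (w, f) = (\<Sum>i\<in>UNIV. \<Sum>k\<in>UNIV. s $ i * snd (snd (w $ i $ k))) - \<alpha> * (\<Sum>i\<in>UNIV. s $ i)"
      by (simp add: inner_vec_def B_def f right_diff_distrib sum_subtractf sum_distrib_left mult.commute)
    ultimately show ?thesis
      by (simp add: l_def f \<phi>_def \<psi>_def sum.distrib sum_subtractf inner_sum_right inner_sum_left
          inner_diff_left right_diff_distrib flip: bb_def)
  qed
  have L': "0 \<le> (- V - (\<Sum>i\<in>UNIV. fst (Y2 $ i))) + (\<Sum>i\<in>UNIV. \<Sum>k\<in>UNIV. \<phi> i k (w i k)) + \<psi> f"
    if "\<And>i k. w i k \<in> K i k" for w f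
    using L[of "(\<chi> i. \<chi> k. w i k, f)"] that unfolding L_eq by (simp add: C_def)
  have \<psi>_scale: "\<psi> (t *\<^sub>R f) = t * \<psi> f" for t f
    by (simp add: \<psi>_def algebra_simps)
  have \<psi>_0: "\<psi> f = 0" for f
    using linear_bounded_below_eq_0[OF \<psi>_scale L'[OF intrinsic_core_subset[OF core_K]]] .
  have s_sum: "(\<Sum>i\<in>UNIV. s $ i) = 1"
    using \<psi>_0[of "(1, 0)"] by (simp add: \<psi>_def)
  have \<omega>_sum: "(\<Sum>i\<in>UNIV. snd (Y2 $ i)) = \<mu>"
    using \<psi>_0[of "(0, \<mu> - (\<Sum>i\<in>UNIV. snd (Y2 $ i)))"] by (simp add: \<psi>_def)
  have \<phi>_scale: "\<phi> i k (t *\<^sub>R p) = t * \<phi> i k p" for i k t p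
    by (simp add: \<phi>_def algebra_simps)
  have K_scale: "0 < t \<Longrightarrow> p \<in> K i k \<Longrightarrow> t *\<^sub>R p \<in> K i k" for i k t p
    by (simp add: K_def homogenization_scale)
  have K_ne: "K i k \<noteq> {}" for i k
    using intrinsic_core_subset[OF core_K] by blast
  have L'': "0 \<le> (- V - (\<Sum>i\<in>UNIV. fst (Y2 $ i))) + (\<Sum>i\<in>UNIV. \<Sum>k\<in>UNIV. \<phi> i k (w i k))"
    if "\<And>i k. w i k \<in> K i k" for w
    using L'[OF that, of 0] by (simp add: \<psi>_0)
  have const: "V \<le> - (\<Sum>i\<in>UNIV. fst (Y2 $ i))"
    using nonneg_on_product_of_cones(1)[of K \<phi>, OF K_ne K_scale \<phi>_scale L''] by simp
  have \<phi>_nonneg: "0 \<le> \<phi> i k p" if "p \<in> K i k" for i k p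
    using nonneg_on_product_of_cones(2)[of K \<phi>, OF K_ne K_scale \<phi>_scale L'' that] .
  have persp: "persp (F i k) (- Y1 $ i) (s $ i) \<le> ereal (om i k)" for i k
    unfolding persp_le_iff[OF pcc_F]
  proof (intro conjI allI impI s)
    fix w q assume "conjugate (F i k) w \<le> ereal q"
    then have "(w, 1, q) \<in> K i k"
      by (simp add: K_def mem_homogenization)
    then have "0 \<le> \<phi> i k (w, 1, q)"
      by (rule \<phi>_nonneg)
    then show "w \<bullet> (- Y1 $ i) - s $ i * q \<le> om i k"
      by (simp add: \<phi>_def inner_commute)
  qed
  let ?x = "(\<chi> i. - fst (Y2 $ i), s, \<chi> i. snd (Y2 $ i), - Y1)"
  have "?x \<in> ad_b'_set g c h \<mu>"
    using persp s s_sum \<omega>_sum by (auto simp: mem_ad_b'_set_iff_family om_def vec_eq_iff)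
  moreover have "ereal V \<le> ad_b'_obj ?x"
    using const by (simp add: ad_b'_obj_def sum_negf)
  ultimately show ?thesis
    by (rule that)
qed

lemma mem_effective_domain_ap_w'_constraint:
  "(\<alpha>, \<beta>, y0, y1, y2, \<nu>) \<in> effective_domain (\<lambda>(\<alpha>, \<beta>, y0, y1, y2, \<nu>).
         conjugate (\<lambda>z. - g i z) (y0 $ i)
         + (\<Sum>j\<in>UNIV. persp (conjugate (h j)) (y1 $ i $ j) (\<beta> $ j))
         + (\<Sum>l\<in>UNIV. persp (conjugate (c l)) (y2 $ i $ l) (\<nu> $ i $ l)) - ereal \<alpha>)
   \<longleftrightarrow> (\<forall>k. persp (conjugate (F i k)) (by_index (y0 $ i) (y1 $ i) (y2 $ i) k) (by_index 1 \<beta> (\<nu> $ i) k) < \<infinity>)"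
proof -
  have *: "u - ereal a < \<infinity> \<longleftrightarrow> u \<noteq> \<infinity>" for u a
    by (cases u) auto
  show ?thesis
    unfolding effective_domain_def mem_Collect_eq prod.case ap_w'_constraint_eq_sum * by (simp add: sum_Pinfty)
qed

lemma slater_ap_w'_imp_exists_ad_b'_ge:
  assumes slater: "slater_point_inf (ap_w'_obj \<mu>) (ap_w'_ineqs g c h) ap_w'_eqs (\<alpha>, \<beta>, y0, y1, y2, \<nu>)"
    and V: "ereal V \<le> inf_value (ap_w'_set g c h) (ap_w'_obj \<mu>)"
  obtains x where "x \<in> ad_b'_set g c h \<mu>" "ereal V \<le> ad_b'_obj x"
proof -
  let ?x = "(\<alpha>, \<beta>, y0, y1, y2, \<nu>)"
  let ?q = "\<lambda>i (\<alpha>, \<beta>, y0, y1, y2, \<nu>).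
         conjugate (\<lambda>z. - g i z) (y0 $ i)
         + (\<Sum>j\<in>UNIV. persp (conjugate (h j)) (y1 $ i $ j) (\<beta> $ j))
         + (\<Sum>l\<in>UNIV. persp (conjugate (c l)) (y2 $ i $ l) (\<nu> $ i $ l)) - ereal \<alpha>"
  define D where "D i = effective_domain (?q i)" for i
  note D_iff = mem_effective_domain_ap_w'_constraint[folded D_def]
  have "(range (\<lambda>j (\<alpha>, \<beta>, y0, y1, y2, \<nu>). \<beta> $ j) \<union> range (\<lambda>l (\<alpha>, \<beta>, y0, y1, y2, \<nu>). \<nu> $ i $ l), ?q i)
      \<in> ap_w'_ineqs g c h" for i
    unfolding ap_w'_ineqs_def by (rule UnI1, rule UnI1) (rule range_eqI, rule refl)
  then have ri: "?x \<in> intrinsic_core (D i)" for i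
    using slater rel_interior_subset_intrinsic_core
    unfolding slater_point_inf_def slater_point_def D_def by blast
  have "?x \<in> ap_w'_set g c h"
    using slater by (simp add: slater_point_inf_def slater_point_def ap_w'_set_def)
  note feas = this[unfolded mem_ap_w'_set_iff_family]
  define y where "y i k = by_index (y0 $ i) (y1 $ i) (y2 $ i) k" for i k
  define b where "b i k = by_index 1 \<beta> (\<nu> $ i) k" for i k
  have fin: "persp (conjugate (F i k)) (y i k) (b i k) < \<infinity>" for i k
    using intrinsic_core_subset[OF ri, of i] by (simp only: D_iff y_def b_def)
  have b_nonneg: "0 \<le> b i k" for i k
    using feas by (auto simp: b_def by_index_def split: option.split sum.split)
  have "\<exists>u. conjugate (F i k) u < \<infinity>" for i k
    using conjugate_domain_nonempty[OF pcc_F, of i k] by (metis ereal_less_PInfty PInfty_neq_ereal(1))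
  then obtain u where u: "\<And>i k. conjugate (F i k) (u i k) < \<infinity>"
    by metis
  \<comment> \<open>The domain also contains a point \<open>?x'\<close> with every weight of
    \<open>\<beta>\<close> and \<open>\<nu>\<close> raised by 1. A step of size \<open>e\<close>
    from the Slater point away from it lowers these weights by \<open>e\<close> and stays in the
    domain, so they are at least \<open>e\<close>.\<close>
  have b_pos: "0 < b i k" for i k
  proof -
    let ?x' = "(\<alpha>, \<chi> j. \<beta> $ j + 1, y0, \<chi> _. \<chi> j. (\<beta> $ j + 1) *\<^sub>R u i (Some (Inl j)),
      \<chi> i'. \<chi> n. (\<nu> $ i' $ n + 1) *\<^sub>R u i (Some (Inr n)), \<chi> i'. \<chi> n. \<nu> $ i' $ n + 1)"
    have "?x' \<in> D i"
      unfolding D_iff all_option_sum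
    proof (intro conjI allI)
      show "persp (conjugate (F i None)) (by_index (y0 $ i) ((\<chi> _. \<chi> j. (\<beta> $ j + 1) *\<^sub>R u i (Some (Inl j))) $ i)
          ((\<chi> i'. \<chi> n. (\<nu> $ i' $ n + 1) *\<^sub>R u i (Some (Inr n))) $ i) None)
          (by_index 1 (\<chi> j. \<beta> $ j + 1) ((\<chi> i'. \<chi> n. \<nu> $ i' $ n + 1) $ i) None) < \<infinity>"
        using fin[of i None] by (simp add: y_def b_def)
    next
      fix j
      have "0 < \<beta> $ j + 1"
        using feas by (simp add: add_nonneg_pos)
      then show "persp (conjugate (F i (Some (Inl j)))) (by_index (y0 $ i) ((\<chi> _. \<chi> j. (\<beta> $ j + 1) *\<^sub>R u i (Some (Inl j))) $ i)
          ((\<chi> i'. \<chi> n. (\<nu> $ i' $ n + 1) *\<^sub>R u i (Some (Inr n))) $ i) (Some (Inl j)))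
          (by_index 1 (\<chi> j. \<beta> $ j + 1) ((\<chi> i'. \<chi> n. \<nu> $ i' $ n + 1) $ i) (Some (Inl j))) < \<infinity>"
        using persp_mult_less_PInf[of "\<beta> $ j + 1" "conjugate (h j)" "u i (Some (Inl j))"]
          u[of i "Some (Inl j)"] by simp
    next
      fix n
      have "0 < \<nu> $ i $ n + 1"
        using feas by (simp add: add_nonneg_pos)
      then show "persp (conjugate (F i (Some (Inr n)))) (by_index (y0 $ i) ((\<chi> _. \<chi> j. (\<beta> $ j + 1) *\<^sub>R u i (Some (Inl j))) $ i)
          ((\<chi> i'. \<chi> n. (\<nu> $ i' $ n + 1) *\<^sub>R u i (Some (Inr n))) $ i) (Some (Inr n)))
          (by_index 1 (\<chi> j. \<beta> $ j + 1) ((\<chi> i'. \<chi> n. \<nu> $ i' $ n + 1) $ i) (Some (Inr n))) < \<infinity>"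
        using persp_mult_less_PInf[of "\<nu> $ i $ n + 1" "conjugate (c n)" "u i (Some (Inr n))"]
          u[of i "Some (Inr n)"] by simp
    qed
    then obtain e where e: "0 < e" "?x + e *\<^sub>R (?x - ?x') \<in> D i"
      using intrinsic_coreD[OF ri] by blast
    have "0 \<le> t" if "persp f v t < \<infinity>" for f :: "real^'n \<Rightarrow> ereal" and v t
      using that by (cases "t < 0") (auto simp: persp_def)
    then have "0 \<le> by_index 1 (\<beta> + e *\<^sub>R (\<beta> - (\<chi> j. \<beta> $ j + 1)))
        ((\<nu> + e *\<^sub>R (\<nu> - (\<chi> i'. \<chi> n. \<nu> $ i' $ n + 1))) $ i) k"
      using e(2) by (simp only: minus_prod_def scaleR_prod_def plus_prod_def fst_conv snd_conv D_iff) blast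
    then show ?thesis
      using e(1) by (auto simp: b_def by_index_def split: option.splits sum.splits)
  qed
  show ?thesis
  proof (rule exists_ad_b'_ge[OF _ _ b_pos _ _ V])
    fix i k
    \<comment> \<open>Only the slope of the \<open>k\<close>-th function of block \<open>i\<close>
      varies.\<close>
    define P where "P v = (\<alpha>, \<beta>, \<chi> i'. if i' = i \<and> k = None then v else y0 $ i',
      \<chi> i'. \<chi> j. if i' = i \<and> k = Some (Inl j) then v else y1 $ i' $ j,
      \<chi> i'. \<chi> n. if i' = i \<and> k = Some (Inr n) then v else y2 $ i' $ n, \<nu>)" for v
    have "affine_map P"
      by (auto simp: affine_map_def P_def vec_eq_iff algebra_simps)
    moreover have "P (y i k) = ?x"
      by (auto simp: P_def y_def vec_eq_iff)
    moreover have "P v \<in> D i \<longleftrightarrow> persp (conjugate (F i k)) v (b i k) < \<infinity>" for v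
    proof -
      have "P v \<in> D i \<longleftrightarrow> (\<forall>k'. persp (conjugate (F i k')) (if k' = k then v else y i k') (b i k') < \<infinity>)"
        unfolding P_def D_iff b_def[symmetric]
        by (intro all_cong1 arg_cong[where f = "\<lambda>w. persp _ w _ < \<infinity>"])
          (auto simp: by_index_def y_def split: option.split sum.split)
      also have "\<dots> \<longleftrightarrow> persp (conjugate (F i k)) v (b i k) < \<infinity>"
        using fin by (auto split: if_splits)
      finally show ?thesis .
    qed
    ultimately show "y i k /\<^sub>R b i k \<in> intrinsic_core (effective_domain (conjugate (F i k)))"
      using b_pos unfolding D_def by (intro intrinsic_core_persp_slice[OF ri[unfolded D_def]])
  qed (use feas that in \<open>auto simp: y_def b_def\<close>)
qed

text \<open>At weight 0 the point is a recession direction of a bounded set, hence 0. The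
  perspectives at the origin are support functions of nonempty sets at 0, so their upper bounds are
  nonnegative.\<close>

lemma ad_b'_bounded_zero_weight:
  assumes bounded: "bounded (supp_set c)"
    and x: "(\<tau>, lam, \<omega>, \<upsilon>) \<in> ad_b'_set g c h \<mu>" and i: "lam $ i = 0"
  shows "\<tau> $ i \<le> 0" "0 \<le> \<omega> $ i $ j"
proof -
  note X = x[unfolded mem_ad_b'_set_iff_family]
  obtain z where "z \<in> supp_set c"
    using Sbar_ne by (auto simp: Sbar_i_def)
  moreover have "persp (c n) (\<upsilon> $ i) 0 \<le> 0" for n
    using x i unfolding mem_ad_b'_set_iff by metis
  ultimately have "\<upsilon> $ i = 0"
    using recession_cone_bounded[OF pcc_c bounded] by blast
  then have persp: "persp (F i k) 0 0 \<le> ereal (by_index (- (\<tau> $ i)) (\<omega> $ i) 0 k)" for k :: "('j + 'l) option"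
    using X i by metis
  have nonneg: "0 \<le> by_index (- (\<tau> $ i)) (\<omega> $ i) 0 k" for k :: "('j + 'l) option"
  proof -
    obtain w s where "conjugate (F i k) w = ereal s"
      using conjugate_domain_nonempty[OF pcc_F] by blast
    then show ?thesis
      using conjunct2[OF persp[of k, unfolded persp_le_iff[OF pcc_F]], rule_format, of w s] by simp
  qed
  show "\<tau> $ i \<le> 0" "0 \<le> \<omega> $ i $ j"
    using nonneg[of None] nonneg[of "Some (Inl j)"] by simp_all
qed

lemma ad_b'_positive_weight_mem_Uset:
  assumes x: "(\<tau>, lam, \<omega>, \<upsilon>) \<in> ad_b'_set g c h \<mu>" and i: "0 < lam $ i"
  shows "(\<upsilon> $ i /\<^sub>R lam $ i, \<omega> $ i /\<^sub>R lam $ i, \<tau> $ i / lam $ i) \<in> Uset g c h i"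
  unfolding mem_Uset_iff
proof
  fix k
  have "F i k (\<upsilon> $ i /\<^sub>R lam $ i) \<le> ereal (by_index (- (\<tau> $ i)) (\<omega> $ i) 0 k / lam $ i)"
    using x unfolding mem_ad_b'_set_iff_family persp_le_pos(1)[OF i, symmetric] by blast
  also have "by_index (- (\<tau> $ i)) (\<omega> $ i) 0 k / lam $ i
      = by_index (- (\<tau> $ i / lam $ i)) (\<omega> $ i /\<^sub>R lam $ i) 0 k"
    by (auto simp: by_index_def divide_inverse_commute split: option.split sum.split)
  finally show "F i k (\<upsilon> $ i /\<^sub>R lam $ i)
      \<le> ereal (by_index (- (\<tau> $ i / lam $ i)) (\<omega> $ i /\<^sub>R lam $ i) 0 k)" .
qed

lemma Uset_nonempty: "Uset g c h i \<noteq> {}"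
proof -
  obtain z where z: "z \<in> Sbar_i g c h i"
    using Sbar_ne by blast
  have "\<exists>r. h j z \<le> ereal r" for j
    using z by (simp add: Sbar_i_def mem_effective_domain)
  then obtain u where u: "\<And>j. h j z \<le> ereal (u j)"
    by metis
  obtain t where "- g i z \<le> ereal t"
    using z by (auto simp: Sbar_i_def mem_effective_domain)
  then have "ereal (- t) \<le> g i z"
    using uminus_le_ereal_uminus_iff[of "g i z" "- t"] by simp
  then have "(z, \<chi> j. u j, - t) \<in> Uset g c h i"
    using u z by (simp add: Uset_def Sbar_i_def supp_set_def)
  then show ?thesis by blast
qed

text \<open>Components of positive weight are divided by it. One of weight 0 may be replaced by any
  point of \<open>Uset g c h i\<close>: it contributes 0, which is no worse than its former
  \<open>\<tau>\<close> and \<open>\<omega>\<close>.\<close>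

lemma ad_b'_le_ad_b:
  assumes bounded: "bounded (supp_set c)"
  shows "sup_value (ad_b'_set g c h \<mu>) ad_b'_obj \<le> sup_value (ad_b_set g c h \<mu>) ad_b_obj"
  unfolding sup_value_def
proof (rule SUP_least)
  fix x assume x: "x \<in> ad_b'_set g c h \<mu>"
  obtain \<tau> lam \<omega> \<upsilon> where x_eq: "x = (\<tau>, lam, \<omega>, \<upsilon>)"
    by (metis prod_cases4)
  note x = x[unfolded x_eq]
  note X = x[unfolded mem_ad_b'_set_iff]
  have "\<exists>z u t. (z, u, t) \<in> Uset g c h i \<and> lam $ i *\<^sub>R u \<le> \<omega> $ i \<and> \<tau> $ i \<le> lam $ i * t" for i
  proof (cases "lam $ i = 0")
    case True
    obtain z u t where "(z, u, t) \<in> Uset g c h i"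
      using Uset_nonempty[of i] by auto
    then show ?thesis
      using ad_b'_bounded_zero_weight[OF bounded x True] True
      by (intro exI[of _ z] exI[of _ u] exI[of _ t]) (auto simp: less_eq_vec_def)
  next
    case False
    then have i: "0 < lam $ i"
      using X by (metis order_le_neq_trans)
    show ?thesis
      using ad_b'_positive_weight_mem_Uset[OF x i] i
      by (intro exI[of _ "\<upsilon> $ i /\<^sub>R lam $ i"] exI[of _ "\<omega> $ i /\<^sub>R lam $ i"] exI[of _ "\<tau> $ i / lam $ i"]) simp
  qed
  then obtain z u t where U: "\<And>i. (z i, u i, t i) \<in> Uset g c h i" "\<And>i. lam $ i *\<^sub>R u i \<le> \<omega> $ i"
    "\<And>i. \<tau> $ i \<le> lam $ i * t i"
    by metis
  let ?y = "(lam, \<chi> i. z i, \<chi> i. u i, \<chi> i. t i)"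
  have "(\<Sum>i\<in>UNIV. lam $ i * u i $ j) \<le> \<mu> $ j" for j
  proof -
    have "lam $ i * u i $ j \<le> \<omega> $ i $ j" for i
      using U(2)[of i] by (simp add: less_eq_vec_def)
    then have "(\<Sum>i\<in>UNIV. lam $ i * u i $ j) \<le> (\<Sum>i\<in>UNIV. \<omega> $ i $ j)"
      by (rule sum_mono)
    then show ?thesis
      using X order_trans by blast
  qed
  then have "?y \<in> ad_b_set g c h \<mu>"
    using X U(1) by (simp add: ad_b_set_def)
  then have "ad_b_obj ?y \<le> Sup (ad_b_obj ` ad_b_set g c h \<mu>)"
    by (rule SUP_upper)
  moreover have "ad_b'_obj x \<le> ad_b_obj ?y"
    using U(3) by (simp add: x_eq ad_b_obj_def ad_b'_obj_def sum_mono)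
  ultimately show "ad_b'_obj x \<le> Sup (ad_b_obj ` ad_b_set g c h \<mu>)"
    by (rule order_trans[rotated])
qed

lemma slater_ap_w'_imp_values_equal:
  assumes slater: "slater_point_inf (ap_w'_obj \<mu>) (ap_w'_ineqs g c h) ap_w'_eqs p"
    and bounded: "bounded (supp_set c)"
  shows "all_values_equal g c h \<mu>" "solvable_sup (ad_b'_set g c h \<mu>) ad_b'_obj"
proof -
  let ?P = "inf_value (ap_w'_set g c h) (ap_w'_obj \<mu>)" and ?D = "sup_value (ad_b'_set g c h \<mu>) ad_b'_obj"
  have p: "p \<in> ap_w'_set g c h"
    using slater by (simp add: slater_point_inf_def slater_point_def ap_w'_set_def)
  have p_fin: "ap_w'_obj \<mu> p \<noteq> \<infinity>"
    by (auto simp: ap_w'_obj_def split: prod.split)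
  have "all_values_equal g c h \<mu> \<and> solvable_sup (ad_b'_set g c h \<mu>) ad_b'_obj"
  proof (cases ?P)
    case PInf
    have "?P \<le> ap_w'_obj \<mu> p"
      using p unfolding inf_value_def by (rule INF_lower)
    then show ?thesis
      using PInf p_fin by simp
  next
    \<comment> \<open>By weak duality (AD-B') is then infeasible, since its objective is real, and
      so solvable by convention.\<close>
    case MInf
    then have "?D = - \<infinity>"
      using ad_b'_le_ap_w' by simp
    then have "ad_b'_obj x = - \<infinity>" if "x \<in> ad_b'_set g c h \<mu>" for x
      using SUP_upper[OF that, of ad_b'_obj] by (simp add: sup_value_def)
    then show ?thesis
      using MInf by (auto simp: solvable_sup_def solves_sup_def intro: all_values_equalI)
  next
    case (real V)
    obtain \<alpha> \<beta> y0 y1 y2 \<nu> where p_eq: "p = (\<alpha>, \<beta>, y0, y1, y2, \<nu>)"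
      by (metis prod_cases6)
    obtain x where x: "x \<in> ad_b'_set g c h \<mu>" "?P \<le> ad_b'_obj x"
      using slater_ap_w'_imp_exists_ad_b'_ge[OF slater[unfolded p_eq]] real by (metis order_refl)
    have "ad_b'_obj x \<le> ?D"
      using x(1) unfolding sup_value_def by (rule SUP_upper)
    then have "?P \<le> ?D"
      using x(2) by (rule order_trans[rotated])
    moreover have "ad_b'_obj x \<noteq> - \<infinity>"
      by (auto simp: ad_b'_obj_def split: prod.split)
    ultimately show ?thesis
      unfolding solvable_sup_def using x ad_b'_le_ap_w' ad_b'_le_ad_b[OF bounded]
      by (intro conjI all_values_equalI exI[of _ x] solves_sup_I) (auto intro: order_trans)
  qed
  then show "all_values_equal g c h \<mu>" "solvable_sup (ad_b'_set g c h \<mu>) ad_b'_obj"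
    by auto
qed

lemma solves_ad_b'_imp_solves_p_uq:
  assumes eq: "all_values_equal g c h \<mu>" and bounded: "bounded (supp_set c)"
    and sol: "solves_sup (ad_b'_set g c h \<mu>) ad_b'_obj (\<tau>, lam, \<omega>, \<upsilon>)"
  shows "solves_sup (ambiguity_set c h \<mu>) (p_uq_obj g) (discrete_distribution lam \<upsilon>)"
proof -
  have val: "sup_value (ad_b'_set g c h \<mu>) ad_b'_obj = sup_value (ambiguity_set c h \<mu>) (p_uq_obj g)"
    using eq by (simp add: all_values_equal_def)
  show ?thesis
  proof (cases "ad_b'_set g c h \<mu> = {}")
    \<comment> \<open>Every point solves an infeasible (AD-B'). By the common value, no distribution
      in the ambiguity set has an objective other than \<open>- \<infinity>\<close>.\<close>
    case True
    then have "sup_value (ambiguity_set c h \<mu>) (p_uq_obj g) = - \<infinity>"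
      unfolding val[symmetric] by (simp add: sup_value_def bot_ereal_def)
    then have "p_uq_obj g M = - \<infinity>" if "M \<in> ambiguity_set c h \<mu>" for M
      using SUP_upper[OF that, of "p_uq_obj g"] by (simp add: sup_value_def)
    then show ?thesis
      by (auto simp: solves_sup_def)
  next
    case False
    have "ad_b'_obj x \<noteq> - \<infinity>" for x
      by (auto simp: ad_b'_obj_def split: prod.split)
    then have x: "(\<tau>, lam, \<omega>, \<upsilon>) \<in> ad_b'_set g c h \<mu>"
      and opt: "ad_b'_obj (\<tau>, lam, \<omega>, \<upsilon>) = sup_value (ad_b'_set g c h \<mu>) ad_b'_obj"
      using sol False unfolding solves_sup_def by blast+
    note X = x[unfolded mem_ad_b'_set_iff]
    let ?z = "\<lambda>i. \<upsilon> $ i /\<^sub>R lam $ i"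
    have "\<exists>H G. 0 < lam $ i \<longrightarrow> ?z i \<in> supp_set c \<and> (\<forall>j. h j (?z i) = ereal (H $ j) \<and> lam $ i * H $ j \<le> \<omega> $ i $ j) \<and>
        gmax g (?z i) = ereal G \<and> \<tau> $ i \<le> lam $ i * G" for i
    proof (cases "0 < lam $ i")
      case True
      note U = mem_Uset_imp_Sbar[OF ad_b'_positive_weight_mem_Uset[OF x True]]
      obtain H G where HG: "?z i \<in> supp_set c" "\<And>j. h j (?z i) = ereal (H $ j)" "gmax g (?z i) = ereal G"
        using mem_SbarE[OF U(1)] by blast
      have "lam $ i * H $ j \<le> \<omega> $ i $ j" for j
        using U(3)[of j] True unfolding HG(2) by (simp add: field_simps)
      moreover have "\<tau> $ i \<le> lam $ i * G"
        using U(2) True unfolding HG(3) by (simp add: field_simps)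
      ultimately show ?thesis
        using HG by blast
    qed auto
    then obtain H G where HG: "\<And>i. 0 < lam $ i \<Longrightarrow> ?z i \<in> supp_set c"
      "\<And>i j. 0 < lam $ i \<Longrightarrow> h j (?z i) = ereal (H i $ j)"
      "\<And>i j. 0 < lam $ i \<Longrightarrow> lam $ i * H i $ j \<le> \<omega> $ i $ j"
      "\<And>i. 0 < lam $ i \<Longrightarrow> gmax g (?z i) = ereal (G i)"
      "\<And>i. 0 < lam $ i \<Longrightarrow> \<tau> $ i \<le> lam $ i * G i"
      by metis
    have zero: "lam $ i = 0" if "\<not> 0 < lam $ i" for i
      using X that by (metis order_le_less)
    have "(\<Sum>i | 0 < lam $ i. lam $ i * H i $ j) \<le> \<mu> $ j" for j
    proof -
      have "(\<Sum>i | 0 < lam $ i. lam $ i * H i $ j) \<le> (\<Sum>i | 0 < lam $ i. \<omega> $ i $ j)"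
        using HG(3) by (intro sum_mono) auto
      \<comment> \<open>The terms of zero weight are nonnegative, so including them cannot lower the
        sum.\<close>
      also have "\<dots> \<le> (\<Sum>i\<in>UNIV. \<omega> $ i $ j)"
        using ad_b'_bounded_zero_weight(2)[OF bounded x zero] by (intro sum_mono2) auto
      also have "\<dots> \<le> \<mu> $ j"
        using X by blast
      finally show ?thesis .
    qed
    then have mem: "discrete_distribution lam \<upsilon> \<in> ambiguity_set c h \<mu>"
      using X HG by (intro discrete_distribution_ambiguity_set[where H = "\<lambda>i j. H i $ j"]) auto
    have obj: "p_uq_obj g (discrete_distribution lam \<upsilon>) = ereal (\<Sum>i | 0 < lam $ i. lam $ i * G i)"
      unfolding p_uq_obj_def using HG(4)
      by (intro ext_expectation_discrete_distribution borel_measurable_gmax)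
    have "(\<Sum>i\<in>UNIV. \<tau> $ i) \<le> (\<Sum>i | 0 < lam $ i. \<tau> $ i)"
    proof -
      \<comment> \<open>Components of zero weight have nonpositive \<open>\<tau>\<close>, so the
        distribution loses nothing by ignoring them.\<close>
      have "(\<Sum>i | 0 < lam $ i. - \<tau> $ i) \<le> (\<Sum>i\<in>UNIV. - \<tau> $ i)"
        using ad_b'_bounded_zero_weight(1)[OF bounded x zero] by (intro sum_mono2) auto
      then show ?thesis
        by (simp add: sum_negf)
    qed
    also have "\<dots> \<le> (\<Sum>i | 0 < lam $ i. lam $ i * G i)"
      using HG(5) by (intro sum_mono) auto
    finally have "ad_b'_obj (\<tau>, lam, \<omega>, \<upsilon>) \<le> p_uq_obj g (discrete_distribution lam \<upsilon>)"
      by (simp add: obj ad_b'_obj_def)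
    then show ?thesis
      using mem obj unfolding opt val by (intro solves_sup_I) auto
  qed
qed

end

theorem theorem11:
  fixes g :: "'i::finite \<Rightarrow> real^'n::finite \<Rightarrow> ereal"
    and c :: "'l::finite \<Rightarrow> real^'n \<Rightarrow> ereal"
    and h :: "'j::finite \<Rightarrow> real^'n \<Rightarrow> ereal"
    and \<mu> :: "real^'j"
  assumes g: "\<And>i. pcc_fun (\<lambda>z. - g i z)"
    and c: "\<And>l. pcc_fun (c l)"
    and h: "\<And>j. pcc_fun (h j)"
    and S_ne: "supp_set c \<noteq> {}"
    and P_ne: "ambiguity_set c h \<mu> \<noteq> {}"
    and Sbar_ne: "\<And>i. Sbar_i g c h i \<noteq> {}"
  shows
    "((\<exists>\<tau> lam \<omega> \<upsilon>.
         slater_point_sup ad_b'_obj (ad_b'_ineqs g c h \<mu>) ad_b'_eqs (\<tau>, lam, \<omega>, \<upsilon>) \<and>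
         (\<forall>i. 0 < lam $ i))
       \<longrightarrow>
       all_values_equal g c h \<mu> \<and>
       solvable_inf (ap_w'_set g c h) (ap_w'_obj \<mu>) \<and>
       (\<forall>\<alpha> \<beta> y0 y1 y2 \<nu>.
          solves_inf (ap_w'_set g c h) (ap_w'_obj \<mu>) (\<alpha>, \<beta>, y0, y1, y2, \<nu>) \<longrightarrow>
          solves_inf (d_uq_set g c h) (ab_obj \<mu>) (\<alpha>, \<beta>)))
     \<and>
     ((\<exists>x. slater_point_inf (ap_w'_obj \<mu>) (ap_w'_ineqs g c h) ap_w'_eqs x) \<and>
       bounded (supp_set c)
       \<longrightarrow>
       all_values_equal g c h \<mu> \<and>
       solvable_sup (ad_b'_set g c h \<mu>) ad_b'_obj \<and>
       (\<forall>\<tau> lam \<omega> \<upsilon>.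
          solves_sup (ad_b'_set g c h \<mu>) ad_b'_obj (\<tau>, lam, \<omega>, \<upsilon>) \<longrightarrow>
          solves_sup (ambiguity_set c h \<mu>) (p_uq_obj g) (discrete_distribution lam \<upsilon>)))"
proof -
  interpret uq g c h \<mu>
    using g c h Sbar_ne by unfold_locales
  show ?thesis
    using slater_ad_b'_imp_values_equal slater_ap_w'_imp_values_equal solves_ap_w'_imp_solves_d_uq solves_ad_b'_imp_solves_p_uq by blast
qed

end
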